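(* Let $d\in\mathbb{N}$, $n\in\mathbb{N}_0$, let $s=(s_\gamma)_{0\le|\gamma|\le 2n}$ ($\gamma\in\mathbb{N}_0^d$) be a given multisequence of real numbers and let $r:=\operatorname{rank}M(n)$. Let $\mathcal{B}=\{X^{\lambda^{(a)}}\}_{a=1}^r$ be a monomial basis of $\mathcal{C}_{M(n)}$. Then $s$ has an $r$-atomic quasi-complex representing measure $\mu=\sum_{a=1}^r\varrho_a\delta_{z^{(a)}}$ if and only if $M(n)$ has a rank preserving extension $M(n+1)$ such that the matrices $$T_j:=M_{\mathcal{B}}(n)^{-1}M_{\mathcal{B},\mathcal{B}+\mathrm{e}_j}(n+1),\qquad j=1,\ldots,d,$$ are all diagonalisable (over $\mathbb{C}$). In this case, for such an extension $M(n+1)$, the measure $\mu=\sum_{a=1}^r\varrho_a\delta_{z^{(a)}}$ can be taken such that $$\operatorname{supp}\mu=\mathcal{V}(M(n+1)),$$ and the weights can be computed (choosing $\mathcal{B}$ with $\lambda^{(1)}=0$) by $$(\varrho_1,\ldots,\varrho_r)^T=V_{\mathcal{B}}^{-T}M_{\mathcal{B}}(n)\,(1,0,\ldots,0)^T .$$ If, in addition, $\mathcal{V}(M(n+1))\subseteq\mathbb{R}^d$, then $\mu=\mu_+-\mu_-$ (Jordan decomposition) is a $\operatorname{rank}M(n)$-atomic signed representing measure for $s$ and $$\operatorname{card}\operatorname{supp}\mu_\pm=i_\pm(M(n)).$$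
   Context: For $\gamma\in\mathbb{N}_0^d$, $|\gamma|=\gamma_1+\cdots+\gamma_d$ and $z^\gamma=\prod_j z_j^{\gamma_j}$; $\mathrm{e}_j$ is the $j$-th standard unit multi-index. $d$-Hankel matrix: for a real multisequence $s=(s_\gamma)_{0\le|\gamma|\le 2m}$, $M(m)=(s_{\lambda+\xi})_{0\le|\lambda|,|\xi|\le m}$, a real symmetric matrix of size $\binom{m+d}{d}$ with rows and columns indexed by the monomials $X^\lambda$, $0\le|\lambda|\le m$ (in graded lexicographic order). $\mathcal{C}_{M(m)}$ is its column space, $X^\lambda\in\mathcal{C}_{M(m)}$ denotes the column indexed by $X^\lambda$, and for a polynomial $p(x)=\sum_{0\le|\lambda|\le m}p_\lambda x^\lambda$ one writes $p(X)=\sum p_\lambda X^\lambda\in\mathcal{C}_{M(m)}$. A rank preserving extension $M(n+1)$ of $M(n)$ is the $d$-Hankel matrix of an extended sequence $(s_\gamma)_{0\le|\gamma|\le 2n+2}$, for some choice of real numbers $(s_\gamma)_{2n+1\le|\gamma|\le 2n+2}$, such that $\operatorname{rank}M(n+1)=\operatorname{rank}M(n)$. For a set of monomials $\mathcal{B}=\{X^{\lambda^{(a)}}\}_{a=1}^r$ forming a basis of $\mathcal{C}_{M(n)}$, $M_{\mathcal{B}}(n)=(s_{\lambda^{(a)}+\lambda^{(b)}})_{a,b=1}^r$ is the (invertible) principal submatrix of $M(n)$ with rows and columns indexed by $\mathcal{B}$, and $M_{\mathcal{B},\mathcal{B}+\mathrm{e}_j}(n+1)=(s_{\lambda^{(a)}+\lambda^{(b)}+\mathrm{e}_j})_{a,b=1}^r$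 is the submatrix of $M(n+1)$ with rows indexed by $\mathcal{B}$ and columns indexed by $\mathcal{B}+\mathrm{e}_j=\{X^{\lambda^{(b)}+\mathrm{e}_j}\}_{b=1}^r$. For points $z^{(1)},\ldots,z^{(r)}\in\mathbb{C}^d$, $V_{\mathcal{B}}=((z^{(a)})^{\lambda^{(b)}})_{a,b=1}^r$, and $V_{\mathcal{B}}^{-T}=(V_{\mathcal{B}}^{T})^{-1}$. Variety: $\mathcal{V}(M(m))=\{z\in\mathbb{C}^d: p(z)=0$ for all real polynomials $p$ in $d$ variables of degree at most $m$ with $p(X)=\mathbf{0}\in\mathcal{C}_{M(m)}\}$. A quasi-complex measure is a (complex) Borel measure $\mu$ on $\mathbb{C}^d$ whose support is closed under complex conjugation ($z\in\operatorname{supp}\mu\iff\bar z\in\operatorname{supp}\mu$). It is a quasi-complex representing measure for $(s_\gamma)_{0\le|\gamma|\le 2n}$ if its moments up to degree $2n$ converge absolutely and $s_\gamma=\int_{\mathbb{C}^d}z^\gamma\,d\mu(z)$ for $0\le|\gamma|\le 2n$. It is $r$-atomic if $\mu=\sum_{a=1}^r\varrho_a\delta_{z^{(a)}}$ with $r$ distinct points $z^{(a)}$ and nonzero $\varrho_a\in\mathbb{C}$. If moreover $\mu$ is real-valued and $\operatorname{supp}\mu\subseteq\mathbb{R}^d$, it is called a signed representing measure. $i_+(A)$ and $i_-(A)$ are the numbers of positive and negative eigenvalues of a Hermitian matrix $A$, counted with multiplicity. *)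

theory Defs
  imports
    "HOL-Analysis.Analysis"
    "Jordan_Normal_Form.DL_Rank"
    "Jordan_Normal_Form.Char_Poly"
    "Jordan_Normal_Form.Gauss_Jordan_Elimination"
begin

text \<open>The dimension \<open>d\<close> is \<open>CARD('d)\<close>: multi-indices have type \<open>nat ^ 'd\<close> (so \<open>axis j 1\<close> is the
  \<open>j\<close>-th unit multi-index), points of \<open>\<complex>\<^sup>d\<close> have type \<open>complex ^ 'd\<close>. Matrices are those of
  \<open>Jordan_Normal_Form\<close>, indexed from \<open>0\<close>. The order on \<open>'d\<close> only serves to list
  the monomials.\<close>

type_synonym 'd mindex = "(nat, 'd) Finite_Cartesian_Product.vec"
type_synonym 'd cpoint = "(complex, 'd) Finite_Cartesian_Product.vec"

section \<open>Monomials\<close>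

definition mdeg :: "('d::finite) mindex \<Rightarrow> nat" where
  "mdeg g = (\<Sum>j\<in>UNIV. vec_nth g j)"

definition mono_at :: "('d::finite) mindex \<Rightarrow> 'd cpoint \<Rightarrow> complex" where
  "mono_at g z = (\<Prod>j\<in>UNIV. vec_nth z j ^ vec_nth g j)"

text \<open>\<open>1, X\<^sub>1, \<dots>, X\<^sub>d, X\<^sub>1\<^sup>2, X\<^sub>1X\<^sub>2, \<dots>\<close>: within one degree, the monomial with the larger
  exponent at the first difference comes first.\<close>
definition grlex :: "('d::{finite,linorder}) mindex \<Rightarrow> 'd mindex \<Rightarrow> bool" where
  "grlex l x \<longleftrightarrow> mdeg l < mdeg x \<or>
     (mdeg l = mdeg x \<and>
      (\<exists>j. vec_nth l j > vec_nth x j \<and>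
           (\<forall>i<j. vec_nth l i = vec_nth x i)))"

definition mono_list :: "nat \<Rightarrow> ('d::{finite,linorder}) mindex list" where
  "mono_list m = (THE xs. sorted_wrt grlex xs \<and> set xs = {l. mdeg l \<le> m})"

lemma grlex_irrefl: "\<not> grlex l l"
  by (simp add: grlex_def)

lemma grlex_trans:
  assumes "grlex a b" "grlex b c" shows "grlex a c"
proof (cases "mdeg a = mdeg b \<and> mdeg b = mdeg c")
  case True
  from assms(1) True obtain j where j: "vec_nth a j > vec_nth b j" "\<forall>i<j. vec_nth a i = vec_nth b i"
    by (auto simp: grlex_def)
  from assms(2) True obtain k where k: "vec_nth b k > vec_nth c k" "\<forall>i<k. vec_nth b i = vec_nth c i"
    by (auto simp: grlex_def)
  have "vec_nth a (min j k) > vec_nth c (min j k)"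
    using j k by (cases j k rule: linorder_cases) (auto simp: min_def)
  moreover have "\<forall>i<min j k. vec_nth a i = vec_nth c i" using j k by auto
  ultimately have "\<exists>i. vec_nth a i > vec_nth c i \<and> (\<forall>i'<i. vec_nth a i' = vec_nth c i')" by blast
  then show ?thesis using True unfolding grlex_def by simp
qed (use assms in \<open>auto simp: grlex_def\<close>)

lemma grlex_total:
  assumes "a \<noteq> b" shows "grlex a b \<or> grlex b a"
proof -
  let ?D = "{j. vec_nth a j \<noteq> vec_nth b j}"
  have ne: "?D \<noteq> {}" using assms by (auto simp: Finite_Cartesian_Product.vec_eq_iff)
  define j where "j = Min ?D"
  have "j \<in> ?D" unfolding j_def using ne by (intro Min_in) auto
  moreover have "\<forall>i<j. vec_nth a i = vec_nth b i"
  proof (intro allI impI)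
    fix i assume "i < j"
    then have "i \<notin> ?D" using Min_le[of ?D i] by (metis finite j_def not_less)
    then show "vec_nth a i = vec_nth b i" by simp
  qed
  ultimately show ?thesis unfolding grlex_def
    by (metis (mono_tags, lifting) linorder_neq_iff mem_Collect_eq)
qed

lemma finite_mdeg_le: "finite {l :: ('d::finite) mindex. mdeg l \<le> m}"
proof -
  have "{l :: 'd mindex. mdeg l \<le> m} \<subseteq> vec_lambda ` (UNIV \<rightarrow>\<^sub>E {..m})"
  proof
    fix l :: "'d mindex" assume "l \<in> {l. mdeg l \<le> m}"
    then have "vec_nth l j \<le> m" for j
      using member_le_sum[of j UNIV "vec_nth l"] by (simp add: mdeg_def)
    then have "vec_nth l \<in> UNIV \<rightarrow>\<^sub>E {..m}" by auto
    then show "l \<in> vec_lambda ` (UNIV \<rightarrow>\<^sub>E {..m})"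
      by (metis image_eqI vec_nth_inverse)
  qed
  then show ?thesis by (rule finite_subset) (auto intro!: finite_imageI finite_PiE)
qed

lemma ex_sorted_grlex:
  "finite S \<Longrightarrow> \<exists>xs. sorted_wrt grlex xs \<and> set xs = S"
proof (induction S rule: finite_induct)
  case (insert x S)
  then obtain xs where xs: "sorted_wrt grlex xs" "set xs = S" by blast
  let ?ys = "filter (\<lambda>y. grlex y x) xs @ x # filter (\<lambda>y. grlex x y) xs"
  have "set ?ys = insert x S" using xs(2) insert.hyps(2) grlex_total by auto
  moreover have "sorted_wrt grlex ?ys"
    using xs(1) by (auto simp: sorted_wrt_append sorted_wrt_filter intro: grlex_trans)
  ultimately show ?case by blast
qed simp

lemma sorted_grlex_unique:
  assumes "sorted_wrt grlex xs" "sorted_wrt grlex ys" "set xs = set ys"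
  shows "xs = ys"
  using assms
proof (induction xs arbitrary: ys)
  case (Cons x xs)
  then obtain y ys' where ys: "ys = y # ys'" by (cases ys) auto
  have xy: "x = y"
  proof (rule ccontr)
    assume "x \<noteq> y"
    then have "x \<in> set ys'" "y \<in> set xs" using Cons.prems(3) ys by auto
    then have "grlex y x" "grlex x y" using Cons.prems(1,2) ys by auto
    then show False using grlex_trans grlex_irrefl by blast
  qed
  have "x \<notin> set xs" "x \<notin> set ys'" using Cons.prems(1,2) ys xy grlex_irrefl by auto
  then have "set xs = set ys'" using Cons.prems(3) ys xy by auto
  then show ?case using Cons.IH[of ys'] Cons.prems ys xy by simp
qed simp

lemma mono_list_props:
  "sorted_wrt grlex (mono_list m :: ('d::{finite,linorder}) mindex list)"
  "set (mono_list m :: 'd mindex list) = {l. mdeg l \<le> m}"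
proof -
  have "\<exists>!xs. sorted_wrt grlex xs \<and> set xs = {l :: 'd mindex. mdeg l \<le> m}"
    using ex_sorted_grlex[OF finite_mdeg_le[of m]] by (auto intro: sorted_grlex_unique)
  from theI'[OF this] show "sorted_wrt grlex (mono_list m :: 'd mindex list)"
    "set (mono_list m) = {l :: 'd mindex. mdeg l \<le> m}"
    unfolding mono_list_def by blast+
qed

section \<open>Hankel matrices\<close>

text \<open>A multisequence \<open>(s\<^sub>\<gamma>)\<close>, \<open>|\<gamma>| \<le> 2m\<close>, is a total function of which only the values of degree at
  most \<open>2m\<close> are ever used.\<close>

definition hankel :: "(('d::{finite,linorder}) mindex \<Rightarrow> real) \<Rightarrow> nat \<Rightarrow> real mat" where
  "hankel s m = mat (length (mono_list m :: 'd mindex list))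
                    (length (mono_list m :: 'd mindex list))
                    (\<lambda>(i,k). s (mono_list m ! i + mono_list m ! k))"

definition hankel_rank :: "(('d::{finite,linorder}) mindex \<Rightarrow> real) \<Rightarrow> nat \<Rightarrow> nat" where
  "hankel_rank s m = vec_space.rank (dim_row (hankel s m)) (hankel s m)"

definition Xcol :: "(('d::{finite,linorder}) mindex \<Rightarrow> real) \<Rightarrow> nat \<Rightarrow> 'd mindex \<Rightarrow> real Matrix.vec" where
  "Xcol s m l = col (hankel s m) (THE k. k < length (mono_list m :: 'd mindex list) \<and> mono_list m ! k = l)"

lemma Xcol_eq:
  fixes s :: "('d::{finite,linorder}) mindex \<Rightarrow> real"
  assumes "mdeg l \<le> m"
  shows "Xcol s m l = Matrix.vec (dim_row (hankel s m)) (\<lambda>i. s (mono_list m ! i + l))"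
proof -
  let ?P = "\<lambda>k. k < length (mono_list m :: 'd mindex list) \<and> mono_list m ! k = l"
  have "l \<in> set (mono_list m)" using assms by (simp add: mono_list_props)
  then have ex: "\<exists>k. ?P k" by (auto simp: in_set_conv_nth)
  have lt: "\<not> i < k" if "?P i" "?P k" for i k
    using that sorted_wrt_nth_less[OF mono_list_props(1)[of m, where ?'d = 'd], of i k] grlex_irrefl[of l]
    by auto
  have un: "i = k" if "?P i" "?P k" for i k
    using lt[OF that] lt[OF that(2) that(1)] by simp
  obtain k where k: "?P k" using ex by blast
  have "(THE k. ?P k) = k"
    by (rule the_equality[where P = ?P, OF k]) (rule un[OF _ k])
  then have "?P (THE k. ?P k)" using k by simp
  then show ?thesis unfolding Xcol_def by (auto simp: hankel_def)
qed

definition column_space :: "(('d::{finite,linorder}) mindex \<Rightarrow> real) \<Rightarrow> nat \<Rightarrow> (real, real Matrix.vec) module" where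
  "column_space s m =
     (module_vec TYPE(real) (dim_row (hankel s m)))
       \<lparr>carrier := vec_space.col_space (dim_row (hankel s m)) (hankel s m)\<rparr>"

text \<open>A list \<open>B\<close> of exponents such that the family of columns \<open>X\<^sup>\<lambda>\<close>, \<open>\<lambda> \<in> B\<close>, is a basis of the column
  space; \<open>distinct\<close> excludes equal columns at different positions.\<close>
definition monomial_basis :: "(('d::{finite,linorder}) mindex \<Rightarrow> real) \<Rightarrow> nat \<Rightarrow> 'd mindex list \<Rightarrow> bool" where
  "monomial_basis s m B \<longleftrightarrow>
     (\<forall>l\<in>set B. mdeg l \<le> m) \<and> distinct (map (Xcol s m) B) \<and>
     vectorspace.basis class_ring (column_space s m) (Xcol s m ` set B)"

definition rank_preserving_extension ::
  "(('d::{finite,linorder}) mindex \<Rightarrow> real) \<Rightarrow> nat \<Rightarrow> ('d mindex \<Rightarrow> real) \<Rightarrow> bool" where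
  "rank_preserving_extension s n s' \<longleftrightarrow>
     (\<forall>g. mdeg g \<le> 2 * n \<longrightarrow> s' g = s g) \<and> hankel_rank s' (n + 1) = hankel_rank s n"

definition basis_mat :: "(('d::finite) mindex \<Rightarrow> real) \<Rightarrow> 'd mindex list \<Rightarrow> real mat" where
  "basis_mat s B = mat (length B) (length B) (\<lambda>(a,b). s (B ! a + B ! b))"

definition shifted_basis_mat :: "(('d::finite) mindex \<Rightarrow> real) \<Rightarrow> 'd mindex list \<Rightarrow> 'd \<Rightarrow> real mat" where
  "shifted_basis_mat s B j = mat (length B) (length B) (\<lambda>(a,b). s (B ! a + B ! b + axis j 1))"

definition minv :: "'a::field mat \<Rightarrow> 'a mat" where
  "minv A = the (mat_inverse A)"

definition T_mat ::
  "(('d::finite) mindex \<Rightarrow> real) \<Rightarrow> ('d mindex \<Rightarrow> real) \<Rightarrow> 'd mindex list \<Rightarrow> 'd \<Rightarrow> real mat" where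
  "T_mat s s' B j = minv (basis_mat s B) * shifted_basis_mat s' B j"

definition diagonalisable :: "'a::field mat \<Rightarrow> bool" where
  "diagonalisable A \<longleftrightarrow> (\<exists>D. diagonal_mat D \<and> similar_mat A D)"

definition vandermonde :: "('d::finite) mindex list \<Rightarrow> (nat \<Rightarrow> 'd cpoint) \<Rightarrow> complex mat" where
  "vandermonde B z = mat (length B) (length B) (\<lambda>(a,b). mono_at (B ! b) (z a))"

text \<open>A polynomial of degree at most \<open>m\<close> is given by its coefficients \<open>p l\<close>, \<open>mdeg l \<le> m\<close>.\<close>

definition poly_at :: "nat \<Rightarrow> (('d::finite) mindex \<Rightarrow> real) \<Rightarrow> 'd cpoint \<Rightarrow> complex" where
  "poly_at m p z = (\<Sum>l | mdeg l \<le> m. of_real (p l) * mono_at l z)"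

definition poly_col ::
  "(('d::{finite,linorder}) mindex \<Rightarrow> real) \<Rightarrow> nat \<Rightarrow> ('d mindex \<Rightarrow> real) \<Rightarrow> real Matrix.vec" where
  "poly_col s m p = finsum_vec TYPE(real) (dim_row (hankel s m))
     (\<lambda>l. p l \<cdot>\<^sub>v Xcol s m l) {l. mdeg l \<le> m}"

definition variety :: "(('d::{finite,linorder}) mindex \<Rightarrow> real) \<Rightarrow> nat \<Rightarrow> 'd cpoint set" where
  "variety s m = {z. \<forall>p. poly_col s m p = 0\<^sub>v (dim_row (hankel s m)) \<longrightarrow> poly_at m p z = 0}"

definition i_plus :: "real mat \<Rightarrow> nat" where
  "i_plus A = (\<Sum>x | eigenvalue A x \<and> x > 0. Polynomial.order x (char_poly A))"

definition i_minus :: "real mat \<Rightarrow> nat" where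
  "i_minus A = (\<Sum>x | eigenvalue A x \<and> x < 0. Polynomial.order x (char_poly A))"

section \<open>Complex measures\<close>

text \<open>Complex Borel measures are set functions of which only the values on Borel sets matter.\<close>

definition complex_measure :: "('a::topological_space set \<Rightarrow> complex) \<Rightarrow> bool" where
  "complex_measure \<mu> \<longleftrightarrow>
     (\<forall>A :: nat \<Rightarrow> 'a set. range A \<subseteq> sets borel \<longrightarrow> disjoint_family A \<longrightarrow>
        (\<lambda>i. \<mu> (A i)) sums \<mu> (\<Union>i. A i))"

text \<open>The set of points all of whose open neighbourhoods have positive total variation, i.e. contain
  a Borel set that is not null.\<close>
definition supp :: "('a::topological_space set \<Rightarrow> complex) \<Rightarrow> 'a set" where
  "supp \<mu> = {z. \<forall>U. open U \<longrightarrow> z \<in> U \<longrightarrow> (\<exists>A\<in>sets borel. A \<subseteq> U \<and> \<mu> A \<noteq> 0)}"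

definition pos_supp :: "'a::topological_space measure \<Rightarrow> 'a set" where
  "pos_supp P = {z. \<forall>U. open U \<longrightarrow> z \<in> U \<longrightarrow> emeasure P U \<noteq> 0}"

definition jordan_decomposition ::
  "('a::topological_space set \<Rightarrow> real) \<Rightarrow> 'a measure \<Rightarrow> 'a measure \<Rightarrow> bool" where
  "jordan_decomposition \<nu> P N \<longleftrightarrow>
     sets P = sets borel \<and> sets N = sets borel \<and> finite_measure P \<and> finite_measure N \<and>
     (\<forall>A\<in>sets borel. \<nu> A = measure P A - measure N A) \<and>
     (\<exists>H\<in>sets borel. emeasure P (- H) = 0 \<and> emeasure N H = 0)"

text \<open>Absolute convergence with respect to \<open>\<mu>\<close> amounts to integrability with respect to the four
  measures in the Jordan decompositions of the real and the imaginary part of \<open>\<mu>\<close>.\<close>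
definition has_cm_integral ::
  "('a::topological_space set \<Rightarrow> complex) \<Rightarrow> ('a \<Rightarrow> complex) \<Rightarrow> complex \<Rightarrow> bool" where
  "has_cm_integral \<mu> f I \<longleftrightarrow>
     (\<exists>P N P' N'. jordan_decomposition (\<lambda>A. Re (\<mu> A)) P N \<and>
        jordan_decomposition (\<lambda>A. Im (\<mu> A)) P' N' \<and>
        integrable P f \<and> integrable N f \<and> integrable P' f \<and> integrable N' f \<and>
        I = (integral\<^sup>L P f - integral\<^sup>L N f) + \<i> * (integral\<^sup>L P' f - integral\<^sup>L N' f))"

definition vec_cnj :: "('d::finite) cpoint \<Rightarrow> 'd cpoint" where
  "vec_cnj z = (\<chi> j. cnj (vec_nth z j))"

definition quasi_complex_measure :: "(('d::finite) cpoint set \<Rightarrow> complex) \<Rightarrow> bool" where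
  "quasi_complex_measure \<mu> \<longleftrightarrow> complex_measure \<mu> \<and> (\<forall>z. z \<in> supp \<mu> \<longleftrightarrow> vec_cnj z \<in> supp \<mu>)"

definition quasi_complex_representing ::
  "(('d::finite) mindex \<Rightarrow> real) \<Rightarrow> nat \<Rightarrow> ('d cpoint set \<Rightarrow> complex) \<Rightarrow> bool" where
  "quasi_complex_representing s n \<mu> \<longleftrightarrow>
     quasi_complex_measure \<mu> \<and>
     (\<forall>g. mdeg g \<le> 2 * n \<longrightarrow> has_cm_integral \<mu> (mono_at g) (of_real (s g)))"

definition real_points :: "('d::finite) cpoint set" where
  "real_points = {z. \<forall>j. vec_nth z j \<in> \<real>}"

definition signed_representing ::
  "(('d::finite) mindex \<Rightarrow> real) \<Rightarrow> nat \<Rightarrow> ('d cpoint set \<Rightarrow> complex) \<Rightarrow> bool" where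
  "signed_representing s n \<mu> \<longleftrightarrow>
     quasi_complex_representing s n \<mu> \<and> (\<forall>A\<in>sets borel. \<mu> A \<in> \<real>) \<and> supp \<mu> \<subseteq> real_points"

definition dirac :: "'a \<Rightarrow> 'a set \<Rightarrow> complex" where
  "dirac z A = indicator A z"

text \<open>\<open>\<mu> = \<Sum>\<^sub>a \<rho>\<^sub>a \<delta>\<^bsub>z\<^sub>a\<^esub>\<close> with \<open>r\<close> distinct points and nonzero weights, \<open>0 \<le> a < r\<close>.\<close>
definition atomic :: "nat \<Rightarrow> (nat \<Rightarrow> 'a::topological_space) \<Rightarrow> (nat \<Rightarrow> complex) \<Rightarrow>
    ('a set \<Rightarrow> complex) \<Rightarrow> bool" where
  "atomic r z w \<mu> \<longleftrightarrow>
     inj_on z {..<r} \<and> (\<forall>a<r. w a \<noteq> 0) \<and> (\<forall>A\<in>sets borel. \<mu> A = (\<Sum>a<r. w a * dirac (z a) A))"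

end

theory Submission
  imports Defs "Jordan_Normal_Form.Jordan_Normal_Form_Existence"
begin

text \<open>For a rank preserving extension, \<open>T\<^sub>j\<close> is the matrix of multiplication by the \<open>j\<close>-th variable on the
  column space, in the basis \<open>B\<close>. The \<open>T\<^sub>j\<close> commute and are self-adjoint for the symmetric bilinear form with
  matrix \<open>M\<^sub>B\<close>. If they are diagonalisable, the coordinate vector of the column \<open>1\<close> is a sum of joint
  eigenvectors \<open>u\<^sub>z\<close> with distinct joint eigenvalues \<open>z\<close>, and \<open>u\<^sub>z\<close>, \<open>u\<^sub>z\<^sub>'\<close> are orthogonal for the form when
  \<open>z \<noteq> z'\<close>. Hence \<open>s\<^sub>\<gamma> = \<Sum>\<^sub>z w\<^sub>z z\<^sup>\<gamma>\<close> with \<open>w\<^sub>z = \<langle>u\<^sub>z, u\<^sub>z\<rangle>\<close>, and counting dimensions shows that exactly \<open>r\<close> of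
  the \<open>w\<^sub>z\<close> are nonzero. Conversely, given atoms with Vandermonde matrix \<open>V\<close>, the conjugation symmetry of
  the support and the uniqueness of the weights make the extended moments real, and \<open>T\<^sub>j = V\<^sup>-\<^sup>1 Z\<^sub>j V\<close> with
  \<open>Z\<^sub>j\<close> diagonal. For real atoms, \<open>M = V\<^sup>T diag(w) V\<close> and Sylvester's law of inertia give the
  signature.\<close>

text \<open>The form is bilinear and not Hermitian, so a joint eigenvector can be isotropic, and
  self-adjointness alone does not make the \<open>T\<^sub>j\<close> diagonalisable; hence
  diagonalisability is a hypothesis, and weights have to be tested for zero. Rank preservation
  enters through one fact: in the rows up to degree \<open>n + 1\<close>, every column of degree at
  most \<open>n + 1\<close> is a combination of the columns of \<open>B\<close>. A product of two
  shifts can then be read with one shift on the row and the other on the column, which is why the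
  \<open>T\<^sub>j\<close> commute. Splitting only the vector of the column \<open>1\<close>, with
  the joint eigenvalues as labels, yields distinct atoms without choosing a joint eigenbasis. The
  count has two halves: orthogonal vectors that are not isotropic are independent, which bounds the
  atoms by \<open>r\<close>, and the invertible \<open>M\<^sub>B\<close> factors through the atoms,
  which forces \<open>r\<close> of them. In the converse, invertibility of \<open>V\<close> means
  that the moments of the monomials in \<open>B\<close> alone determine the weights.\<close>

unbundle no vec_syntax

section \<open>Linear systems\<close>

text \<open>Gaussian elimination of one equation and one unknown at a time. The index sets are
  arbitrary because points, basis positions and eigenvalue indices all occur in the dimension
  counts.\<close>

lemma homogeneous_system:
  fixes m :: "'i \<Rightarrow> 'j \<Rightarrow> 'a::field"
  assumes "finite I" "finite J" "card I < card J"
  shows "\<exists>x. (\<exists>j\<in>J. x j \<noteq> 0) \<and> (\<forall>i\<in>I. (\<Sum>j\<in>J. m i j * x j) = 0)"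
  using assms
proof (induction I arbitrary: J m rule: finite_induct)
  case empty
  then have "J \<noteq> {}" by auto
  then show ?case by (intro exI[of _ "\<lambda>_. 1"]) auto
next
  case (insert i0 I)
  show ?case
  proof (cases "\<forall>j\<in>J. m i0 j = 0")
    case True
    from insert have "card I < card J" by simp
    from insert.IH[OF insert.prems(1) this, of m] True show ?thesis by auto
  next
    case False
    then obtain j0 where j0: "j0 \<in> J" "m i0 j0 \<noteq> 0" by auto
    let ?J = "J - {j0}"
    have "card I < card ?J" using insert j0 by simp
    from insert.IH[OF _ this, of "\<lambda>i j. m i j - m i j0 * m i0 j / m i0 j0"] insert.prems(1)
    obtain x where x: "\<exists>j\<in>?J. x j \<noteq> 0"
      "\<And>i. i \<in> I \<Longrightarrow> (\<Sum>j\<in>?J. (m i j - m i j0 * m i0 j / m i0 j0) * x j) = 0" by auto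
    define t where "t = - (\<Sum>j\<in>?J. m i0 j * x j) / m i0 j0"
    define y where "y = x(j0 := t)"
    have split: "(\<Sum>j\<in>J. m i j * y j) = m i j0 * t + (\<Sum>j\<in>?J. m i j * x j)" for i
      using insert.prems(1) j0(1) by (subst sum.remove[of J j0]) (auto simp: y_def intro!: sum.cong)
    have "(\<Sum>j\<in>J. m i j * y j) = 0" if "i \<in> I" for i
    proof -
      have "0 = (\<Sum>j\<in>?J. m i j * x j) - (\<Sum>j\<in>?J. m i j0 / m i0 j0 * (m i0 j * x j))"
        using x(2)[OF that] by (simp add: left_diff_distrib sum_subtractf mult.assoc)
      also have "\<dots> = (\<Sum>j\<in>?J. m i j * x j) + m i j0 * t"
        by (simp add: t_def sum_distrib_left[symmetric] sum_divide_distrib[symmetric])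
      finally show ?thesis using split[of i] by (simp add: add.commute)
    qed
    moreover have "(\<Sum>j\<in>J. m i0 j * y j) = 0"
      using j0 unfolding split t_def by simp
    moreover have "\<exists>j\<in>J. y j \<noteq> 0" using x(1) by (auto simp: y_def)
    ultimately show ?thesis by (intro exI[of _ y]) auto
  qed
qed

lemma mult_mat_vec_index_sum:
  assumes "A \<in> carrier_mat nr nc" "v \<in> carrier_vec nc" "i < nr"
  shows "vec_index (A *\<^sub>v v) i = (\<Sum>j<nc. A $$ (i, j) * vec_index v j)"
  using assms by (auto simp: scalar_prod_def atLeast0LessThan intro!: sum.cong)

lemma mult_mat_index_sum:
  assumes "A \<in> carrier_mat nr k" "B \<in> carrier_mat k nc" "i < nr" "j < nc"
  shows "(A * B) $$ (i, j) = (\<Sum>l<k. A $$ (i, l) * B $$ (l, j))"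
  using assms by (auto simp: scalar_prod_def atLeast0LessThan intro!: sum.cong)

lemma det_nonzero_iff:
  fixes A :: "'a::field mat"
  assumes A: "A \<in> carrier_mat r r"
  shows "det A \<noteq> 0 \<longleftrightarrow> (\<forall>x. (\<forall>a<r. (\<Sum>b<r. A $$ (a, b) * x b) = 0) \<longrightarrow> (\<forall>b<r. x b = 0))"
proof -
  have eq: "(A *\<^sub>v v = 0\<^sub>v r) \<longleftrightarrow> (\<forall>a<r. (\<Sum>b<r. A $$ (a, b) * vec_index v b) = 0)" if "v \<in> carrier_vec r" for v
    using A that by (subst Matrix.vec_eq_iff) (auto simp: mult_mat_vec_index_sum[OF A that] simp del: index_mult_mat_vec)
  have z: "(v = 0\<^sub>v r) \<longleftrightarrow> (\<forall>b<r. vec_index v b = 0)" if "v \<in> carrier_vec r" for v :: "'a Matrix.vec"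
    using that by (subst Matrix.vec_eq_iff) auto
  have "det A = 0 \<longleftrightarrow> (\<exists>v. v \<in> carrier_vec r \<and> v \<noteq> 0\<^sub>v r \<and> A *\<^sub>v v = 0\<^sub>v r)"
    by (rule det_0_iff_vec_prod_zero[OF A])
  also have "\<dots> \<longleftrightarrow> \<not> (\<forall>x. (\<forall>a<r. (\<Sum>b<r. A $$ (a, b) * x b) = 0) \<longrightarrow> (\<forall>b<r. x b = 0))"
  proof
    assume "\<exists>v. v \<in> carrier_vec r \<and> v \<noteq> 0\<^sub>v r \<and> A *\<^sub>v v = 0\<^sub>v r"
    then obtain v where "v \<in> carrier_vec r" "v \<noteq> 0\<^sub>v r" "A *\<^sub>v v = 0\<^sub>v r" by blast
    then show "\<not> (\<forall>x. (\<forall>a<r. (\<Sum>b<r. A $$ (a, b) * x b) = 0) \<longrightarrow> (\<forall>b<r. x b = 0))"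
      using eq z by (auto intro!: exI[of _ "vec_index v"])
  next
    assume "\<not> (\<forall>x. (\<forall>a<r. (\<Sum>b<r. A $$ (a, b) * x b) = 0) \<longrightarrow> (\<forall>b<r. x b = 0))"
    then obtain x where x: "\<forall>a<r. (\<Sum>b<r. A $$ (a, b) * x b) = 0" "\<not> (\<forall>b<r. x b = 0)" by blast
    let ?v = "Matrix.vec r x"
    have "?v \<in> carrier_vec r" by simp
    moreover have "?v \<noteq> 0\<^sub>v r" using x(2) z[of ?v] by auto
    moreover have "A *\<^sub>v ?v = 0\<^sub>v r" using x(1) eq[of ?v] by simp
    ultimately show "\<exists>v. v \<in> carrier_vec r \<and> v \<noteq> 0\<^sub>v r \<and> A *\<^sub>v v = 0\<^sub>v r" by blast
  qed
  finally show ?thesis by blast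
qed

lemma det_nonzeroD:
  fixes A :: "'a::field mat"
  assumes "A \<in> carrier_mat r r" "det A \<noteq> 0" "\<And>a. a < r \<Longrightarrow> (\<Sum>b<r. A $$ (a, b) * x b) = 0" "b < r"
  shows "x b = 0"
  using det_nonzero_iff[OF assms(1), THEN iffD1, OF assms(2), THEN spec[of _ x]] assms(3,4) by simp

lemma minv_inverse:
  fixes A :: "'a::field mat"
  assumes A: "A \<in> carrier_mat r r" and "det A \<noteq> 0"
  shows "minv A \<in> carrier_mat r r" "A * minv A = 1\<^sub>m r" "minv A * A = 1\<^sub>m r"
proof -
  have "A \<in> Units (ring_mat TYPE('a) r undefined)"
    by (rule det_non_zero_imp_unit[OF A assms(2)])
  then obtain C where "mat_inverse A = Some C"
    using mat_inverse(1)[OF A, of undefined] by (cases "mat_inverse A") auto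
  from mat_inverse(2)[OF A this] this
  show "minv A \<in> carrier_mat r r" "A * minv A = 1\<^sub>m r" "minv A * A = 1\<^sub>m r"
    by (auto simp: minv_def)
qed

lemma det_nonzero_solve:
  fixes A :: "'a::field mat"
  assumes A: "A \<in> carrier_mat r r" and d: "det A \<noteq> 0"
  shows "\<exists>c. \<forall>a<r. (\<Sum>b<r. A $$ (a, b) * c b) = y a"
proof (intro exI allI impI)
  let ?y = "Matrix.vec r y"
  fix a assume a: "a < r"
  have M: "minv A \<in> carrier_mat r r" by (rule minv_inverse(1)[OF A d])
  have c: "minv A *\<^sub>v ?y \<in> carrier_vec r" using M by simp
  have "A *\<^sub>v (minv A *\<^sub>v ?y) = (A * minv A) *\<^sub>v ?y"
    by (rule assoc_mult_mat_vec[OF A M, symmetric]) simp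
  also have "\<dots> = ?y" unfolding minv_inverse(2)[OF A d] by (rule one_mult_mat_vec) simp
  finally have "vec_index (A *\<^sub>v (minv A *\<^sub>v ?y)) a = y a" using a by simp
  then show "(\<Sum>b<r. A $$ (a, b) * vec_index (minv A *\<^sub>v ?y) b) = y a"
    unfolding mult_mat_vec_index_sum[OF A c a] .
qed

section \<open>Columns of Hankel matrices\<close>

text \<open>A linear combination of the columns \<open>X\<^sup>\<lambda>\<close>, \<open>\<lambda> \<in> B\<close>, is given by a coefficient function on
  positions in \<open>B\<close>; its values outside \<open>{..<length B}\<close> are irrelevant.\<close>

definition indep :: "(('d::finite) mindex \<Rightarrow> real) \<Rightarrow> nat \<Rightarrow> 'd mindex list \<Rightarrow> bool" where
  "indep s m B \<longleftrightarrow> (\<forall>c. (\<forall>x. mdeg x \<le> m \<longrightarrow> (\<Sum>b<length B. c b * s (x + B ! b)) = 0) \<longrightarrow>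
     (\<forall>b<length B. c b = 0))"

definition spanning :: "(('d::finite) mindex \<Rightarrow> real) \<Rightarrow> nat \<Rightarrow> 'd mindex list \<Rightarrow> bool" where
  "spanning s m B \<longleftrightarrow> (\<forall>l. mdeg l \<le> m \<longrightarrow>
     (\<exists>c. \<forall>x. mdeg x \<le> m \<longrightarrow> s (x + l) = (\<Sum>b<length B. c b * s (x + B ! b))))"

text \<open>Two positions with the same column satisfy the relation with coefficients
  \<open>1\<close> and \<open>-1\<close>.\<close>

lemma indep_distinct:
  assumes "indep s m B" and deg: "\<forall>l\<in>set B. mdeg l \<le> m"
  shows "distinct (map (Xcol s m) B)"
proof (rule ccontr)
  assume "\<not> ?thesis"
  then obtain i j where ij: "i < length B" "j < length B" "i \<noteq> j" "Xcol s m (B ! i) = Xcol s m (B ! j)"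
    by (auto simp: distinct_conv_nth)
  have eq: "s (x + B ! i) = s (x + B ! j)" if "mdeg x \<le> m" for x
  proof -
    from that have "x \<in> set (mono_list m)" by (simp add: mono_list_props)
    then obtain k where k: "k < length (mono_list m :: 'a mindex list)" "mono_list m ! k = x"
      by (auto simp: in_set_conv_nth)
    have "mdeg (B ! i) \<le> m" "mdeg (B ! j) \<le> m" using deg ij by auto
    then have "vec_index (Xcol s m (B ! i)) k = s (x + B ! i)" "vec_index (Xcol s m (B ! j)) k = s (x + B ! j)"
      using k by (auto simp: Xcol_eq hankel_def)
    then show ?thesis using ij(4) by simp
  qed
  define c where "c b = (if b = i then 1 else if b = j then -1 else 0 :: real)" for b
  have "(\<Sum>b<length B. c b * s (x + B ! b)) = 0" if "mdeg x \<le> m" for x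
  proof -
    have "(\<Sum>b<length B. c b * s (x + B ! b)) = (\<Sum>b\<in>{i,j}. c b * s (x + B ! b))"
      using ij by (intro sum.mono_neutral_right) (auto simp: c_def)
    also have "\<dots> = 0" using ij(3) eq[OF that] by (simp add: c_def)
    finally show ?thesis .
  qed
  then have "c i = 0" using assms ij(1) unfolding indep_def by blast
  then show False by (simp add: c_def)
qed

context
  fixes s :: "('d::{finite,linorder}) mindex \<Rightarrow> real" and m :: nat
begin

lemma dim_hankel: "dim_row (hankel s m) = length (mono_list m :: 'd mindex list)"
  "dim_col (hankel s m) = length (mono_list m :: 'd mindex list)"
  by (simp_all add: hankel_def)

lemma Xcol_carrier: "mdeg l \<le> m \<Longrightarrow> Xcol s m l \<in> carrier_vec (dim_row (hankel s m))"
  by (simp add: Xcol_eq)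

lemma vec_eq_rows_iff:
  assumes "v \<in> carrier_vec (dim_row (hankel s m))" "w \<in> carrier_vec (dim_row (hankel s m))"
    and "\<And>i. i < dim_row (hankel s m) \<Longrightarrow> vec_index v i = f (mono_list m ! i :: 'd mindex)"
    and "\<And>i. i < dim_row (hankel s m) \<Longrightarrow> vec_index w i = g (mono_list m ! i :: 'd mindex)"
  shows "v = w \<longleftrightarrow> (\<forall>x. mdeg x \<le> m \<longrightarrow> f x = g x)"
proof -
  have "v = w \<longleftrightarrow> (\<forall>i<dim_row (hankel s m). f (mono_list m ! i :: 'd mindex) = g (mono_list m ! i))"
    using assms by (subst Matrix.vec_eq_iff) auto
  also have "\<dots> \<longleftrightarrow> (\<forall>x\<in>set (mono_list m). f x = g x)"
    by (auto simp: dim_hankel all_set_conv_all_nth)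
  finally show ?thesis by (simp add: mono_list_props)
qed

lemma set_cols_hankel: "set (cols (hankel s m)) = Xcol s m ` {l. mdeg l \<le> m}"
proof -
  have "cols (hankel s m) = map (Xcol s m) (mono_list m)"
  proof (rule nth_equalityI)
    fix i assume "i < length (cols (hankel s m))"
    then have i: "i < length (mono_list m :: 'd mindex list)" by (simp add: dim_hankel)
    then have "mono_list m ! i \<in> set (mono_list m :: 'd mindex list)" by simp
    then have d: "mdeg (mono_list m ! i :: 'd mindex) \<le> m" by (simp add: mono_list_props)
    show "cols (hankel s m) ! i = map (Xcol s m) (mono_list m) ! i"
      using i d by (auto simp: Xcol_eq dim_hankel) (auto simp: hankel_def Matrix.vec_eq_iff)
  qed (simp add: dim_hankel)
  then show ?thesis by (simp add: mono_list_props)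
qed

interpretation V: vec_space "TYPE(real)" "dim_row (hankel s m)" .

lemma lincomb_Xcol:
  assumes "\<forall>l\<in>set B. mdeg l \<le> m" "distinct (map (Xcol s m) B)"
  shows "V.lincomb a (Xcol s m ` set B) \<in> carrier_vec (dim_row (hankel s m))"
    and "i < dim_row (hankel s m) \<Longrightarrow> vec_index (V.lincomb a (Xcol s m ` set B)) i
      = (\<Sum>b<length B. a (Xcol s m (B ! b)) * s (mono_list m ! i + B ! b))"
proof -
  have c: "Xcol s m ` set B \<subseteq> carrier_vec (dim_row (hankel s m))" using assms(1) Xcol_carrier by auto
  then show "V.lincomb a (Xcol s m ` set B) \<in> carrier_vec (dim_row (hankel s m))"
    by (intro V.lincomb_closed) auto
  assume i: "i < dim_row (hankel s m)"
  have bij: "bij_betw (\<lambda>b. Xcol s m (B ! b)) {..<length B} (Xcol s m ` set B)"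
    using bij_betw_nth[OF assms(2), of "{..<length B}" "Xcol s m ` set B"]
    by (subst bij_betw_cong[where g = "(!) (map (Xcol s m) B)"]) auto
  have "vec_index (V.lincomb a (Xcol s m ` set B)) i = (\<Sum>x\<in>Xcol s m ` set B. a x * vec_index x i)"
    by (rule V.lincomb_index[OF i c])
  also have "\<dots> = (\<Sum>b<length B. a (Xcol s m (B ! b)) * vec_index (Xcol s m (B ! b)) i)"
    by (rule sum.reindex_bij_betw[OF bij, symmetric])
  also have "\<dots> = (\<Sum>b<length B. a (Xcol s m (B ! b)) * s (mono_list m ! i + B ! b))"
    using assms(1) i by (intro sum.cong) (auto simp: Xcol_eq)
  finally show "vec_index (V.lincomb a (Xcol s m ` set B)) i
      = (\<Sum>b<length B. a (Xcol s m (B ! b)) * s (mono_list m ! i + B ! b))" .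
qed

text \<open>\<open>lincomb\<close> weights vectors, whereas \<open>indep\<close> and
  \<open>spanning\<close> weight positions. Since different positions carry different columns, the
  weight of a position can be read off its column.\<close>

lemma coefficient_function:
  assumes "distinct (map (Xcol s m) B)"
  obtains a where "\<And>b. b < length B \<Longrightarrow> a (Xcol s m (B ! b)) = c b"
proof
  fix b assume "b < length B"
  with assms have "(THE k. k < length B \<and> Xcol s m (B ! k) = Xcol s m (B ! b)) = b"
    by (intro the_equality) (auto simp: distinct_conv_nth)
  then show "(\<lambda>v. c (THE k. k < length B \<and> Xcol s m (B ! k) = v)) (Xcol s m (B ! b)) = c b" by simp
qed

lemma lin_indpt_iff:
  assumes "\<forall>l\<in>set B. mdeg l \<le> m" and d: "distinct (map (Xcol s m) B)"
  shows "V.lin_indpt (Xcol s m ` set B) \<longleftrightarrow> indep s m B"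
proof -
  have c: "Xcol s m ` set B \<subseteq> carrier_vec (dim_row (hankel s m))" using assms(1) Xcol_carrier by auto
  have z: "V.lincomb a (Xcol s m ` set B) = 0\<^sub>v (dim_row (hankel s m)) \<longleftrightarrow>
     (\<forall>x. mdeg x \<le> m \<longrightarrow> (\<Sum>b<length B. a (Xcol s m (B ! b)) * s (x + B ! b)) = 0)" for a
    by (rule vec_eq_rows_iff) (use lincomb_Xcol[OF assms] in auto)
  show ?thesis
  proof
    assume li: "V.lin_indpt (Xcol s m ` set B)"
    show "indep s m B" unfolding indep_def
    proof (intro allI impI)
      fix c b assume c: "\<forall>x. mdeg x \<le> m \<longrightarrow> (\<Sum>b<length B. c b * s (x + B ! b)) = 0" and b: "b < length B"
      obtain a where a: "\<And>b. b < length B \<Longrightarrow> a (Xcol s m (B ! b)) = c b"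
        using coefficient_function[OF d] by blast
      have "V.lincomb a (Xcol s m ` set B) = 0\<^sub>v (dim_row (hankel s m))"
        unfolding z using c a by simp
      with li have "a (Xcol s m (B ! b)) = 0"
        using b unfolding V.lin_dep_def by (auto dest: nth_mem)
      then show "c b = 0" using a b by simp
    qed
  next
    assume i: "indep s m B"
    show "V.lin_indpt (Xcol s m ` set B)"
    proof (rule V.finite_lin_indpt2[OF _ c])
      fix a assume "V.lincomb a (Xcol s m ` set B) = 0\<^sub>v (dim_row (hankel s m))"
      with i have "\<forall>b<length B. a (Xcol s m (B ! b)) = 0"
        unfolding z indep_def by (rule_tac mp[OF spec[of _ "\<lambda>b. a (Xcol s m (B ! b))"]])
      then show "\<forall>v\<in>Xcol s m ` set B. a v = 0" by (auto simp: in_set_conv_nth)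
    qed simp
  qed
qed

lemma span_iff:
  assumes "\<forall>l\<in>set B. mdeg l \<le> m" and d: "distinct (map (Xcol s m) B)" and l: "mdeg l \<le> m"
  shows "Xcol s m l \<in> V.span (Xcol s m ` set B) \<longleftrightarrow>
    (\<exists>c. \<forall>x. mdeg x \<le> m \<longrightarrow> s (x + l) = (\<Sum>b<length B. c b * s (x + B ! b)))"
proof -
  have c: "Xcol s m ` set B \<subseteq> carrier_vec (dim_row (hankel s m))" using assms(1) Xcol_carrier by auto
  have z: "Xcol s m l = V.lincomb a (Xcol s m ` set B) \<longleftrightarrow>
     (\<forall>x. mdeg x \<le> m \<longrightarrow> s (x + l) = (\<Sum>b<length B. a (Xcol s m (B ! b)) * s (x + B ! b)))" for a
    by (rule vec_eq_rows_iff) (use lincomb_Xcol[OF assms(1,2)] l in \<open>auto simp: Xcol_eq\<close>)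
  have "Xcol s m l \<in> V.span (Xcol s m ` set B) \<longleftrightarrow> (\<exists>a. Xcol s m l = V.lincomb a (Xcol s m ` set B))"
    using V.finite_span[OF _ c] by auto
  also have "\<dots> \<longleftrightarrow> (\<exists>c. \<forall>x. mdeg x \<le> m \<longrightarrow> s (x + l) = (\<Sum>b<length B. c b * s (x + B ! b)))"
    (is "_ \<longleftrightarrow> (\<exists>c. ?P c)")
  proof
    assume "\<exists>c. ?P c"
    then obtain c where c: "?P c" by blast
    obtain a where "\<And>b. b < length B \<Longrightarrow> a (Xcol s m (B ! b)) = c b"
      using coefficient_function[OF d] by blast
    with c show "\<exists>a. Xcol s m l = V.lincomb a (Xcol s m ` set B)" by (intro exI[of _ a]) (simp add: z)
  qed (auto simp: z)
  finally show ?thesis .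
qed

text \<open>\<open>column_space\<close> is a module of its own, so its span and linear dependence
  are not literally those of the ambient space. Inside the span of all columns the notions agree,
  and bases can be checked in the ambient space.\<close>

lemma column_space_props:
  shows "column_space s m = V.span_vs (Xcol s m ` {l. mdeg l \<le> m})"
    and "vectorspace class_ring (column_space s m)"
    and "hankel_rank s m = vectorspace.dim class_ring (column_space s m)"
    and "vectorspace.fin_dim class_ring (column_space s m)"
    and "S \<subseteq> Xcol s m ` {l. mdeg l \<le> m} \<Longrightarrow> vectorspace.basis class_ring (column_space s m) S \<longleftrightarrow>
       V.lin_indpt S \<and> Xcol s m ` {l. mdeg l \<le> m} \<subseteq> V.span S"
    and "S \<subseteq> Xcol s m ` {l. mdeg l \<le> m} \<Longrightarrow>
      module.lin_dep class_ring (column_space s m) S = V.lin_dep S"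
proof -
  let ?X = "Xcol s m ` {l. mdeg l \<le> m}"
  show cs: "column_space s m = V.span_vs ?X"
    by (simp add: column_space_def V.col_space_def set_cols_hankel)
  have Xc: "?X \<subseteq> carrier_vec (dim_row (hankel s m))" using Xcol_carrier by auto
  have sub: "LinearCombinations.submodule class_ring (V.span ?X) V.V" by (rule V.span_is_submodule[OF Xc])
  show vs: "vectorspace class_ring (column_space s m)"
    unfolding cs using vectorspace_def V.submodule_is_module[OF sub] class_field by blast
  show "hankel_rank s m = vectorspace.dim class_ring (column_space s m)"
    by (simp add: hankel_rank_def V.rank_def cs set_cols_hankel)
  have "finite ?X" by (intro finite_imageI finite_mdeg_le)
  then show "vectorspace.fin_dim class_ring (column_space s m)"
    unfolding cs using Xc by (intro V.fin_dim_span) auto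
  assume S: "S \<subseteq> ?X"
  then have SS: "S \<subseteq> V.span ?X" using V.in_own_span[OF Xc] by blast
  note nd = V.span_li_not_depend[OF SS sub]
  show "module.lin_dep class_ring (column_space s m) S = V.lin_dep S"
    unfolding cs using nd(2) by simp
  have Sc: "S \<subseteq> carrier_vec (dim_row (hankel s m))" using S Xc by blast
  have "V.span S = V.span ?X \<longleftrightarrow> ?X \<subseteq> V.span S"
  proof
    assume "?X \<subseteq> V.span S"
    then have "V.span ?X \<subseteq> V.span S" by (rule V.span_is_subset[OF _ V.span_is_submodule[OF Sc]])
    moreover have "V.span S \<subseteq> V.span ?X" by (rule V.span_is_monotone[OF S])
    ultimately show "V.span S = V.span ?X" by blast
  qed (use V.in_own_span[OF Xc] in auto)
  then show "vectorspace.basis class_ring (column_space s m) S \<longleftrightarrow> V.lin_indpt S \<and> ?X \<subseteq> V.span S"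
    unfolding vectorspace.basis_def[OF vs] unfolding cs using nd SS by auto
qed

text \<open>From here on a monomial basis is a statement about sums of the numbers
  \<open>s (x + l)\<close>; vector spaces return only where the rank is counted.\<close>

theorem monomial_basis_iff:
  "monomial_basis s m B \<longleftrightarrow> (\<forall>l\<in>set B. mdeg l \<le> m) \<and> indep s m B \<and> spanning s m B"
proof (cases "(\<forall>l\<in>set B. mdeg l \<le> m) \<and> distinct (map (Xcol s m) B)")
  case True
  then have "Xcol s m ` set B \<subseteq> Xcol s m ` {l. mdeg l \<le> m}" by auto
  from column_space_props(5)[OF this] True show ?thesis
    unfolding monomial_basis_def spanning_def by (auto simp: lin_indpt_iff span_iff image_subset_iff)
next
  case False
  then show ?thesis using indep_distinct[of s m B] unfolding monomial_basis_def by auto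
qed

lemma monomial_basis_length:
  assumes "monomial_basis s m B"
  shows "length B = hankel_rank s m"
proof -
  have "vectorspace.dim class_ring (column_space s m) = card (Xcol s m ` set B)"
    using assms by (intro vectorspace.dim_basis[OF column_space_props(2)]) (auto simp: monomial_basis_def)
  also have "\<dots> = length B" using assms distinct_card[of "map (Xcol s m) B"] by (simp add: monomial_basis_def)
  finally show ?thesis by (simp add: column_space_props(3))
qed

text \<open>This is how rank preservation is used: in the extension, independence together with the
  right number of monomials yields spanning.\<close>

lemma monomial_basisI_rank:
  assumes "\<forall>l\<in>set B. mdeg l \<le> m" "indep s m B" "length B = hankel_rank s m"
  shows "monomial_basis s m B"
proof -
  have d: "distinct (map (Xcol s m) B)" by (rule indep_distinct[OF assms(2,1)])
  have sub: "Xcol s m ` set B \<subseteq> Xcol s m ` {l. mdeg l \<le> m}" using assms(1) by auto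
  have Xc: "Xcol s m ` {l. mdeg l \<le> m} \<subseteq> carrier_vec (dim_row (hankel s m))" using Xcol_carrier by auto
  have "vectorspace.basis class_ring (column_space s m) (Xcol s m ` set B)"
  proof (rule vectorspace.dim_li_is_basis[OF column_space_props(2) column_space_props(4)])
    show "Xcol s m ` set B \<subseteq> carrier (column_space s m)"
      using sub V.in_own_span[OF Xc] unfolding column_space_props(1) by auto
    show "module.lin_indpt class_ring (column_space s m) (Xcol s m ` set B)"
      using column_space_props(6)[OF sub] lin_indpt_iff[OF assms(1) d] assms(2) by simp
    show "vectorspace.dim class_ring (column_space s m) \<le> card (Xcol s m ` set B)"
      using assms(3) distinct_card[OF d] by (simp add: column_space_props(3))
  qed simp
  then show ?thesis using d assms(1) by (simp add: monomial_basis_def)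
qed

end

text \<open>The rows with exponents in \<open>B\<close> already form a nonsingular system for the
  coefficients.\<close>

lemma indep_of_det:
  assumes deg: "\<forall>l\<in>set B. mdeg l \<le> m" and det: "det (basis_mat s B) \<noteq> 0"
  shows "indep s m B"
  unfolding indep_def
proof (intro allI impI)
  fix c b assume c: "\<forall>x. mdeg x \<le> m \<longrightarrow> (\<Sum>b<length B. c b * s (x + B ! b)) = 0" and b: "b < length B"
  have "basis_mat s B \<in> carrier_mat (length B) (length B)" by (simp add: basis_mat_def)
  moreover have "(\<Sum>b<length B. basis_mat s B $$ (a, b) * c b) = 0" if "a < length B" for a
    using c deg that by (auto simp: basis_mat_def mult.commute)
  ultimately show "c b = 0" using det b by (metis det_nonzeroD)
qed

text \<open>A kernel vector of the block is killed by the rows in \<open>B\<close>. By symmetry,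
  relations between columns are also relations between rows, so it is killed by every row and is
  itself a relation between the columns of \<open>B\<close>.\<close>

lemma det_basis_mat:
  assumes deg: "\<forall>l\<in>set B. mdeg l \<le> m" and "indep s m B" "spanning s m B"
  shows "det (basis_mat s B) \<noteq> 0"
proof -
  have car: "basis_mat s B \<in> carrier_mat (length B) (length B)" by (simp add: basis_mat_def)
  show ?thesis unfolding det_nonzero_iff[OF car]
  proof (rule allI, rule impI)
    fix x assume x: "\<forall>a<length B. (\<Sum>b<length B. basis_mat s B $$ (a, b) * x b) = 0"
    have "(\<Sum>b<length B. x b * s (l + B ! b)) = 0" if "mdeg l \<le> m" for l
    proof -
      obtain c where c: "\<And>x. mdeg x \<le> m \<Longrightarrow> s (x + l) = (\<Sum>b<length B. c b * s (x + B ! b))"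
        using assms(3) \<open>mdeg l \<le> m\<close> unfolding spanning_def by blast
      have "(\<Sum>b<length B. x b * s (l + B ! b)) = (\<Sum>b<length B. x b * (\<Sum>a<length B. c a * s (B ! b + B ! a)))"
        using deg by (intro sum.cong refl) (simp add: c[symmetric] add.commute)
      also have "\<dots> = (\<Sum>a<length B. c a * (\<Sum>b<length B. basis_mat s B $$ (a, b) * x b))"
        unfolding sum_distrib_left by (subst sum.swap, intro sum.cong refl) (simp add: basis_mat_def add.commute)
      also have "\<dots> = 0" using x by simp
      finally show ?thesis .
    qed
    with assms(2) show "\<forall>b<length B. x b = 0" unfolding indep_def by blast
  qed
qed

lemma monomial_basis_of_det:
  assumes "\<forall>l\<in>set B. mdeg l \<le> m" "det (basis_mat s B) \<noteq> 0" "spanning s m B"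
  shows "monomial_basis s m B"
  using assms indep_of_det[OF assms(1,2)] by (simp add: monomial_basis_iff)

lemma indep_append:
  assumes ind: "indep s m B" and l: "mdeg l \<le> m"
    and no: "\<not> (\<exists>c. \<forall>x. mdeg x \<le> m \<longrightarrow> s (x + l) = (\<Sum>b<length B. c b * s (x + B ! b)))"
  shows "indep s m (B @ [l])"
  unfolding indep_def
proof (rule allI, rule impI)
  fix c assume c: "\<forall>x. mdeg x \<le> m \<longrightarrow> (\<Sum>b<length (B @ [l]). c b * s (x + (B @ [l]) ! b)) = 0"
  have split: "(\<Sum>b<length (B @ [l]). c b * s (x + (B @ [l]) ! b)) =
    (\<Sum>b<length B. c b * s (x + B ! b)) + c (length B) * s (x + l)" for x
    by (simp add: nth_append)
  have cl: "c (length B) = 0"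
  proof (rule ccontr)
    assume nz: "c (length B) \<noteq> 0"
    have "s (x + l) = (\<Sum>b<length B. - c b / c (length B) * s (x + B ! b))" if "mdeg x \<le> m" for x
    proof -
      have "c (length B) * s (x + l) = - (\<Sum>b<length B. c b * s (x + B ! b))"
        using c that unfolding split by (simp add: add_eq_0_iff)
      then have "s (x + l) = - (\<Sum>b<length B. c b * s (x + B ! b)) / c (length B)"
        using nz by (simp add: field_simps)
      then show ?thesis by (simp add: sum_divide_distrib sum_negf)
    qed
    then have "\<forall>x. mdeg x \<le> m \<longrightarrow> s (x + l) = (\<Sum>b<length B. - c b / c (length B) * s (x + B ! b))"
      by blast
    then have "\<exists>c. \<forall>x. mdeg x \<le> m \<longrightarrow> s (x + l) = (\<Sum>b<length B. c b * s (x + B ! b))"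
      by (rule exI[where x = "\<lambda>b. - c b / c (length B)"])
    with no show False by (rule notE)
  qed
  have "\<forall>x. mdeg x \<le> m \<longrightarrow> (\<Sum>b<length B. c b * s (x + B ! b)) = 0"
    using c unfolding split cl by simp
  with ind have "\<forall>b<length B. c b = 0" unfolding indep_def by (rule_tac mp[OF spec[of _ c]])
  with cl show "\<forall>b<length (B @ [l]). c b = 0" by (auto simp: less_Suc_eq)
qed

text \<open>Needed to find a basis that starts with the monomial \<open>1\<close>. The process stops
  because the columns of an independent list are distinct, so the list is no longer than the number
  of monomials.\<close>

lemma indep_extend_basis:
  fixes s :: "('d::{finite,linorder}) mindex \<Rightarrow> real"
  assumes "indep s m B" "\<forall>l\<in>set B. mdeg l \<le> m"
  shows "\<exists>B'. monomial_basis s m (B @ B')"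
  using assms
proof (induction "card {l :: 'd mindex. mdeg l \<le> m} - length B" arbitrary: B rule: less_induct)
  case less
  show ?case
  proof (cases "spanning s m B")
    case True
    then show ?thesis using less.prems by (intro exI[of _ "[]"]) (simp add: monomial_basis_iff)
  next
    case False
    then obtain l where l: "mdeg l \<le> m"
      "\<not> (\<exists>c. \<forall>x. mdeg x \<le> m \<longrightarrow> s (x + l) = (\<Sum>b<length B. c b * s (x + B ! b)))"
      unfolding spanning_def by blast
    have ind: "indep s m (B @ [l])" by (rule indep_append[OF less.prems(1) l])
    have deg: "\<forall>l\<in>set (B @ [l]). mdeg l \<le> m" using less.prems(2) l(1) by auto
    have "distinct (B @ [l])" using indep_distinct[OF ind deg] by (simp only: distinct_map)
    then have "length (B @ [l]) = card (set (B @ [l]))" by (rule distinct_card[symmetric])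
    also have "\<dots> \<le> card {l :: 'd mindex. mdeg l \<le> m}"
      using deg by (intro card_mono finite_mdeg_le) auto
    finally have "card {l :: 'd mindex. mdeg l \<le> m} - length (B @ [l]) < card {l :: 'd mindex. mdeg l \<le> m} - length B"
      by simp
    from less.hyps[OF this ind deg] show ?thesis by auto
  qed
qed

lemma monomial_basis_det:
  assumes "monomial_basis s m B"
  shows "det (basis_mat s B) \<noteq> 0"
  using assms det_basis_mat[of B m s] by (simp add: monomial_basis_iff)

section \<open>Monomials\<close>

lemma mdeg_simps [simp]: "mdeg 0 = 0" "mdeg (x + y) = mdeg x + mdeg y" "mdeg (axis j (Suc 0)) = 1"
  for x y :: "('d::finite) mindex"
  by (simp_all add: mdeg_def sum.distrib axis_def)

lemma mono_at_simps [simp]: "mono_at 0 z = 1" "mono_at (x + y) z = mono_at x z * mono_at y z"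
  "mono_at (axis j (Suc 0)) z = vec_nth z j" for x y :: "('d::finite) mindex"
proof -
  show "mono_at 0 z = 1" by (simp add: mono_at_def)
  show "mono_at (x + y) z = mono_at x z * mono_at y z"
    by (simp add: mono_at_def power_add prod.distrib)
  have "mono_at (axis j (Suc 0)) z = (\<Prod>i\<in>UNIV. if i = j then vec_nth z j else 1)"
    unfolding mono_at_def by (intro prod.cong) (auto simp: axis_def)
  then show "mono_at (axis j (Suc 0)) z = vec_nth z j" by simp
qed

lemma mono_at_cnj: "mono_at l (vec_cnj x) = cnj (mono_at l x)"
  by (simp add: mono_at_def vec_cnj_def cnj_prod)

lemma mindex_Suc_cases:
  fixes l :: "('d::finite) mindex"
  assumes "mdeg l = Suc k"
  obtains l' j where "l = l' + axis j 1" "mdeg l' = k"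
proof -
  have "\<exists>j. vec_nth l j \<noteq> 0"
  proof (rule ccontr)
    assume "\<not> ?thesis"
    then have "mdeg l = 0" by (simp add: mdeg_def)
    with assms show False by simp
  qed
  then obtain j where j: "vec_nth l j \<noteq> 0" by blast
  have l: "l = (l - axis j 1) + axis j 1"
    using j by (auto simp: Finite_Cartesian_Product.vec_eq_iff axis_def)
  then have "mdeg l = mdeg (l - axis j 1) + 1" by (metis One_nat_def mdeg_simps(2,3))
  then show ?thesis using that[OF l] assms by simp
qed

lemma mindex_induct [case_names zero step]:
  fixes l :: "('d::finite) mindex"
  assumes "P 0" "\<And>l j. P l \<Longrightarrow> P (l + axis j 1)"
  shows "P l"
proof (induction "mdeg l" arbitrary: l)
  case 0
  then have "l = 0" by (simp add: mdeg_def Finite_Cartesian_Product.vec_eq_iff)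
  then show ?case using assms(1) by simp
next
  case (Suc k)
  from mindex_Suc_cases[OF Suc.hyps(2)[symmetric]] Suc.hyps(1) assms(2) show ?case by metis
qed

text \<open>Applied with \<open>a = b = n + 1\<close>, it turns a moment of degree at most
  \<open>2 * (n + 1)\<close> into an entry of the Hankel matrix of order
  \<open>n + 1\<close>.\<close>

lemma mindex_split:
  fixes l :: "('d::finite) mindex"
  assumes "mdeg l \<le> a + b"
  obtains x y where "l = x + y" "mdeg x \<le> a" "mdeg y \<le> b"
proof -
  have "\<exists>x y. l = x + y \<and> mdeg x \<le> a \<and> mdeg y \<le> b"
    using assms
  proof (induction a arbitrary: l)
    case 0
    then show ?case by (rule_tac x = 0 in exI, rule_tac x = l in exI) simp
  next
    case (Suc a)
    show ?case
    proof (cases "mdeg l")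
      case 0
      then show ?thesis by (rule_tac x = 0 in exI, rule_tac x = l in exI) simp
    next
      case (Suc k)
      then obtain l' j where l: "l = l' + axis j 1" "mdeg l' = k" by (rule mindex_Suc_cases)
      with Suc Suc.prems have "mdeg l' \<le> a + b" by simp
      from Suc.IH[OF this] obtain x y where "l' = x + y" "mdeg x \<le> a" "mdeg y \<le> b" by blast
      then show ?thesis using l by (rule_tac x = "x + axis j 1" in exI, rule_tac x = y in exI) (simp add: add_ac)
    qed
  qed
  then show ?thesis using that by blast
qed

section \<open>Joint eigenvectors of commuting diagonalisable matrices\<close>

text \<open>\<open>E t\<close> is the spectral projection of \<open>A\<close> for \<open>t\<close>,
  and zero if \<open>t\<close> is not an eigenvalue. In an eigenbasis, a matrix commuting with
  \<open>A\<close> has no entries between different eigenvalues, so it commutes with the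
  projections.\<close>

lemma diagonalisable_projections:
  fixes A :: "'a::field mat"
  assumes A: "A \<in> carrier_mat r r" and "diagonalisable A"
  shows "\<exists>S E. finite S \<and> (\<forall>t. E t \<in> carrier_mat r r) \<and> (\<forall>t. A * E t = t \<cdot>\<^sub>m E t) \<and>
    (\<forall>i<r. \<forall>j<r. (\<Sum>t\<in>S. E t $$ (i, j)) = (if i = j then 1 else 0)) \<and>
    (\<forall>t C. C \<in> carrier_mat r r \<longrightarrow> A * C = C * A \<longrightarrow> C * E t = E t * C)"
proof -
  from assms obtain D P Q where D: "diagonal_mat D" and w: "similar_mat_wit A D P Q"
    unfolding diagonalisable_def similar_mat_def by blast
  have car: "D \<in> carrier_mat r r" "P \<in> carrier_mat r r" "Q \<in> carrier_mat r r"
    and PQ: "P * Q = 1\<^sub>m r" "Q * P = 1\<^sub>m r" and eq: "A = P * D * Q"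
    using w A unfolding similar_mat_wit_def Let_def by auto
  note as = assoc_mult_mat[of _ r r _ r _ r] mult_carrier_mat[of _ r r _ r]
    left_mult_one_mat[of _ r r] right_mult_one_mat[of _ r r]
  define F where "F t = mat r r (\<lambda>(i, j). if i = j \<and> D $$ (i, i) = t then 1 else 0 :: 'a)" for t
  define E where "E t = P * F t * Q" for t
  have F: "F t \<in> carrier_mat r r" for t by (simp add: F_def)
  have ind: "(G * F t) $$ (i, j) = (if D $$ (j, j) = t then G $$ (i, j) else 0)"
    "(F t * G) $$ (i, j) = (if D $$ (i, i) = t then G $$ (i, j) else 0)"
    if "G \<in> carrier_mat r r" "i < r" "j < r" for G t i j
  proof -
    have "(G * F t) $$ (i, j) = (\<Sum>l<r. if l = j then (if D $$ (j, j) = t then G $$ (i, j) else 0) else 0)"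
      unfolding mult_mat_index_sum[OF that(1) F that(2,3)] using that
      by (intro sum.cong) (auto simp: F_def)
    then show "(G * F t) $$ (i, j) = (if D $$ (j, j) = t then G $$ (i, j) else 0)" using that by simp
    have "(F t * G) $$ (i, j) = (\<Sum>l<r. if l = i then (if D $$ (i, i) = t then G $$ (i, j) else 0) else 0)"
      unfolding mult_mat_index_sum[OF F that(1) that(2,3)] using that
      by (intro sum.cong) (auto simp: F_def)
    then show "(F t * G) $$ (i, j) = (if D $$ (i, i) = t then G $$ (i, j) else 0)" using that by simp
  qed
  have Doff: "D $$ (i, j) = 0" if "i < r" "j < r" "i \<noteq> j" for i j
    using D car(1) that by (auto simp: diagonal_mat_def)
  have Dl: "(G * D) $$ (i, j) = G $$ (i, j) * D $$ (j, j)" "(D * G) $$ (i, j) = D $$ (i, i) * G $$ (i, j)"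
    if "G \<in> carrier_mat r r" "i < r" "j < r" for G i j
  proof -
    have "(G * D) $$ (i, j) = (\<Sum>l<r. if l = j then G $$ (i, j) * D $$ (j, j) else 0)"
      unfolding mult_mat_index_sum[OF that(1) car(1) that(2,3)] using that Doff
      by (intro sum.cong) auto
    then show "(G * D) $$ (i, j) = G $$ (i, j) * D $$ (j, j)" using that by simp
    have "(D * G) $$ (i, j) = (\<Sum>l<r. if l = i then D $$ (i, i) * G $$ (i, j) else 0)"
      unfolding mult_mat_index_sum[OF car(1) that(1) that(2,3)] using that Doff
      by (intro sum.cong) auto
    then show "(D * G) $$ (i, j) = D $$ (i, i) * G $$ (i, j)" using that by simp
  qed
  show ?thesis
  proof (rule exI[of _ "(\<lambda>i. D $$ (i, i)) ` {..<r}"], rule exI[of _ E], intro conjI allI impI)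
    show "finite ((\<lambda>i. D $$ (i, i)) ` {..<r})" by simp
    show E: "E t \<in> carrier_mat r r" for t using car F by (simp add: E_def as)
    show "A * E t = t \<cdot>\<^sub>m E t" for t
    proof -
      have "D * F t = t \<cdot>\<^sub>m F t"
      proof (rule eq_matI)
        fix i j assume "i < dim_row (t \<cdot>\<^sub>m F t)" "j < dim_col (t \<cdot>\<^sub>m F t)"
        then have ij: "i < r" "j < r" by (simp_all add: F_def)
        show "(D * F t) $$ (i, j) = (t \<cdot>\<^sub>m F t) $$ (i, j)"
          unfolding ind(1)[OF car(1) ij] using ij Doff[OF ij] by (auto simp: F_def)
      qed (use car F[of t] in auto)
      have "A * E t = P * D * (Q * P) * F t * Q" using car F by (simp add: eq E_def as)
      also have "\<dots> = P * (D * F t) * Q" using car F unfolding PQ(2) by (simp add: as)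
      also have "\<dots> = t \<cdot>\<^sub>m E t" unfolding \<open>D * F t = t \<cdot>\<^sub>m F t\<close> E_def
        using car F by (simp add: mult_smult_distrib[of _ r r _ r] mult_smult_assoc_mat[of _ r r _ r])
      finally show ?thesis .
    qed
    show "(\<Sum>t\<in>(\<lambda>i. D $$ (i, i)) ` {..<r}. E t $$ (i, j)) = (if i = j then 1 else 0)"
      if ij: "i < r" "j < r" for i j
    proof -
      have "(\<Sum>t\<in>(\<lambda>i. D $$ (i, i)) ` {..<r}. E t $$ (i, j)) =
        (\<Sum>t\<in>(\<lambda>i. D $$ (i, i)) ` {..<r}. \<Sum>l<r. (if D $$ (l, l) = t then P $$ (i, l) else 0) * Q $$ (l, j))"
        unfolding E_def using car F ij
        by (intro sum.cong refl) (subst mult_mat_index_sum[of _ r r], auto simp: ind(1) simp del: index_mult_mat(1))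
      also have "\<dots> = (\<Sum>l<r. \<Sum>t\<in>(\<lambda>i. D $$ (i, i)) ` {..<r}. if D $$ (l, l) = t then P $$ (i, l) * Q $$ (l, j) else 0)"
        by (subst sum.swap) (intro sum.cong refl, auto)
      also have "\<dots> = (\<Sum>l<r. P $$ (i, l) * Q $$ (l, j))"
        by (intro sum.cong refl) auto
      also have "\<dots> = (P * Q) $$ (i, j)" using mult_mat_index_sum[OF car(2,3) ij] by simp
      finally show ?thesis using ij by (simp add: PQ)
    qed
    show "C * E t = E t * C" if C: "C \<in> carrier_mat r r" and comm: "A * C = C * A" for t C
    proof -
      \<comment> \<open>The matrix of \<open>C\<close> in the eigenbasis given by the columns of
        \<open>P\<close>.\<close>
      define G where "G = Q * C * P"
      have G: "G \<in> carrier_mat r r" using car C by (simp add: G_def as)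
      have PG: "P * G = C * P"
      proof -
        have "P * G = (P * Q) * (C * P)" using car C by (simp add: G_def as)
        then show ?thesis using car C unfolding PQ(1) by (simp add: as)
      qed
      have GQ: "G * Q = Q * C"
      proof -
        have "G * Q = (Q * C) * (P * Q)" using car C by (simp add: G_def as)
        then show ?thesis using car C unfolding PQ(1) by (simp add: as)
      qed
      have "G * D = Q * C * (P * D * Q) * P"
      proof -
        have "Q * C * (P * D * Q) * P = Q * C * P * D * (Q * P)" using car C by (simp add: as)
        then show ?thesis using car C unfolding PQ(2) G_def by (simp add: as)
      qed
      also have "\<dots> = Q * (C * A) * P" using car C A by (simp add: eq as)
      also have "\<dots> = (Q * P) * D * (Q * C * P)" using car C A unfolding comm[symmetric] by (simp add: eq as)
      also have "\<dots> = D * G" using car C unfolding PQ(2) G_def by (simp add: as)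
      finally have GD: "G * D = D * G" .
      have GF: "G * F t = F t * G"
      proof (rule eq_matI)
        fix i j assume "i < dim_row (F t * G)" "j < dim_col (F t * G)"
        then have ij: "i < r" "j < r" using F[of t] G by auto
        have "G $$ (i, j) * D $$ (j, j) = G $$ (i, j) * D $$ (i, i)"
          by (metis Dl(1)[OF G ij] Dl(2)[OF G ij] GD mult.commute)
        then have "G $$ (i, j) = 0 \<or> D $$ (j, j) = D $$ (i, i)" by (simp only: mult_cancel_left)
        then show "(G * F t) $$ (i, j) = (F t * G) $$ (i, j)"
          unfolding ind[OF G ij] by auto
      qed (use F[of t] G in auto)
      have "C * E t = (C * P) * F t * Q" using car C F[of t] by (simp add: E_def as)
      also have "\<dots> = P * (G * F t) * Q" unfolding PG[symmetric] using car F[of t] G by (simp add: as)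
      also have "\<dots> = P * F t * (G * Q)" unfolding GF using car F[of t] G by (simp add: as)
      also have "\<dots> = E t * C" unfolding GQ E_def using car F[of t] C by (simp add: as)
      finally show ?thesis .
    qed
  qed
qed

text \<open>The projections of one matrix after another split \<open>v\<close>; those of the next
  matrix preserve the eigenspaces already reached because they commute with the earlier matrices.
  Some \<open>u z\<close> may be zero.\<close>

lemma joint_eigenvectors:
  fixes A :: "'d::finite \<Rightarrow> 'a::field mat"
  assumes A: "\<And>j. A j \<in> carrier_mat r r" and comm: "\<And>i j. A i * A j = A j * A i"
    and diag: "\<And>j. diagonalisable (A j)" and v: "v \<in> carrier_vec r"
  shows "\<exists>(Z :: ('d \<Rightarrow> 'a) set) u. finite Z \<and> (\<forall>z\<in>Z. u z \<in> carrier_vec r) \<and>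
    (\<forall>z\<in>Z. \<forall>j. A j *\<^sub>v u z = z j \<cdot>\<^sub>v u z) \<and>
    (\<forall>i<r. vec_index v i = (\<Sum>z\<in>Z. vec_index (u z) i))"
proof -
  \<comment> \<open>A label is zero at the matrices not yet treated. Therefore
    \<open>z(j0 := t)\<close> determines both \<open>z\<close> and \<open>t\<close>, and no two
    summands receive the same label.\<close>
  have "\<exists>Z u. finite Z \<and> (\<forall>z\<in>Z. \<forall>j. j \<notin> J \<longrightarrow> z j = 0) \<and> (\<forall>z\<in>Z. u z \<in> carrier_vec r) \<and>
    (\<forall>z\<in>Z. \<forall>j\<in>J. A j *\<^sub>v u z = z j \<cdot>\<^sub>v u z) \<and>
    (\<forall>i<r. vec_index v i = (\<Sum>z\<in>Z. vec_index (u z) i))" if "finite J" for J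
    using that
  proof induction
    case empty
    show ?case using v by (intro exI[of _ "{\<lambda>_. 0 :: 'a}"] exI[of _ "\<lambda>_. v"]) simp
  next
    case (insert j0 J)
    obtain Z u where Zu: "finite Z \<and> (\<forall>z\<in>Z. \<forall>j. j \<notin> J \<longrightarrow> z j = 0) \<and> (\<forall>z\<in>Z. u z \<in> carrier_vec r) \<and>
      (\<forall>z\<in>Z. \<forall>j\<in>J. A j *\<^sub>v u z = z j \<cdot>\<^sub>v u z) \<and>
      (\<forall>i<r. vec_index v i = (\<Sum>z\<in>Z. vec_index (u z) i))"
      using insert.IH by (elim exE) (rule that)
    from Zu have Z: "finite Z" "\<And>z j. z \<in> Z \<Longrightarrow> j \<notin> J \<Longrightarrow> z j = 0" by blast+
    from Zu have u: "\<And>z. z \<in> Z \<Longrightarrow> u z \<in> carrier_vec r"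
        "\<And>z j. z \<in> Z \<Longrightarrow> j \<in> J \<Longrightarrow> A j *\<^sub>v u z = z j \<cdot>\<^sub>v u z"
        "\<And>i. i < r \<Longrightarrow> vec_index v i = (\<Sum>z\<in>Z. vec_index (u z) i)" by blast+
    obtain S E where SE: "finite S \<and> (\<forall>t. E t \<in> carrier_mat r r) \<and> (\<forall>t. A j0 * E t = t \<cdot>\<^sub>m E t) \<and>
      (\<forall>i<r. \<forall>j<r. (\<Sum>t\<in>S. E t $$ (i, j)) = (if i = j then 1 else 0)) \<and>
      (\<forall>t C. C \<in> carrier_mat r r \<longrightarrow> A j0 * C = C * A j0 \<longrightarrow> C * E t = E t * C)"
      using diagonalisable_projections[OF A[of j0] diag[of j0]] by (elim exE) (rule that)
    from SE have S: "finite S" by blast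
    from SE have E: "\<And>t. E t \<in> carrier_mat r r" "\<And>t. A j0 * E t = t \<cdot>\<^sub>m E t"
      "\<And>i j. i < r \<Longrightarrow> j < r \<Longrightarrow> (\<Sum>t\<in>S. E t $$ (i, j)) = (if i = j then 1 else 0)"
      "\<And>t C. C \<in> carrier_mat r r \<Longrightarrow> A j0 * C = C * A j0 \<Longrightarrow> C * E t = E t * C"
      by blast+
    define f where "f = (\<lambda>(z :: 'd \<Rightarrow> 'a, t). z(j0 := t))"
    \<comment> \<open>Reads both parts back from the new label \<open>y\<close>:
      \<open>t = y j0\<close> and \<open>z = y(j0 := 0)\<close>.\<close>
    define u' where "u' y = E (y j0) *\<^sub>v u (y(j0 := 0))" for y :: "'d \<Rightarrow> 'a"
    have upd: "(z(j0 := t))(j0 := 0) = z" if "z \<in> Z" for z t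
      using Z(2)[OF that insert.hyps(2)] by auto
    have u'f: "u' (f (z, t)) = E t *\<^sub>v u z" if "z \<in> Z" for z t
      using upd[OF that] by (simp add: u'_def f_def)
    have inj: "inj_on f (Z \<times> S)"
    proof (rule inj_onI)
      fix p q assume pq: "p \<in> Z \<times> S" "q \<in> Z \<times> S" "f p = f q"
      obtain z t z' t' where [simp]: "p = (z, t)" "q = (z', t')" by (cases p, cases q)
      have e: "z(j0 := t) = z'(j0 := t')" using pq(3) by (simp add: f_def)
      then have "t = t'" by (metis fun_upd_same)
      moreover have "z = z'" using pq upd[of z t] upd[of z' t'] e by auto
      ultimately show "p = q" by simp
    qed
    have "A j *\<^sub>v u' y = y j \<cdot>\<^sub>v u' y" if "y \<in> f ` (Z \<times> S)" "j \<in> insert j0 J" for y j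
    proof -
      obtain z t where y: "z \<in> Z" "y = f (z, t)" using \<open>y \<in> f ` (Z \<times> S)\<close> by auto
      have uz: "u z \<in> carrier_vec r" by (rule u(1)[OF y(1)])
      have "A j *\<^sub>v u' y = (A j * E t) *\<^sub>v u z"
        unfolding y(2) u'f[OF y(1)] by (rule assoc_mult_mat_vec[OF A E(1) uz, symmetric])
      also have "\<dots> = y j \<cdot>\<^sub>v u' y"
      proof (cases "j = j0")
        case True
        have "(A j * E t) *\<^sub>v u z = t \<cdot>\<^sub>v (E t *\<^sub>v u z)"
          unfolding True E(2) using E(1)[of t] uz by (intro eq_vecI) (simp_all add: row_smult)
        then show ?thesis using True unfolding y(2) u'f[OF y(1)] by (simp add: f_def)
      next
        case False
        then have "j \<in> J" using that by simp
        have "(A j * E t) *\<^sub>v u z = (E t * A j) *\<^sub>v u z" using E(4)[OF A comm] by simp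
        also have "\<dots> = E t *\<^sub>v (A j *\<^sub>v u z)" by (rule assoc_mult_mat_vec[OF E(1) A uz])
        also have "\<dots> = z j \<cdot>\<^sub>v (E t *\<^sub>v u z)"
          unfolding u(2)[OF y(1) \<open>j \<in> J\<close>] by (rule mult_mat_vec[OF E(1) uz])
        finally show ?thesis using False unfolding y(2) u'f[OF y(1)] by (simp add: f_def)
      qed
      finally show ?thesis .
    qed
    moreover have "vec_index v i = (\<Sum>y\<in>f ` (Z \<times> S). vec_index (u' y) i)" if i: "i < r" for i
    proof -
      have "(\<Sum>y\<in>f ` (Z \<times> S). vec_index (u' y) i) = (\<Sum>(z, t)\<in>Z \<times> S. vec_index (E t *\<^sub>v u z) i)"
        unfolding sum.reindex[OF inj] using u'f by (intro sum.cong) auto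
      also have "\<dots> = (\<Sum>z\<in>Z. \<Sum>t\<in>S. \<Sum>k<r. E t $$ (i, k) * vec_index (u z) k)"
        unfolding sum.cartesian_product[symmetric] using E(1) u(1) i
        by (intro sum.cong refl mult_mat_vec_index_sum) auto
      also have "\<dots> = (\<Sum>z\<in>Z. \<Sum>k<r. (\<Sum>t\<in>S. E t $$ (i, k)) * vec_index (u z) k)"
        by (intro sum.cong refl) (subst sum.swap, simp add: sum_distrib_right)
      also have "\<dots> = (\<Sum>z\<in>Z. \<Sum>k<r. if k = i then vec_index (u z) i else 0)"
        using i by (intro sum.cong refl) (simp add: E(3))
      also have "\<dots> = vec_index v i" using i u(3) by simp
      finally show ?thesis by simp
    qed
    moreover have "u' y \<in> carrier_vec r" if "y \<in> f ` (Z \<times> S)" for y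
    proof -
      from that obtain z t where y: "z \<in> Z" "y = f (z, t)" by auto
      show ?thesis unfolding y(2) u'f[OF y(1)] using E(1)[of t] u(1)[OF y(1)] by (rule mult_mat_vec_carrier)
    qed
    moreover have "y j = 0" if "y \<in> f ` (Z \<times> S)" "j \<notin> insert j0 J" for y j
      using that Z(2) by (auto simp: f_def)
    moreover have "finite (f ` (Z \<times> S))" using Z(1) S by simp
    ultimately show ?case by (intro exI[of _ "f ` (Z \<times> S)"] exI[of _ u']) simp
  qed
  from this[of UNIV] show ?thesis by simp
qed

section \<open>Flat extensions\<close>

text \<open>A basis of degree at most \<open>n\<close> for the columns of degree at most \<open>n + 1\<close> turns multiplication by the
  variables into operators of the column space, with matrices \<open>T j\<close>.\<close>

locale flat_hankel =
  fixes s :: "('d::finite) mindex \<Rightarrow> real" and n :: nat and B :: "'d mindex list"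
  assumes deg: "\<And>l. l \<in> set B \<Longrightarrow> mdeg l \<le> n"
    and det: "det (basis_mat s B) \<noteq> 0"
    and span: "spanning s (Suc n) B"
begin

abbreviation r where "r \<equiv> length B"
abbreviation T where "T \<equiv> T_mat s s B"

lemma deg_nth [simp]: "a < r \<Longrightarrow> mdeg (B ! a) \<le> n" "a < r \<Longrightarrow> mdeg (B ! a) \<le> Suc n"
  using deg[of "B ! a"] by (auto dest: nth_mem)

lemma basis_car: "basis_mat s B \<in> carrier_mat r r" by (simp add: basis_mat_def)

lemma T_car: "T j \<in> carrier_mat r r"
  using minv_inverse(1)[OF basis_car det] by (simp add: T_mat_def shifted_basis_mat_def)

lemma basis_inj:
  assumes "\<And>a. a < r \<Longrightarrow> (\<Sum>b<r. s (B ! a + B ! b) * x b) = (\<Sum>b<r. s (B ! a + B ! b) * y b)" and "b < r"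
  shows "x b = y b"
proof -
  have "\<forall>a<r. (\<Sum>b<r. basis_mat s B $$ (a, b) * (x b - y b)) = 0"
    using assms(1) by (auto simp: basis_mat_def right_diff_distrib sum_subtractf)
  then have "x b - y b = 0" by (intro det_nonzeroD[OF basis_car det, of "\<lambda>b. x b - y b"]) (use assms(2) in auto)
  then show ?thesis by simp
qed

text \<open>Any choice will do: nonsingularity of \<open>basis_mat s B\<close> makes the coordinates
  unique below \<open>r\<close>.\<close>

definition coords :: "'d mindex \<Rightarrow> nat \<Rightarrow> real" where
  "coords l = (SOME c. \<forall>x. mdeg x \<le> Suc n \<longrightarrow> s (x + l) = (\<Sum>b<r. c b * s (x + B ! b)))"

lemma coords:
  assumes "mdeg l \<le> Suc n" "mdeg x \<le> Suc n"
  shows "(\<Sum>b<r. s (x + B ! b) * coords l b) = s (x + l)"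
proof -
  have "\<exists>c. \<forall>x. mdeg x \<le> Suc n \<longrightarrow> s (x + l) = (\<Sum>b<r. c b * s (x + B ! b))"
    using span assms(1) unfolding spanning_def by blast
  from someI_ex[OF this] assms(2) have "s (x + l) = (\<Sum>b<r. coords l b * s (x + B ! b))"
    unfolding coords_def by blast
  also have "\<dots> = (\<Sum>b<r. s (x + B ! b) * coords l b)" by (simp only: mult.commute)
  finally show ?thesis by simp
qed

lemma basis_T:
  assumes "a < r" "b < r"
  shows "(\<Sum>k<r. s (B ! a + B ! k) * T j $$ (k, b)) = s (B ! a + B ! b + axis j 1)"
proof -
  have car: "shifted_basis_mat s B j \<in> carrier_mat r r" by (simp add: shifted_basis_mat_def)
  have "basis_mat s B * T j = (basis_mat s B * minv (basis_mat s B)) * shifted_basis_mat s B j"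
    unfolding T_mat_def by (rule assoc_mult_mat[OF basis_car minv_inverse(1)[OF basis_car det] car, symmetric])
  also have "\<dots> = shifted_basis_mat s B j"
    unfolding minv_inverse(2)[OF basis_car det] using car by simp
  finally have "(basis_mat s B * T j) $$ (a, b) = s (B ! a + B ! b + axis j 1)"
    using assms by (simp add: shifted_basis_mat_def)
  moreover have "(basis_mat s B * T j) $$ (a, b) = (\<Sum>k<r. s (B ! a + B ! k) * T j $$ (k, b))"
    unfolding mult_mat_index_sum[OF basis_car T_car assms] using assms by (intro sum.cong) (auto simp: basis_mat_def)
  ultimately show ?thesis by simp
qed

text \<open>Both sides solve the same nonsingular system. This is the sense in which
  \<open>T j\<close> multiplies by the \<open>j\<close>-th variable.\<close>

lemma T_col:
  assumes "k < r" "b < r"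
  shows "T j $$ (k, b) = coords (B ! b + axis j 1) k"
  by (rule basis_inj[OF _ assms(1)]) (use assms in \<open>simp add: basis_T coords add.assoc\<close>)

lemma T_comm: "T i * T j = T j * T i"
proof -
  have e: "(\<Sum>k<r. s (B ! a + B ! k) * (T i * T j) $$ (k, b)) = s (B ! a + B ! b + axis i 1 + axis j 1)"
    if "a < r" "b < r" for a b i j
  proof -
    have "(\<Sum>k<r. s (B ! a + B ! k) * (T i * T j) $$ (k, b)) =
      (\<Sum>k<r. \<Sum>l<r. s (B ! a + B ! k) * (T i $$ (k, l) * T j $$ (l, b)))"
      using that by (intro sum.cong refl) (subst mult_mat_index_sum[OF T_car T_car], auto simp: sum_distrib_left)
    also have "\<dots> = (\<Sum>l<r. (\<Sum>k<r. s (B ! a + B ! k) * T i $$ (k, l)) * T j $$ (l, b))"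
      by (subst sum.swap) (simp add: sum_distrib_right mult.assoc)
    \<comment> \<open>The shift by \<open>i\<close> joins the row exponent and the shift by
      \<open>j\<close> is taken by the coordinates. This needs the column relations in rows of
      degree \<open>n + 1\<close>.\<close>
    also have "\<dots> = (\<Sum>l<r. s ((B ! a + axis i 1) + B ! l) * coords (B ! b + axis j 1) l)"
      using that by (intro sum.cong refl) (subst basis_T, auto simp: T_col add_ac)
    also have "\<dots> = s (B ! a + B ! b + axis i 1 + axis j 1)"
      using that by (subst coords) (auto simp: add_ac)
    finally show ?thesis .
  qed
  show ?thesis
  proof (rule eq_matI)
    fix k b assume "k < dim_row (T j * T i)" "b < dim_col (T j * T i)"
    then have kb: "k < r" "b < r" using T_car[of i] T_car[of j] by auto
    show "(T i * T j) $$ (k, b) = (T j * T i) $$ (k, b)"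
      by (rule basis_inj[OF _ kb(1)]) (simp add: e[OF _ kb(2)] add_ac)
  qed (use T_car[of i] T_car[of j] in auto)
qed

text \<open>Extends \<open>T_col\<close> from the exponents in \<open>B\<close> to all exponents of
  degree at most \<open>n\<close>, by the same transfer of the shift to the row.\<close>

lemma coords_step:
  assumes "mdeg l \<le> n" "k < r"
  shows "coords (l + axis j 1) k = (\<Sum>b<r. T j $$ (k, b) * coords l b)"
proof (rule basis_inj[OF _ assms(2)])
  fix a assume a: "a < r"
  have "(\<Sum>k<r. s (B ! a + B ! k) * (\<Sum>b<r. T j $$ (k, b) * coords l b)) =
    (\<Sum>b<r. (\<Sum>k<r. s (B ! a + B ! k) * T j $$ (k, b)) * coords l b)"
    unfolding sum_distrib_left sum_distrib_right by (subst sum.swap) (simp add: mult.assoc)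
  also have "\<dots> = (\<Sum>b<r. s ((B ! a + axis j 1) + B ! b) * coords l b)"
    using a by (intro sum.cong refl) (subst basis_T, auto simp: add_ac)
  also have "\<dots> = s (B ! a + (l + axis j 1))"
    using a assms(1) by (subst coords) (auto simp: add_ac)
  also have "\<dots> = (\<Sum>k<r. s (B ! a + B ! k) * coords (l + axis j 1) k)"
    using a assms(1) by (subst coords) auto
  finally show "(\<Sum>b<r. s (B ! a + B ! b) * coords (l + axis j 1) b) =
    (\<Sum>k<r. s (B ! a + B ! k) * (\<Sum>b<r. T j $$ (k, b) * coords l b))" by simp
qed

text \<open>Without conjugation, a self-adjoint operator has orthogonal eigenvectors for different
  eigenvalues even when these are not real.\<close>

definition form :: "(nat \<Rightarrow> complex) \<Rightarrow> (nat \<Rightarrow> complex) \<Rightarrow> complex" where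
  "form x y = (\<Sum>a<r. \<Sum>b<r. x a * of_real (s (B ! a + B ! b)) * y b)"

lemma form_sum_left: "form (\<lambda>i. \<Sum>z\<in>Z. c z * u z i) y = (\<Sum>z\<in>Z. c z * form (u z) y)"
proof -
  have "form (\<lambda>i. \<Sum>z\<in>Z. c z * u z i) y =
    (\<Sum>a<r. \<Sum>b<r. \<Sum>z\<in>Z. c z * (u z a * of_real (s (B ! a + B ! b)) * y b))"
    unfolding form_def by (simp add: sum_distrib_right mult.assoc)
  also have "\<dots> = (\<Sum>a<r. \<Sum>z\<in>Z. \<Sum>b<r. c z * (u z a * of_real (s (B ! a + B ! b)) * y b))"
    by (intro sum.cong refl sum.swap)
  also have "\<dots> = (\<Sum>z\<in>Z. \<Sum>a<r. \<Sum>b<r. c z * (u z a * of_real (s (B ! a + B ! b)) * y b))"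
    by (rule sum.swap)
  finally show ?thesis by (simp add: form_def sum_distrib_left)
qed

lemma form_sym: "form x y = form y x"
  unfolding form_def by (subst sum.swap) (simp add: mult_ac add.commute)

lemma form_cong:
  "(\<And>i. i < r \<Longrightarrow> x i = x' i) \<Longrightarrow> (\<And>i. i < r \<Longrightarrow> y i = y' i) \<Longrightarrow> form x y = form x' y'"
  by (simp add: form_def)

lemma form_sum_right: "form y (\<lambda>i. \<Sum>z\<in>Z. c z * u z i) = (\<Sum>z\<in>Z. c z * form y (u z))"
  using form_sum_left[of c u Z y] by (simp add: form_sym[of y])

text \<open>\<open>M\<^sub>B T\<^sub>j\<close> is the shifted block with entries
  \<open>s (B ! a + B ! b + axis j 1)\<close>, which is symmetric in \<open>a\<close> and
  \<open>b\<close>.\<close>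

lemma T_selfadjoint:
  "form (\<lambda>k. \<Sum>b<r. of_real (T j $$ (k, b)) * x b) y = form x (\<lambda>k. \<Sum>b<r. of_real (T j $$ (k, b)) * y b)"
proof -
  have R: "form y (\<lambda>k. \<Sum>b<r. of_real (T j $$ (k, b)) * x b) =
    (\<Sum>a<r. \<Sum>b<r. y a * of_real (s (B ! a + B ! b + axis j 1)) * x b)" for x y
  proof -
    have "form y (\<lambda>k. \<Sum>b<r. of_real (T j $$ (k, b)) * x b) =
      (\<Sum>a<r. \<Sum>k<r. \<Sum>b<r. y a * of_real (s (B ! a + B ! k) * T j $$ (k, b)) * x b)"
      unfolding form_def by (simp add: sum_distrib_left mult.assoc)
    also have "\<dots> = (\<Sum>a<r. \<Sum>b<r. \<Sum>k<r. y a * of_real (s (B ! a + B ! k) * T j $$ (k, b)) * x b)"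
      by (intro sum.cong refl sum.swap)
    also have "\<dots> = (\<Sum>a<r. \<Sum>b<r. y a * of_real (\<Sum>k<r. s (B ! a + B ! k) * T j $$ (k, b)) * x b)"
      by (simp add: sum_distrib_left sum_distrib_right del: of_real_mult)
    also have "\<dots> = (\<Sum>a<r. \<Sum>b<r. y a * of_real (s (B ! a + B ! b + axis j 1)) * x b)"
      by (intro sum.cong refl) (auto simp: basis_T)
    finally show ?thesis .
  qed
  show ?thesis unfolding R form_sym[of _ y]
    by (subst sum.swap) (simp add: mult_ac add.commute[of "B ! _" "B ! _"])
qed

text \<open>The moments are reproduced up to degree \<open>2 * (n + 1)\<close>, beyond those of the
  original sequence; this links the atoms to the variety of the extension.\<close>

theorem flat_atomic:
  assumes diag: "\<And>j. diagonalisable (map_mat complex_of_real (T j))"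
  obtains z :: "nat \<Rightarrow> 'd cpoint" and w :: "nat \<Rightarrow> complex"
  where "inj_on z {..<r}" "\<And>a. a < r \<Longrightarrow> w a \<noteq> 0"
    "\<And>g. mdeg g \<le> 2 * Suc n \<Longrightarrow> of_real (s g) = (\<Sum>a<r. w a * mono_at g (z a))"
proof -
  define Tc where "Tc j = map_mat complex_of_real (T j)" for j
  have Tc_car: "Tc j \<in> carrier_mat r r" for j using T_car[of j] by (simp add: Tc_def)
  have Tc_comm: "Tc i * Tc j = Tc j * Tc i" for i j
    unfolding Tc_def by (metis T_comm T_car of_real_hom.mat_hom_mult)
  define e where "e = Matrix.vec r (\<lambda>i. complex_of_real (coords 0 i))"
  have e_car: "e \<in> carrier_vec r" by (simp add: e_def)
  obtain Z0 :: "('d \<Rightarrow> complex) set" and u0 where Zu: "finite Z0 \<and> (\<forall>z\<in>Z0. u0 z \<in> carrier_vec r) \<and>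
    (\<forall>z\<in>Z0. \<forall>j. Tc j *\<^sub>v u0 z = z j \<cdot>\<^sub>v u0 z) \<and>
    (\<forall>i<r. vec_index e i = (\<Sum>z\<in>Z0. vec_index (u0 z) i))"
    using joint_eigenvectors[of Tc r e, OF Tc_car Tc_comm diag[folded Tc_def] e_car] by (elim exE) (rule that)
  then have Z0: "finite Z0" "\<And>z. z \<in> Z0 \<Longrightarrow> u0 z \<in> carrier_vec r"
    "\<And>z j. z \<in> Z0 \<Longrightarrow> Tc j *\<^sub>v u0 z = z j \<cdot>\<^sub>v u0 z"
    "\<And>i. i < r \<Longrightarrow> vec_index e i = (\<Sum>z\<in>Z0. vec_index (u0 z) i)" by blast+
  define Z where "Z = vec_lambda ` Z0"
  define u where "u z i = vec_index (u0 (vec_nth z)) i" for z :: "'d cpoint" and i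
  have fin: "finite Z" using Z0(1) by (simp add: Z_def)
  have inj: "inj_on vec_lambda Z0"
    by (rule inj_onI) (auto simp: Finite_Cartesian_Product.vec_eq_iff)
  have eig: "(\<Sum>b<r. of_real (T j $$ (k, b)) * u z b) = vec_nth z j * u z k" if "z \<in> Z" "k < r" for z j k
  proof -
    from that obtain z0 where z0: "z0 \<in> Z0" "vec_nth z = z0" by (auto simp: Z_def vec_lambda_inverse)
    have "vec_index (Tc j *\<^sub>v u0 z0) k = vec_index (z0 j \<cdot>\<^sub>v u0 z0) k" using Z0(3)[OF z0(1)] by simp
    then show ?thesis using that Z0(2)[OF z0(1)] T_car[of j] z0(2)
      unfolding mult_mat_vec_index_sum[OF Tc_car Z0(2)[OF z0(1)] that(2)] by (simp add: u_def Tc_def)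
  qed
  have c0: "of_real (coords 0 i) = (\<Sum>z\<in>Z. u z i)" if "i < r" for i
    using Z0(4)[OF that] that by (simp add: e_def Z_def u_def sum.reindex[OF inj] vec_lambda_inverse)
  \<comment> \<open>\<open>T j\<close> multiplies \<open>u z\<close> by the \<open>j\<close>-th
    coordinate of \<open>z\<close>, so each step from \<open>l\<close> to
    \<open>l + axis j 1\<close> contributes this factor.\<close>
  have co: "of_real (coords l k) = (\<Sum>z\<in>Z. mono_at l z * u z k)" if "mdeg l \<le> Suc n" "k < r" for l k
    using that
  proof (induction l arbitrary: k rule: mindex_induct)
    case zero
    then show ?case by (simp add: c0)
  next
    case (step l j)
    have "of_real (coords (l + axis j 1) k) = (\<Sum>b<r. of_real (T j $$ (k, b)) * of_real (coords l b))"
      using step.prems by (subst coords_step) auto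
    also have "\<dots> = (\<Sum>b<r. \<Sum>z\<in>Z. mono_at l z * (of_real (T j $$ (k, b)) * u z b))"
      using step.prems by (intro sum.cong refl) (simp add: step.IH sum_distrib_left sum_distrib_right mult_ac)
    also have "\<dots> = (\<Sum>z\<in>Z. mono_at l z * (\<Sum>b<r. of_real (T j $$ (k, b)) * u z b))"
      by (subst sum.swap) (simp add: sum_distrib_left)
    also have "\<dots> = (\<Sum>z\<in>Z. mono_at (l + axis j 1) z * u z k)"
      using step.prems by (intro sum.cong refl) (simp add: eig mult.assoc)
    finally show ?case .
  qed
  have orth: "form (u z) (u z') = 0" if "z \<in> Z" "z' \<in> Z" "z \<noteq> z'" for z z'
  proof -
    obtain j where j: "vec_nth z j \<noteq> vec_nth z' j"
      using \<open>z \<noteq> z'\<close> by (auto simp: Finite_Cartesian_Product.vec_eq_iff)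
    have "vec_nth z j * form (u z) (u z') = form (\<lambda>k. \<Sum>b<r. of_real (T j $$ (k, b)) * u z b) (u z')"
      \<comment> \<open>A scalar multiple is a sum over the one-element set \<open>{()}\<close>, so
        the sum rule also gives homogeneity.\<close>
      using that form_sum_left[of "\<lambda>_. vec_nth z j" "\<lambda>_. u z" "{()}" "u z'"]
      by (simp add: eig cong: form_cong)
    also have "\<dots> = form (u z) (\<lambda>k. \<Sum>b<r. of_real (T j $$ (k, b)) * u z' b)" by (rule T_selfadjoint)
    also have "\<dots> = vec_nth z' j * form (u z) (u z')"
      using that form_sum_right[of "u z" "\<lambda>_. vec_nth z' j" "\<lambda>_. u z'" "{()}"]
      by (simp add: eig cong: form_cong)
    finally show ?thesis using j by simp
  qed
  define W where "W z = form (u z) (u z)" for z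
  \<comment> \<open>A moment is the form of two coordinate vectors, and orthogonality leaves only
    the diagonal terms.\<close>
  have form_co: "of_real (s (l + x)) = (\<Sum>z\<in>Z. W z * (mono_at l z * mono_at x z))"
    if "mdeg l \<le> Suc n" "mdeg x \<le> Suc n" for l x
  proof -
    have "s (l + x) = (\<Sum>b<r. s (l + B ! b) * coords x b)"
      using that by (simp add: coords)
    also have "\<dots> = (\<Sum>b<r. (\<Sum>a<r. s (B ! b + B ! a) * coords l a) * coords x b)"
      using that by (intro sum.cong refl) (subst coords, auto simp: add.commute)
    finally have "of_real (s (l + x)) = form (\<lambda>i. of_real (coords x i)) (\<lambda>i. of_real (coords l i))"
      by (simp add: form_def sum_distrib_right sum_distrib_left mult_ac)
    also have "\<dots> = form (\<lambda>i. \<Sum>z\<in>Z. mono_at x z * u z i) (\<lambda>i. \<Sum>z\<in>Z. mono_at l z * u z i)"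
      using that by (intro form_cong) (auto simp: co)
    also have "\<dots> = (\<Sum>z\<in>Z. mono_at x z * (\<Sum>z'\<in>Z. mono_at l z' * form (u z) (u z')))"
      by (simp add: form_sum_left form_sum_right)
    also have "\<dots> = (\<Sum>z\<in>Z. mono_at x z * (\<Sum>z'\<in>Z. if z' = z then mono_at l z * W z else 0))"
      by (intro sum.cong refl arg_cong2[where f = "(*)"]) (auto simp: W_def orth)
    also have "\<dots> = (\<Sum>z\<in>Z. W z * (mono_at l z * mono_at x z))"
      using fin by (intro sum.cong refl) (auto simp: mult_ac)
    finally show ?thesis .
  qed
  \<comment> \<open>Isotropic summands contribute to no moment and are dropped.\<close>
  define Z' where "Z' = {z\<in>Z. W z \<noteq> 0}"
  have fin': "finite Z'" using fin by (simp add: Z'_def)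
  have rep: "of_real (s g) = (\<Sum>z\<in>Z'. W z * mono_at g z)" if "mdeg g \<le> 2 * Suc n" for g
  proof -
    from that obtain l x where g: "g = l + x" "mdeg l \<le> Suc n" "mdeg x \<le> Suc n"
      using mindex_split[of g "Suc n" "Suc n"] by auto
    have "of_real (s g) = (\<Sum>z\<in>Z. W z * mono_at g z)" using form_co[OF g(2,3)] by (simp add: g(1))
    also have "\<dots> = (\<Sum>z\<in>Z'. W z * mono_at g z)"
      using fin by (intro sum.mono_neutral_right) (auto simp: Z'_def)
    finally show ?thesis .
  qed
  \<comment> \<open>More than \<open>r\<close> vectors in dimension \<open>r\<close> satisfy a
    relation; pairing it with \<open>u z'\<close> isolates \<open>x z' * W z'\<close>.\<close>
  have "card Z' \<le> r"
  proof (rule ccontr)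
    assume "\<not> ?thesis"
    then obtain x where x: "\<exists>z\<in>Z'. x z \<noteq> 0" "\<And>i. i < r \<Longrightarrow> (\<Sum>z\<in>Z'. u z i * x z) = 0"
      using homogeneous_system[of "{..<r}" Z' "\<lambda>i z. u z i"] fin' by auto
    have "x z' = 0" if "z' \<in> Z'" for z'
    proof -
      have "0 = form (u z') (\<lambda>i. 0)" by (simp add: form_def)
      also have "\<dots> = form (u z') (\<lambda>i. \<Sum>z\<in>Z'. x z * u z i)"
        by (rule form_cong) (simp_all add: x(2)[symmetric] mult.commute)
      also have "\<dots> = (\<Sum>z\<in>Z'. if z = z' then x z' * W z' else 0)"
        unfolding form_sum_right using that by (intro sum.cong refl) (auto simp: W_def orth Z'_def)
      also have "\<dots> = x z' * W z'" using fin' that by simp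
      finally show ?thesis using that by (simp add: Z'_def)
    qed
    then show False using x(1) by blast
  qed
  \<comment> \<open>With fewer than \<open>r\<close> points, some nontrivial combination of the
    monomials in \<open>B\<close> vanishes on all of \<open>Z'\<close>. By \<open>rep\<close> its
    coefficients lie in the kernel of the nonsingular \<open>basis_mat s B\<close>.\<close>
  moreover have "r \<le> card Z'"
  proof (rule ccontr)
    assume "\<not> ?thesis"
    then obtain x where x: "\<exists>b<r. x b \<noteq> 0" "\<And>z. z \<in> Z' \<Longrightarrow> (\<Sum>b<r. mono_at (B ! b) z * x b) = 0"
      using homogeneous_system[of Z' "{..<r}" "\<lambda>z b. mono_at (B ! b) z"] fin' by auto
    have car: "map_mat complex_of_real (basis_mat s B) \<in> carrier_mat r r" by (simp add: basis_mat_def)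
    have M: "map_mat complex_of_real (basis_mat s B) $$ (a, b) = (\<Sum>z\<in>Z'. W z * (mono_at (B ! a) z * mono_at (B ! b) z))"
      if "a < r" "b < r" for a b
    proof -
      have "mdeg (B ! a + B ! b) \<le> 2 * Suc n" using deg_nth(1)[OF that(1)] deg_nth(1)[OF that(2)] by simp
      from rep[OF this] that show ?thesis by (simp add: basis_mat_def)
    qed
    have dn: "det (map_mat complex_of_real (basis_mat s B)) \<noteq> 0" using det by simp
    have e: "(\<Sum>b<r. map_mat complex_of_real (basis_mat s B) $$ (a, b) * x b) = 0" if a: "a < r" for a
    proof -
      have "(\<Sum>b<r. map_mat complex_of_real (basis_mat s B) $$ (a, b) * x b) =
        (\<Sum>b<r. \<Sum>z\<in>Z'. W z * mono_at (B ! a) z * (mono_at (B ! b) z * x b))"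
        using a by (intro sum.cong refl) (auto simp: M sum_distrib_right sum_distrib_left mult_ac simp del: index_map_mat)
      also have "\<dots> = (\<Sum>z\<in>Z'. W z * mono_at (B ! a) z * (\<Sum>b<r. mono_at (B ! b) z * x b))"
        by (subst sum.swap) (simp add: sum_distrib_left)
      also have "\<dots> = 0" using x(2) by simp
      finally show ?thesis .
    qed
    have "x b = 0" if "b < r" for b by (rule det_nonzeroD[OF car dn e that])
    then show False using x(1) by blast
  qed
  ultimately have card: "card Z' = r" by simp
  then obtain z where z: "bij_betw z {..<r} Z'"
    using ex_bij_betw_nat_finite[OF fin'] by (auto simp: atLeast0LessThan)
  show thesis
  proof (rule that[of z "\<lambda>a. W (z a)"])
    show "inj_on z {..<r}" using z by (simp add: bij_betw_def)
    show "W (z a) \<noteq> 0" if "a < r" for a using z that by (auto simp: bij_betw_def Z'_def)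
    show "of_real (s g) = (\<Sum>a<r. W (z a) * mono_at g (z a))" if "mdeg g \<le> 2 * Suc n" for g
      unfolding rep[OF that] by (rule sum.reindex_bij_betw[OF z, symmetric])
  qed
qed

end

section \<open>Atomic measures\<close>

text \<open>A pushed-forward weighted counting measure, the shape of both parts of the Jordan
  decomposition of an atomic measure. Since \<open>ennreal\<close> cuts negative numbers to
  \<open>0\<close>, the facts about its values assume \<open>0 \<le> c a\<close>.\<close>

definition atoms_measure :: "nat set \<Rightarrow> (nat \<Rightarrow> real) \<Rightarrow> (nat \<Rightarrow> 'a::t1_space) \<Rightarrow> 'a measure" where
  "atoms_measure I c z = distr (point_measure I (\<lambda>a. ennreal (c a))) borel z"

lemma sets_atoms_measure: "sets (atoms_measure I c z) = sets borel"
  by (simp add: atoms_measure_def)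

context
  fixes I :: "nat set" and c :: "nat \<Rightarrow> real" and z :: "nat \<Rightarrow> 'a::t1_space"
  assumes fin: "finite I" and pos: "\<forall>a\<in>I. 0 \<le> c a"
begin

lemma emeasure_atoms_measure:
  assumes "A \<in> sets borel"
  shows "emeasure (atoms_measure I c z) A = ennreal (\<Sum>a\<in>I. c a * indicator A (z a))"
proof -
  have "emeasure (atoms_measure I c z) A = emeasure (point_measure I (\<lambda>a. ennreal (c a))) (z -` A \<inter> I)"
    unfolding atoms_measure_def using assms by (subst emeasure_distr) (auto simp: space_point_measure)
  also have "\<dots> = (\<Sum>a\<in>z -` A \<inter> I. ennreal (c a))"
    using fin by (subst emeasure_point_measure_finite) auto
  also have "\<dots> = ennreal (\<Sum>a\<in>z -` A \<inter> I. c a)" using pos by (intro sum_ennreal) auto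
  also have "(\<Sum>a\<in>z -` A \<inter> I. c a) = (\<Sum>a\<in>I. c a * indicator A (z a))"
    using fin by (intro sum.mono_neutral_cong_left) (auto simp: indicator_def)
  finally show ?thesis .
qed

lemma measure_atoms_measure:
  assumes "A \<in> sets borel"
  shows "measure (atoms_measure I c z) A = (\<Sum>a\<in>I. c a * indicator A (z a))"
  unfolding Sigma_Algebra.measure_def emeasure_atoms_measure[OF assms]
  using pos by (intro enn2real_ennreal sum_nonneg) auto

lemma finite_atoms_measure: "finite_measure (atoms_measure I c z)"
  by (rule finite_measureI)
    (use emeasure_atoms_measure[of UNIV] in \<open>simp add: atoms_measure_def\<close>)

lemma integral_atoms_measure:
  fixes f :: "'a \<Rightarrow> complex"
  assumes f: "f \<in> borel_measurable borel"
  shows "integrable (atoms_measure I c z) f" "integral\<^sup>L (atoms_measure I c z) f = (\<Sum>a\<in>I. of_real (c a) * f (z a))"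
proof -
  have z: "z \<in> measurable (point_measure I (\<lambda>a. ennreal (c a))) borel" by simp
  show "integrable (atoms_measure I c z) f"
    unfolding atoms_measure_def integrable_distr_eq[OF z f]
    using fin by (intro integrable_point_measure_finite)
  show "integral\<^sup>L (atoms_measure I c z) f = (\<Sum>a\<in>I. of_real (c a) * f (z a))"
    unfolding atoms_measure_def integral_distr[OF z f]
    using lebesgue_integral_point_measure_finite[OF fin, of c "\<lambda>a. f (z a)"] pos
    by (simp add: scaleR_conv_of_real)
qed

lemma pos_supp_atoms_measure:
  assumes "\<And>a. a \<in> I \<Longrightarrow> c a \<noteq> 0"
  shows "pos_supp (atoms_measure I c z) = z ` I"
proof (intro equalityI subsetI)
  fix x assume x: "x \<in> pos_supp (atoms_measure I c z)"
  show "x \<in> z ` I"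
  proof (rule ccontr)
    assume n: "x \<notin> z ` I"
    have o: "open (- (z ` I))" using fin by (intro open_Compl finite_imp_closed) simp
    have "(\<Sum>a\<in>I. c a * indicator (- (z ` I)) (z a)) = 0" by (intro sum.neutral) auto
    then have "emeasure (atoms_measure I c z) (- (z ` I)) = 0"
      using o by (subst emeasure_atoms_measure) auto
    then show False using x n o unfolding pos_supp_def by blast
  qed
next
  fix x assume "x \<in> z ` I"
  then obtain a where a: "a \<in> I" "x = z a" by blast
  show "x \<in> pos_supp (atoms_measure I c z)" unfolding pos_supp_def
  proof (intro CollectI allI impI)
    fix U assume U: "open U" "x \<in> U"
    have "0 < c a" using assms[OF a(1)] pos a(1) by fastforce
    also have "c a = c a * indicator U (z a)" using U a by simp
    also have "\<dots> \<le> (\<Sum>a\<in>I. c a * indicator U (z a))"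
      using fin a(1) pos by (intro member_le_sum) auto
    finally show "emeasure (atoms_measure I c z) U \<noteq> 0"
      using U by (subst emeasure_atoms_measure) (auto simp: ennreal_eq_0_iff)
  qed
qed

end

lemma jordan_decomposition_atoms:
  fixes z :: "nat \<Rightarrow> 'a::t1_space"
  assumes inj: "inj_on z {..<r}" and nu: "\<And>A. A \<in> sets borel \<Longrightarrow> \<nu> A = (\<Sum>a<r. c a * indicator A (z a))"
  shows "jordan_decomposition \<nu> (atoms_measure {a. a < r \<and> c a > 0} c z)
    (atoms_measure {a. a < r \<and> c a < 0} (\<lambda>a. - c a) z)" (is "jordan_decomposition \<nu> (atoms_measure ?P c z) (atoms_measure ?N _ z)")
proof -
  have fin: "finite ?P" "finite ?N" by auto
  have pos: "\<forall>a\<in>?P. 0 \<le> c a" "\<forall>a\<in>?N. 0 \<le> - c a" by auto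
  note m = measure_atoms_measure[OF fin(1) pos(1)] measure_atoms_measure[OF fin(2) pos(2)]
  have "\<nu> A = measure (atoms_measure ?P c z) A - measure (atoms_measure ?N (\<lambda>a. - c a) z) A"
    if A: "A \<in> sets borel" for A
  proof -
    have "\<nu> A = (\<Sum>a\<in>?P \<union> ?N. c a * indicator A (z a))"
      unfolding nu[OF A] by (rule sum.mono_neutral_right) auto
    also have "\<dots> = (\<Sum>a\<in>?P. c a * indicator A (z a)) + (\<Sum>a\<in>?N. c a * indicator A (z a))"
      by (rule sum.union_disjoint) auto
    finally show ?thesis unfolding m(1)[OF A] m(2)[OF A] by (simp add: sum_negf)
  qed
  moreover have "\<exists>H\<in>sets borel. emeasure (atoms_measure ?P c z) (- H) = 0 \<and>
      emeasure (atoms_measure ?N (\<lambda>a. - c a) z) H = 0"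
  proof (intro bexI conjI)
    \<comment> \<open>The Hahn set consists of the positive atoms; injectivity of \<open>z\<close>
      keeps the negative ones out of it.\<close>
    show H: "z ` ?P \<in> sets borel" by (intro borel_closed finite_imp_closed) auto
    have "(\<Sum>a\<in>?P. c a * indicator (- (z ` ?P)) (z a)) = 0" by (intro sum.neutral) auto
    then show "emeasure (atoms_measure ?P c z) (- (z ` ?P)) = 0"
      using H by (subst emeasure_atoms_measure[OF fin(1) pos(1)]) auto
    have "z a \<notin> z ` ?P" if "a \<in> ?N" for a
      using that by (auto simp: inj_on_eq_iff[OF inj])
    then have "(\<Sum>a\<in>?N. - c a * indicator (z ` ?P) (z a)) = 0" by (intro sum.neutral) auto
    then show "emeasure (atoms_measure ?N (\<lambda>a. - c a) z) (z ` ?P) = 0"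
      using H by (subst emeasure_atoms_measure[OF fin(2) pos(2)]) auto
  qed
  ultimately show ?thesis
    unfolding jordan_decomposition_def
    using finite_atoms_measure[where z = z, OF fin(1) pos(1)] finite_atoms_measure[where z = z, OF fin(2) pos(2)]
    by (simp add: sets_atoms_measure)
qed

text \<open>\<open>has_cm_integral\<close> asks for some Jordan decomposition, so it determines the
  value only if all decompositions give the same integral. The Hahn set \<open>H\<close> forces
  \<open>P\<close> to be \<open>\<nu>\<close> on \<open>H\<close> and \<open>N\<close> to be
  \<open>- \<nu>\<close> off \<open>H\<close>.\<close>

lemma jordan_decomposition_atomsD:
  fixes z :: "nat \<Rightarrow> 'a::t1_space" and f :: "'a \<Rightarrow> complex"
  assumes jd: "jordan_decomposition \<nu> P N" and inj: "inj_on z {..<r}"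
    and nu: "\<And>A. A \<in> sets borel \<Longrightarrow> \<nu> A = (\<Sum>a<r. c a * indicator A (z a))"
    and f: "f \<in> borel_measurable borel"
  shows "integral\<^sup>L P f - integral\<^sup>L N f = (\<Sum>a<r. of_real (c a) * f (z a))"
proof -
  from jd have sets: "sets P = sets borel" "sets N = sets borel"
    and fin: "finite_measure P" "finite_measure N"
    and diff: "\<And>A. A \<in> sets borel \<Longrightarrow> \<nu> A = measure P A - measure N A"
    unfolding jordan_decomposition_def by auto
  from jd obtain H where H: "H \<in> sets borel" "emeasure P (- H) = 0" "emeasure N H = 0"
    unfolding jordan_decomposition_def by blast
  interpret P: finite_measure P by (rule fin)
  interpret N: finite_measure N by (rule fin)
  \<comment> \<open>The split follows \<open>H\<close> and not the sign of \<open>c\<close>, because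
    atoms with \<open>c a = 0\<close> may lie on either side.\<close>
  let ?I = "{a. a < r \<and> z a \<in> H}" and ?J = "{a. a < r \<and> z a \<notin> H}"
  have mP: "measure P A = (\<Sum>a\<in>?I. c a * indicator A (z a))" if A: "A \<in> sets borel" for A
  proof -
    have "measure P A = measure P (A \<inter> H) + measure P (A \<inter> - H)"
      using A H(1) sets by (subst P.finite_measure_Union[symmetric]) (auto intro!: arg_cong[where f = "measure P"])
    moreover have "measure P (A \<inter> - H) = 0"
    proof -
      have "measure P (A \<inter> - H) \<le> measure P (- H)" using H(1) sets by (intro P.finite_measure_mono) auto
      also have "\<dots> = 0" using H(2) by (simp add: Sigma_Algebra.measure_def)
      finally show ?thesis using measure_nonneg[of P "A \<inter> - H"] by linarith
    qed
    moreover have "measure N (A \<inter> H) = 0"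
    proof -
      have "measure N (A \<inter> H) \<le> measure N H" using H(1) sets by (intro N.finite_measure_mono) auto
      also have "\<dots> = 0" using H(3) by (simp add: Sigma_Algebra.measure_def)
      finally show ?thesis using measure_nonneg[of N "A \<inter> H"] by linarith
    qed
    ultimately have "measure P A = \<nu> (A \<inter> H)" using diff[of "A \<inter> H"] A H(1) by auto
    also have "\<dots> = (\<Sum>a<r. c a * indicator (A \<inter> H) (z a))" using A H(1) by (intro nu) auto
    also have "\<dots> = (\<Sum>a\<in>?I. c a * indicator A (z a))"
      by (rule sum.mono_neutral_cong_right) (auto simp: indicator_def)
    finally show ?thesis .
  qed
  have mN: "measure N A = (\<Sum>a\<in>?J. - c a * indicator A (z a))" if A: "A \<in> sets borel" for A
  proof -
    have "measure N A = measure P A - \<nu> A" using diff[OF A] by simp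
    also have "\<nu> A = (\<Sum>a\<in>?I. c a * indicator A (z a)) + (\<Sum>a\<in>?J. c a * indicator A (z a))"
      unfolding nu[OF A] by (subst sum.union_disjoint[symmetric]) (auto intro!: sum.cong)
    finally show ?thesis unfolding mP[OF A] by (simp add: sum_negf)
  qed
  \<comment> \<open>Singletons as test sets turn the nonnegativity of \<open>P\<close> and
    \<open>N\<close> into signs of the individual weights.\<close>
  have single: "(\<Sum>a\<in>K. k a * indicator {z b} (z a)) = (k b :: real)" if "K \<subseteq> {..<r}" "b \<in> K" for K b k
  proof -
    have "(\<Sum>a\<in>K. k a * indicator {z b} (z a)) = (\<Sum>a\<in>{b}. k a)"
      using that(2) finite_subset[OF that(1)] inj_on_eq_iff[OF inj_on_subset[OF inj that(1)]]
      by (intro sum.mono_neutral_cong_right) (auto simp: indicator_def)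
    then show ?thesis by simp
  qed
  have sub: "?I \<subseteq> {..<r}" "?J \<subseteq> {..<r}" and fIJ: "finite ?I" "finite ?J" by auto
  have pos: "\<forall>b\<in>?I. 0 \<le> c b"
  proof
    fix b assume "b \<in> ?I"
    from single[OF sub(1) this, of c] show "0 \<le> c b"
      using mP[of "{z b}"] measure_nonneg[of P "{z b}"] by simp
  qed
  have neg: "\<forall>b\<in>?J. 0 \<le> - c b"
  proof
    fix b assume "b \<in> ?J"
    from single[OF sub(2) this, of "\<lambda>a. - c a"] show "0 \<le> - c b"
      using mN[of "{z b}"] measure_nonneg[of N "{z b}"] by simp
  qed
  have P: "P = atoms_measure ?I c z"
  proof (rule measure_eqI)
    show "sets P = sets (atoms_measure ?I c z)" by (simp add: sets sets_atoms_measure)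
    fix A assume "A \<in> sets P"
    then have A: "A \<in> sets borel" using sets by simp
    show "emeasure P A = emeasure (atoms_measure ?I c z) A"
      unfolding emeasure_atoms_measure[where c = c, OF fIJ(1) pos A] P.emeasure_eq_measure mP[OF A] by (rule refl)
  qed
  have N: "N = atoms_measure ?J (\<lambda>a. - c a) z"
  proof (rule measure_eqI)
    show "sets N = sets (atoms_measure ?J (\<lambda>a. - c a) z)" by (simp add: sets sets_atoms_measure)
    fix A assume "A \<in> sets N"
    then have A: "A \<in> sets borel" using sets by simp
    show "emeasure N A = emeasure (atoms_measure ?J (\<lambda>a. - c a) z) A"
      unfolding emeasure_atoms_measure[where c = "\<lambda>a. - c a", OF fIJ(2) neg A] N.emeasure_eq_measure mN[OF A] by (rule refl)
  qed
  have "integral\<^sup>L P f - integral\<^sup>L N f =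
      (\<Sum>a\<in>?I. of_real (c a) * f (z a)) - (\<Sum>a\<in>?J. of_real (- c a) * f (z a))"
    unfolding P N integral_atoms_measure(2)[where c = c, OF fIJ(1) pos f] integral_atoms_measure(2)[where c = "\<lambda>a. - c a", OF fIJ(2) neg f] by (rule refl)
  also have "\<dots> = (\<Sum>a\<in>?I. of_real (c a) * f (z a)) + (\<Sum>a\<in>?J. of_real (c a) * f (z a))"
    by (simp add: sum_negf)
  also have "\<dots> = (\<Sum>a<r. of_real (c a) * f (z a))"
    by (subst sum.union_disjoint[symmetric]) (auto intro!: sum.cong)
  finally show ?thesis .
qed

lemma atomic_Re_Im:
  assumes "atomic r z w \<mu>" "A \<in> sets borel"
  shows "Re (\<mu> A) = (\<Sum>a<r. Re (w a) * indicator A (z a))" "Im (\<mu> A) = (\<Sum>a<r. Im (w a) * indicator A (z a))"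
  using assms by (auto simp: atomic_def dirac_def Re_sum Im_sum indicator_def intro!: sum.cong)

theorem has_cm_integral_atomic:
  fixes z :: "nat \<Rightarrow> 'a::t1_space"
  assumes at: "atomic r z w \<mu>" and f: "f \<in> borel_measurable borel"
  shows "has_cm_integral \<mu> f I \<longleftrightarrow> I = (\<Sum>a<r. w a * f (z a))"
proof -
  have inj: "inj_on z {..<r}" using at by (simp add: atomic_def)
  note re = atomic_Re_Im(1)[OF at] and im = atomic_Re_Im(2)[OF at]
  have val: "(integral\<^sup>L P f - integral\<^sup>L N f) + \<i> * (integral\<^sup>L P' f - integral\<^sup>L N' f) = (\<Sum>a<r. w a * f (z a))"
    if "jordan_decomposition (\<lambda>A. Re (\<mu> A)) P N" "jordan_decomposition (\<lambda>A. Im (\<mu> A)) P' N'" for P N P' N'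
  proof -
    have "(\<Sum>a<r. w a * f (z a)) = (\<Sum>a<r. of_real (Re (w a)) * f (z a)) + \<i> * (\<Sum>a<r. of_real (Im (w a)) * f (z a))"
      unfolding sum_distrib_left sum.distrib[symmetric]
      by (intro sum.cong refl) (simp add: complex_eq_iff algebra_simps)
    then show ?thesis
      using jordan_decomposition_atomsD[OF that(1) inj re f] jordan_decomposition_atomsD[OF that(2) inj im f] by simp
  qed
  have "\<exists>P N P' N'. jordan_decomposition (\<lambda>A. Re (\<mu> A)) P N \<and> jordan_decomposition (\<lambda>A. Im (\<mu> A)) P' N' \<and>
        integrable P f \<and> integrable N f \<and> integrable P' f \<and> integrable N' f"
  proof (intro exI conjI)
    show "jordan_decomposition (\<lambda>A. Re (\<mu> A)) (atoms_measure {a. a < r \<and> Re (w a) > 0} (\<lambda>a. Re (w a)) z)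
      (atoms_measure {a. a < r \<and> Re (w a) < 0} (\<lambda>a. - Re (w a)) z)"
      using inj re by (rule jordan_decomposition_atoms)
    show "jordan_decomposition (\<lambda>A. Im (\<mu> A)) (atoms_measure {a. a < r \<and> Im (w a) > 0} (\<lambda>a. Im (w a)) z)
      (atoms_measure {a. a < r \<and> Im (w a) < 0} (\<lambda>a. - Im (w a)) z)"
      using inj im by (rule jordan_decomposition_atoms)
  qed (rule integral_atoms_measure(1)[OF _ _ f]; auto)+
  then obtain P N P' N' where ex: "jordan_decomposition (\<lambda>A. Re (\<mu> A)) P N"
    "jordan_decomposition (\<lambda>A. Im (\<mu> A)) P' N'"
    "integrable P f" "integrable N f" "integrable P' f" "integrable N' f" by blast
  show ?thesis
  proof
    assume "has_cm_integral \<mu> f I"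
    then obtain P N P' N' where "jordan_decomposition (\<lambda>A. Re (\<mu> A)) P N"
      "jordan_decomposition (\<lambda>A. Im (\<mu> A)) P' N'"
      "I = (integral\<^sup>L P f - integral\<^sup>L N f) + \<i> * (integral\<^sup>L P' f - integral\<^sup>L N' f)"
      unfolding has_cm_integral_def by blast
    then show "I = (\<Sum>a<r. w a * f (z a))" using val by simp
  next
    assume "I = (\<Sum>a<r. w a * f (z a))"
    then have "I = (integral\<^sup>L P f - integral\<^sup>L N f) + \<i> * (integral\<^sup>L P' f - integral\<^sup>L N' f)"
      using val[OF ex(1,2)] by simp
    then show "has_cm_integral \<mu> f I" unfolding has_cm_integral_def using ex by blast
  qed
qed

text \<open>The singleton of an atom has its nonzero weight as measure, and the complement of the
  finitely many atoms is open and contains null sets only.\<close>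

lemma supp_atomic:
  fixes z :: "nat \<Rightarrow> 'a::t1_space"
  assumes at: "atomic r z w \<mu>"
  shows "supp \<mu> = z ` {..<r}"
proof (intro equalityI subsetI)
  fix x assume x: "x \<in> supp \<mu>"
  show "x \<in> z ` {..<r}"
  proof (rule ccontr)
    assume n: "x \<notin> z ` {..<r}"
    have o: "open (- (z ` {..<r}))" by (intro open_Compl finite_imp_closed) simp
    then obtain A where A: "A \<in> sets borel" "A \<subseteq> - (z ` {..<r})" "\<mu> A \<noteq> 0"
      using x n unfolding supp_def by blast
    have "\<mu> A = (\<Sum>a<r. w a * dirac (z a) A)" using at A(1) by (simp add: atomic_def)
    also have "\<dots> = 0" using A(2) by (intro sum.neutral) (auto simp: dirac_def indicator_def)
    finally show False using A(3) by simp
  qed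
next
  fix x assume "x \<in> z ` {..<r}"
  then obtain a where a: "a < r" "x = z a" by blast
  have "\<mu> {x} = (\<Sum>b<r. w b * dirac (z b) {x})" using at by (simp add: atomic_def)
  also have "\<dots> = (\<Sum>b<r. if b = a then w a else 0)"
    using at a by (intro sum.cong refl) (auto simp: atomic_def dirac_def indicator_def inj_on_eq_iff)
  also have "\<dots> = w a" using a by simp
  finally have "\<mu> {x} \<noteq> 0" using at a by (simp add: atomic_def)
  then show "x \<in> supp \<mu>" unfolding supp_def by (auto intro!: bexI[of _ "{x}"])
qed

lemma complex_measure_atoms:
  fixes z :: "nat \<Rightarrow> 'a::t1_space"
  shows "complex_measure (\<lambda>A. \<Sum>a<r. w a * dirac (z a) A)"
  unfolding complex_measure_def
proof (intro allI impI)
  fix A :: "nat \<Rightarrow> 'a set" assume d: "disjoint_family A"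
  have "(\<lambda>i. dirac (z a) (A i)) sums dirac (z a) (\<Union>i. A i)" for a
  proof -
    have "(\<lambda>i. complex_of_real (indicator (A i) (z a))) sums complex_of_real (indicator (\<Union>i. A i) (z a))"
      using d by (intro sums_of_real indicator_sums) (auto simp: disjoint_family_on_def)
    then show ?thesis by (simp add: dirac_def of_real_indicator)
  qed
  then show "(\<lambda>i. \<Sum>a<r. w a * dirac (z a) (A i)) sums (\<Sum>a<r. w a * dirac (z a) (\<Union>i. A i))"
    by (intro sums_sum sums_mult)
qed

lemma mono_at_measurable [measurable]: "mono_at g \<in> borel_measurable borel"
  unfolding mono_at_def by (intro borel_measurable_continuous_onI continuous_intros)

section \<open>Inertia of real symmetric matrices\<close>

text \<open>Reduces to a single block: entries outside the blocks vanish, and the diagonal of a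
  block is constant.\<close>

lemma jordan_matrix_index:
  assumes "i < sum_list (map fst n_as)" "j < sum_list (map fst n_as)" "jordan_matrix n_as $$ (i, j) \<noteq> 0"
  shows "i = j \<or> j = Suc i \<and> jordan_matrix n_as $$ (i, j) = 1 \<and> jordan_matrix n_as $$ (i, i) = jordan_matrix n_as $$ (j, j)"
  using assms
proof (induction n_as arbitrary: i j)
  case (Cons na n_as)
  obtain n a where na: "na = (n, a)" by force
  let ?J = "jordan_matrix n_as" and ?m = "sum_list (map fst n_as)"
  have eq: "jordan_matrix (na # n_as) = four_block_mat (jordan_block n a) (0\<^sub>m n ?m) (0\<^sub>m ?m n) ?J"
    using jordan_matrix_dim[of n_as] by (simp add: jordan_matrix_def na Let_def)
  have ix: "jordan_matrix (na # n_as) $$ (i, j) = (if i < n then if j < n then jordan_block n a $$ (i, j) else 0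
     else if j < n then 0 else ?J $$ (i - n, j - n))" if "i < n + ?m" "j < n + ?m" for i j
    unfolding eq using that by (subst index_mat_four_block) (auto simp: jordan_block_def)
  have ij: "i < n + ?m" "j < n + ?m" using Cons.prems na by auto
  show ?case
  proof (cases "i < n \<or> j < n")
    case True
    then show ?thesis using Cons.prems(3) ij unfolding ix[OF ij] ix[OF ij(1) ij(1)] ix[OF ij(2) ij(2)]
      by (auto split: if_splits)
  next
    case False
    then obtain i' j' where e: "i = n + i'" "j = n + j'" by (metis le_add_diff_inverse not_less)
    then show ?thesis using Cons.prems(3) Cons.IH[of i' j'] ij
      unfolding ix[OF ij] ix[OF ij(1) ij(1)] ix[OF ij(2) ij(2)] by auto
  qed
qed simp

text \<open>Each complex eigenvalue is the Hermitian form of \<open>A\<close> at an eigenvector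
  divided by the squared norm of that vector, hence real, and the complex factorisation descends to
  the reals.\<close>

lemma symmetric_char_poly_splits:
  fixes A :: "real mat"
  assumes A: "A \<in> carrier_mat N N" and sym: "\<And>i j. i < N \<Longrightarrow> j < N \<Longrightarrow> A $$ (i, j) = A $$ (j, i)"
  obtains es where "char_poly A = (\<Prod>a\<leftarrow>es. [:- a, 1:])"
proof -
  let ?A = "map_mat complex_of_real A"
  have cA: "?A \<in> carrier_mat N N" using A by simp
  obtain as where as: "char_poly ?A = (\<Prod>a\<leftarrow>as. [:- a, 1:])" using char_poly_factorized[OF cA] by blast
  have real: "a \<in> \<real>" if "a \<in> set as" for a
  proof -
    have "poly (char_poly ?A) a = 0" using that unfolding as by (simp add: poly_prod_list prod_list_zero_iff image_iff)
    then have "eigenvalue ?A a" by (simp add: eigenvalue_root_char_poly[OF cA])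
    then obtain v where v: "v \<in> carrier_vec N" "v \<noteq> 0\<^sub>v N" "?A *\<^sub>v v = a \<cdot>\<^sub>v v"
      using A unfolding eigenvalue_def eigenvector_def by auto
    let ?v = "vec_index v"
    have Av: "(\<Sum>j<N. complex_of_real (A $$ (i, j)) * ?v j) = a * ?v i" if "i < N" for i
      using mult_mat_vec_index_sum[OF cA v(1) that] v that A by simp
    define q where "q = (\<Sum>i<N. \<Sum>j<N. cnj (?v i) * complex_of_real (A $$ (i, j)) * ?v j)"
    define t where "t = (\<Sum>i<N. (cmod (?v i))\<^sup>2)"
    have "q = (\<Sum>i<N. cnj (?v i) * (a * ?v i))"
      unfolding q_def by (intro sum.cong refl) (simp add: Av[symmetric] sum_distrib_left mult.assoc)
    also have "\<dots> = a * of_real t"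
      unfolding t_def of_real_sum sum_distrib_left
      by (intro sum.cong refl, subst complex_norm_square) (simp add: mult_ac)
    finally have qa: "q = a * of_real t" .
    have "cnj q = (\<Sum>i<N. \<Sum>j<N. cnj (?v j) * complex_of_real (A $$ (j, i)) * ?v i)"
      unfolding q_def cnj_sum by (intro sum.cong refl) (auto simp: sym[of _ _] mult_ac)
    also have "\<dots> = q" unfolding q_def by (rule sum.swap)
    finally have "cnj q = q" .
    obtain k where k: "k < N" "?v k \<noteq> 0" using v(1,2) by (auto simp: Matrix.vec_eq_iff)
    have "0 < (cmod (?v k))\<^sup>2" using k by simp
    also have "\<dots> \<le> t" unfolding t_def using k by (intro member_le_sum) auto
    finally have "t > 0" .
    have "a = q / of_real t" using qa \<open>t > 0\<close> by simp
    moreover have "q \<in> \<real>" using \<open>cnj q = q\<close> by (simp add: Reals_cnj_iff)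
    ultimately show ?thesis by (simp add: Reals_divide)
  qed
  have "as = map complex_of_real (map Re as)"
    using real by (simp add: map_idI complex_is_Real_iff complex_eq_iff)
  moreover have "(\<Prod>a\<leftarrow>map complex_of_real bs. [:- a, 1:]) = map_poly complex_of_real (\<Prod>a\<leftarrow>bs. [:- a, 1:])" for bs
    by (induction bs) (simp_all add: hom_distribs, auto simp: poly_eq_iff coeff_map_poly coeff_pCons split: nat.splits)
  ultimately have "char_poly ?A = map_poly complex_of_real (\<Prod>a\<leftarrow>map Re as. [:- a, 1:])"
    unfolding as by metis
  then have "map_poly complex_of_real (char_poly A) = map_poly complex_of_real (\<Prod>a\<leftarrow>map Re as. [:- a, 1:])"
    unfolding of_real_hom.char_poly_hom[OF A] .
  then have "char_poly A = (\<Prod>a\<leftarrow>map Re as. [:- a, 1:])"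
    by (simp add: poly_eq_iff coeff_map_poly)
  then show thesis by (rule that)
qed

text \<open>A Jordan block of size at least two would give \<open>p\<^sub>k = (A - t) p\<^sub>k\<^sub>+\<^sub>1\<close> and \<open>(A - t) p\<^sub>k = 0\<close>,
  hence \<open>|p\<^sub>k|\<^sup>2 = 0\<close>.\<close>

lemma symmetric_diagonalisation:
  fixes A :: "real mat"
  assumes A: "A \<in> carrier_mat N N" and sym: "\<And>i j. i < N \<Longrightarrow> j < N \<Longrightarrow> A $$ (i, j) = A $$ (j, i)"
  obtains D P Q where "similar_mat_wit A D P Q" "diagonal_mat D"
proof -
  obtain es where "char_poly A = (\<Prod>a\<leftarrow>es. [:- a, 1:])" using symmetric_char_poly_splits[OF assms] .
  from jordan_nf_exists[OF A this] obtain n_as where "jordan_nf A n_as" ..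
  then have "similar_mat A (jordan_matrix n_as)" by (simp add: jordan_nf_def)
  then obtain P Q where w: "similar_mat_wit A (jordan_matrix n_as) P Q" unfolding similar_mat_def by blast
  define J where "J = jordan_matrix n_as"
  have car: "J \<in> carrier_mat N N" "P \<in> carrier_mat N N" "Q \<in> carrier_mat N N"
    and PQ: "P * Q = 1\<^sub>m N" "Q * P = 1\<^sub>m N" and eq: "A = P * J * Q"
    using w A unfolding similar_mat_wit_def Let_def J_def by auto
  have N: "sum_list (map fst n_as) = N" using car(1) unfolding J_def carrier_mat_def by simp
  have AP: "A * P = P * J"
  proof -
    have "A * P = P * J * (Q * P)" unfolding eq using car by (simp add: assoc_mult_mat[of _ N N _ N _ N])
    then show ?thesis unfolding PQ(2) using car by simp
  qed
  have APix: "(\<Sum>l<N. A $$ (i, l) * P $$ (l, k)) = (\<Sum>l<N. P $$ (i, l) * J $$ (l, k))" if "i < N" "k < N" for i k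
    using AP mult_mat_index_sum[OF A car(2) that] mult_mat_index_sum[OF car(2,1) that] by simp
  have "diagonal_mat J"
  proof (rule ccontr)
    assume "\<not> ?thesis"
    then obtain i j where ij: "i < N" "j < N" "i \<noteq> j" "J $$ (i, j) \<noteq> 0"
      using car(1) unfolding diagonal_mat_def by auto
    let ?S = "\<lambda>k. Suc k < N \<and> J $$ (k, Suc k) \<noteq> 0"
    have "?S i" using jordan_matrix_index[of i n_as j] ij N by (auto simp: J_def)
    \<comment> \<open>With \<open>k\<close> minimal, column \<open>k\<close> of \<open>J\<close> has
      no entry off the diagonal, so column \<open>k\<close> of \<open>P\<close> is a true
      eigenvector, while column \<open>Suc k\<close> is only a generalised one.\<close>
    define k where "k = (LEAST k. ?S k)"
    have k: "?S k" unfolding k_def by (rule LeastI[of ?S, OF \<open>?S i\<close>])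
    have km: "\<not> ?S l" if "l < k" for l using not_less_Least[of l ?S] that unfolding k_def by blast
    define t where "t = J $$ (k, k)"
    have k1: "J $$ (k, Suc k) = 1" "J $$ (Suc k, Suc k) = t"
      using jordan_matrix_index[of k n_as "Suc k"] k N by (auto simp: J_def t_def)
    have J0: "J $$ (l, m) = 0" if "l < N" "m < N" "l \<noteq> m" "m \<noteq> Suc l" for l m
      using jordan_matrix_index[of l n_as m] that N by (auto simp: J_def)
    have Jk: "J $$ (l, k) = 0" if "l < N" "l \<noteq> k" for l
      using that k km[of l] J0[of l k] by (cases "k = Suc l") auto
    have ck: "(\<Sum>l<N. A $$ (i, l) * P $$ (l, k)) = t * P $$ (i, k)" if "i < N" for i
    proof -
      have "(\<Sum>l<N. P $$ (i, l) * J $$ (l, k)) = (\<Sum>l<N. if l = k then P $$ (i, k) * t else 0)"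
        by (intro sum.cong refl) (auto simp: t_def Jk)
      then show ?thesis using k APix[of i k] that by simp
    qed
    have ck1: "(\<Sum>l<N. A $$ (i, l) * P $$ (l, Suc k)) = t * P $$ (i, Suc k) + P $$ (i, k)" if "i < N" for i
    proof -
      have "(\<Sum>l<N. P $$ (i, l) * J $$ (l, Suc k)) =
        (\<Sum>l<N. (if l = Suc k then P $$ (i, Suc k) * t else 0) + (if l = k then P $$ (i, k) else 0))"
        using k k1 J0 by (intro sum.cong refl) auto
      then show ?thesis using k APix[of i "Suc k"] that by (simp add: sum.distrib)
    qed
    \<comment> \<open>The form of \<open>A\<close> at columns \<open>k\<close> and
      \<open>Suc k\<close> of \<open>P\<close> is evaluated from both sides; the terms with
      \<open>t\<close> cancel and the squared norm of column \<open>k\<close> remains.\<close>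
    have "(\<Sum>i<N. P $$ (i, k) * (t * P $$ (i, Suc k) + P $$ (i, k))) =
      (\<Sum>i<N. \<Sum>l<N. P $$ (i, k) * A $$ (i, l) * P $$ (l, Suc k))"
      by (intro sum.cong refl) (simp add: ck1[symmetric] sum_distrib_left mult.assoc)
    also have "\<dots> = (\<Sum>l<N. \<Sum>i<N. P $$ (i, k) * A $$ (l, i) * P $$ (l, Suc k))"
      by (subst sum.swap, intro sum.cong refl) (auto simp: sym[of _ _])
    also have "\<dots> = (\<Sum>l<N. t * P $$ (l, k) * P $$ (l, Suc k))"
      by (intro sum.cong refl) (simp add: ck[symmetric] sum_distrib_left sum_distrib_right mult_ac)
    finally have "(\<Sum>i<N. (P $$ (i, k))\<^sup>2) = 0"
      by (simp add: distrib_left sum.distrib power2_eq_square mult_ac)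
    then have "P $$ (i, k) = 0" if "i < N" for i using that by (simp add: sum_nonneg_eq_0_iff)
    then have "(Q * P) $$ (k, k) = 0" using k by (subst mult_mat_index_sum[OF car(3,2)]) auto
    then show False using k unfolding PQ(2) by simp
  qed
  then show thesis using that[of J P Q] w by (simp add: J_def)
qed

lemma order_linear_prod:
  "Polynomial.order x (\<Prod>i<N. [:- D i, 1:]) = card {i. i < N \<and> D i = x}" for x :: real and N :: nat
proof (induction N)
  case (Suc N)
  have "(\<Prod>i<N. [:- D i, 1:]) \<noteq> 0" by (simp add: prod_zero_iff)
  then have "(\<Prod>i<N. [:- D i, 1:]) * [:- D N, 1:] \<noteq> 0" by (simp only: mult_eq_0_iff) simp
  then have "Polynomial.order x (\<Prod>i<Suc N. [:- D i, 1:]) =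
    Polynomial.order x (\<Prod>i<N. [:- D i, 1:]) + Polynomial.order x [:- D N, 1:]"
    unfolding prod.lessThan_Suc by (rule order_mult)
  also have "Polynomial.order x [:- D N, 1:] = (if D N = x then 1 else 0)"
    using order_linear_power[of x "- D N" 1] by simp
  also have "{i. i < Suc N \<and> D i = x} = {i. i < N \<and> D i = x} \<union> (if D N = x then {N} else {})"
    by (auto simp: less_Suc_eq)
  ultimately show ?case using Suc.IH by auto
qed (simp add: order_0I)

text \<open>Similarity preserves the characteristic polynomial, so its root multiplicities count
  repetitions on the diagonal of \<open>D\<close>.\<close>

lemma inertia_diagonal:
  fixes A :: "real mat"
  assumes A: "A \<in> carrier_mat N N" and w: "similar_mat_wit A D P Q" and D: "diagonal_mat D"
  shows "i_plus A = card {i. i < N \<and> D $$ (i, i) > 0}" "i_minus A = card {i. i < N \<and> D $$ (i, i) < 0}"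
proof -
  have cD: "D \<in> carrier_mat N N" using w A unfolding similar_mat_wit_def Let_def by auto
  have "char_poly A = char_poly D" using w by (intro char_poly_similar) (auto simp: similar_mat_def)
  also have "\<dots> = (\<Prod>a\<leftarrow>diag_mat D. [:- a, 1:])"
    using D cD by (intro char_poly_upper_triangular[OF cD]) (auto simp: upper_triangular_def diagonal_mat_def)
  also have "\<dots> = (\<Prod>i<N. [:- D $$ (i, i), 1:])"
    using cD by (simp add: diag_mat_def prod.list_conv_set_nth atLeast0LessThan)
  finally have cp: "char_poly A = (\<Prod>i<N. [:- D $$ (i, i), 1:])" .
  have ev: "eigenvalue A x \<longleftrightarrow> (\<exists>i<N. D $$ (i, i) = x)" for x
    unfolding eigenvalue_root_char_poly[OF A] cp poly_prod by auto
  have *: "(\<Sum>x | eigenvalue A x \<and> p x. Polynomial.order x (char_poly A)) = card {i. i < N \<and> p (D $$ (i, i))}" for p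
  proof -
    let ?S = "{x. eigenvalue A x \<and> p x}"
    have S: "?S = (\<lambda>i. D $$ (i, i)) ` {i. i < N \<and> p (D $$ (i, i))}" by (auto simp: ev)
    have "card {i. i < N \<and> p (D $$ (i, i))} = card (\<Union>x\<in>?S. {i. i < N \<and> D $$ (i, i) = x})"
      by (rule arg_cong[where f = card]) (auto simp: ev)
    also have "\<dots> = (\<Sum>x\<in>?S. card {i. i < N \<and> D $$ (i, i) = x})"
      unfolding S by (rule card_UN_disjoint) auto
    finally show ?thesis unfolding cp order_linear_prod by simp
  qed
  show "i_plus A = card {i. i < N \<and> D $$ (i, i) > 0}" "i_minus A = card {i. i < N \<and> D $$ (i, i) < 0}"
    unfolding i_plus_def i_minus_def by (rule *)+
qed

text \<open>Sylvester's law of inertia. Eigenvectors for different eigenvalues are orthogonal, so on the span of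
  eigenvectors whose eigenvalues have sign \<open>e\<close> the quadratic form is \<open>e\<close> times a sum of squares; an
  excess of positive eigenvalues or of positive weights would give a nonzero vector on which the form is
  both positive and nonpositive.\<close>

lemma positive_index_eq:
  fixes A p Q :: "nat \<Rightarrow> nat \<Rightarrow> real" and N r :: nat
  assumes eig: "\<And>i k. i < N \<Longrightarrow> k < N \<Longrightarrow> (\<Sum>j<N. A i j * p j k) = D k * p i k"
    and sym: "\<And>i j. i < N \<Longrightarrow> j < N \<Longrightarrow> A i j = A j i"
    and PQ: "\<And>i j. i < N \<Longrightarrow> j < N \<Longrightarrow> (\<Sum>k<N. p i k * Q k j) = (if i = j then 1 else 0)"
    and QP: "\<And>i j. i < N \<Longrightarrow> j < N \<Longrightarrow> (\<Sum>k<N. Q i k * p k j) = (if i = j then 1 else 0)"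
    and rep: "\<And>i j. i < N \<Longrightarrow> j < N \<Longrightarrow> A i j = (\<Sum>a<r. w a * g a i * g a j)"
    and gh: "\<And>a b. a < r \<Longrightarrow> b < r \<Longrightarrow> (\<Sum>i<N. g a i * h i b) = (if a = b then 1 else 0)"
  shows "card {k. k < N \<and> D k > 0} = card {a. a < r \<and> w a > 0}" (is "card ?K = card ?R")
proof -
  define q where "q x = (\<Sum>i<N. \<Sum>j<N. x i * A i j * x j)" for x
  have q_rep: "q x = (\<Sum>a<r. w a * (\<Sum>i<N. g a i * x i)\<^sup>2)" for x
  proof -
    have "q x = (\<Sum>i<N. \<Sum>j<N. \<Sum>a<r. w a * ((g a i * x i) * (g a j * x j)))"
      unfolding q_def by (intro sum.cong refl) (simp add: rep sum_distrib_left sum_distrib_right mult_ac)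
    also have "\<dots> = (\<Sum>i<N. \<Sum>a<r. \<Sum>j<N. w a * ((g a i * x i) * (g a j * x j)))"
      by (intro sum.cong refl sum.swap)
    also have "\<dots> = (\<Sum>a<r. \<Sum>i<N. \<Sum>j<N. w a * ((g a i * x i) * (g a j * x j)))" by (rule sum.swap)
    also have "\<dots> = (\<Sum>a<r. w a * (\<Sum>i<N. g a i * x i)\<^sup>2)"
      by (simp only: sum_distrib_left[symmetric] sum_distrib_right[symmetric] power2_eq_square)
    finally show ?thesis .
  qed
  \<comment> \<open>Gram matrix of the eigenvectors. The similarity need not be orthogonal, so
    \<open>G\<close> is in general not the identity.\<close>
  define G where "G k l = (\<Sum>i<N. p i k * p i l)" for k l
  have orth: "G k l = 0" if "k < N" "l < N" "D k \<noteq> D l" for k l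
  proof -
    have "D l * G k l = (\<Sum>i<N. \<Sum>j<N. p i k * A i j * p j l)"
      unfolding G_def sum_distrib_left using that
      by (intro sum.cong refl) (simp add: mult.left_commute[of "D l"] eig[symmetric] sum_distrib_left mult.assoc)
    also have "\<dots> = (\<Sum>j<N. \<Sum>i<N. A j i * p i k * p j l)"
      by (subst sum.swap, intro sum.cong refl) (auto simp: sym[of _ _] mult_ac)
    also have "\<dots> = D k * G k l"
      unfolding G_def sum_distrib_left using that
      by (intro sum.cong refl) (simp add: mult.assoc[symmetric] eig[symmetric] sum_distrib_right)
    finally show ?thesis using that(3) by simp
  qed
  \<comment> \<open>Eigenvectors for one eigenvalue need not be orthogonal. But \<open>G k l\<close>
    vanishes unless \<open>D k = D l\<close>, and then \<open>D l\<close> equals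
    \<open>e * sqrt \<bar>D k\<bar> * sqrt \<bar>D l\<bar>\<close>, which turns the double sum into
    \<open>e\<close> times a sum of squares.\<close>
  have q_p: "q (\<lambda>i. \<Sum>k\<in>S. c k * p i k) = e * (\<Sum>i<N. (\<Sum>k\<in>S. c k * sqrt \<bar>D k\<bar> * p i k)\<^sup>2)"
    if S: "S \<subseteq> {..<N}" and e: "\<And>k. k \<in> S \<Longrightarrow> D k = e * \<bar>D k\<bar>" for S c e
  proof -
    have Ax: "(\<Sum>j<N. A i j * (\<Sum>l\<in>S. c l * p j l)) = (\<Sum>l\<in>S. c l * D l * p i l)" if "i < N" for i
    proof -
      have "(\<Sum>j<N. A i j * (\<Sum>l\<in>S. c l * p j l)) = (\<Sum>l\<in>S. c l * (\<Sum>j<N. A i j * p j l))"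
        unfolding sum_distrib_left by (subst sum.swap) (simp add: mult_ac)
      also have "\<dots> = (\<Sum>l\<in>S. c l * D l * p i l)"
        using that S by (intro sum.cong refl) (subst eig, auto)
      finally show ?thesis .
    qed
    have "q (\<lambda>i. \<Sum>k\<in>S. c k * p i k) = (\<Sum>i<N. (\<Sum>k\<in>S. c k * p i k) * (\<Sum>j<N. A i j * (\<Sum>l\<in>S. c l * p j l)))"
      unfolding q_def by (intro sum.cong refl) (simp add: sum_distrib_left mult.assoc)
    also have "\<dots> = (\<Sum>i<N. (\<Sum>k\<in>S. c k * p i k) * (\<Sum>l\<in>S. c l * D l * p i l))"
      by (intro sum.cong refl) (simp add: Ax)
    also have "\<dots> = (\<Sum>i<N. \<Sum>k\<in>S. \<Sum>l\<in>S. c k * (c l * D l) * (p i k * p i l))"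
      by (simp add: sum_product mult_ac)
    also have "\<dots> = (\<Sum>k\<in>S. \<Sum>i<N. \<Sum>l\<in>S. c k * (c l * D l) * (p i k * p i l))" by (rule sum.swap)
    also have "\<dots> = (\<Sum>k\<in>S. \<Sum>l\<in>S. c k * (c l * D l) * G k l)"
      unfolding G_def sum_distrib_left by (intro sum.cong refl sum.swap)
    also have "\<dots> = (\<Sum>k\<in>S. \<Sum>l\<in>S. e * ((c k * sqrt \<bar>D k\<bar>) * (c l * sqrt \<bar>D l\<bar>) * G k l))"
    proof (intro sum.cong refl)
      fix k l assume kl: "k \<in> S" "l \<in> S"
      show "c k * (c l * D l) * G k l = e * ((c k * sqrt \<bar>D k\<bar>) * (c l * sqrt \<bar>D l\<bar>) * G k l)"
      proof (cases "D k = D l")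
        case True
        then have "e * (sqrt \<bar>D k\<bar> * sqrt \<bar>D l\<bar>) = D l" using e[OF kl(2)] by simp
        then show ?thesis by (simp add: algebra_simps)
      next
        case False
        then show ?thesis using orth[of k l] kl S by auto
      qed
    qed
    also have "\<dots> = e * (\<Sum>k\<in>S. \<Sum>l\<in>S. \<Sum>i<N. (c k * sqrt \<bar>D k\<bar> * p i k) * (c l * sqrt \<bar>D l\<bar> * p i l))"
      unfolding G_def sum_distrib_left by (intro sum.cong refl) (simp add: mult_ac)
    also have "(\<Sum>k\<in>S. \<Sum>l\<in>S. \<Sum>i<N. (c k * sqrt \<bar>D k\<bar> * p i k) * (c l * sqrt \<bar>D l\<bar> * p i l)) =
       (\<Sum>k\<in>S. \<Sum>i<N. \<Sum>l\<in>S. (c k * sqrt \<bar>D k\<bar> * p i k) * (c l * sqrt \<bar>D l\<bar> * p i l))"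
      by (intro sum.cong refl sum.swap)
    also have "\<dots> = (\<Sum>i<N. \<Sum>k\<in>S. \<Sum>l\<in>S. (c k * sqrt \<bar>D k\<bar> * p i k) * (c l * sqrt \<bar>D l\<bar> * p i l))"
      by (rule sum.swap)
    also have "\<dots> = (\<Sum>i<N. (\<Sum>k\<in>S. c k * sqrt \<bar>D k\<bar> * p i k)\<^sup>2)"
      by (simp add: power2_eq_square sum_product)
    finally show ?thesis .
  qed
  have indep: "c k = 0" if S: "S \<subseteq> {..<N}" and z: "\<And>i. i < N \<Longrightarrow> (\<Sum>k\<in>S. c k * p i k) = 0" and k: "k \<in> S" for S c k
  proof -
    have "0 = (\<Sum>i<N. Q k i * (\<Sum>l\<in>S. c l * p i l))" using z by simp
    also have "\<dots> = (\<Sum>l\<in>S. c l * (\<Sum>i<N. Q k i * p i l))"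
      unfolding sum_distrib_left by (subst sum.swap) (simp add: mult_ac)
    also have "\<dots> = (\<Sum>l\<in>S. if l = k then c k else 0)"
      using S k by (intro sum.cong refl) (subst QP, auto)
    also have "\<dots> = c k" using k finite_subset[OF S] by simp
    finally show ?thesis by simp
  qed
  have fin: "finite ?K" "finite ?R" by auto
  have "card ?K \<le> card ?R"
  proof (rule ccontr)
    assume "\<not> ?thesis"
    \<comment> \<open>\<open>c\<close> gives a vector in the span of the eigenvectors with positive
      eigenvalue on which all \<open>g a\<close> of positive weight vanish.\<close>
    then obtain c where c: "\<exists>k\<in>?K. c k \<noteq> 0" "\<And>a. a \<in> ?R \<Longrightarrow> (\<Sum>k\<in>?K. (\<Sum>i<N. g a i * p i k) * c k) = 0"
      using homogeneous_system[OF fin(2,1), of "\<lambda>a k. \<Sum>i<N. g a i * p i k"] by auto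
    let ?x = "\<lambda>i. \<Sum>k\<in>?K. c k * p i k"
    have "q ?x \<le> 0" unfolding q_rep
    proof (rule sum_nonpos)
      fix a assume "a \<in> {..<r}"
      show "w a * (\<Sum>i<N. g a i * ?x i)\<^sup>2 \<le> 0"
      proof (cases "w a > 0")
        case True
        have "(\<Sum>i<N. g a i * ?x i) = (\<Sum>k\<in>?K. (\<Sum>i<N. g a i * p i k) * c k)"
          unfolding sum_distrib_left sum_distrib_right by (subst sum.swap) (simp add: mult_ac)
        also have "\<dots> = 0" using True \<open>a \<in> {..<r}\<close> by (intro c(2)) simp
        finally show ?thesis by simp
      qed (simp add: mult_nonpos_nonneg)
    qed
    moreover have "q ?x = 1 * (\<Sum>i<N. (\<Sum>k\<in>?K. c k * sqrt \<bar>D k\<bar> * p i k)\<^sup>2)"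
      by (rule q_p) auto
    moreover have "0 \<le> (\<Sum>i<N. (\<Sum>k\<in>?K. c k * sqrt \<bar>D k\<bar> * p i k)\<^sup>2)" by (rule sum_nonneg) simp
    ultimately have "(\<Sum>i<N. (\<Sum>k\<in>?K. c k * sqrt \<bar>D k\<bar> * p i k)\<^sup>2) = 0" by linarith
    then have "(\<Sum>k\<in>?K. c k * sqrt \<bar>D k\<bar> * p i k) = 0" if "i < N" for i
      using that by (simp add: sum_nonneg_eq_0_iff)
    then have "c k * sqrt \<bar>D k\<bar> = 0" if "k \<in> ?K" for k
      using indep[of ?K "\<lambda>k. c k * sqrt \<bar>D k\<bar>" k] that by auto
    then show False using c(1) by fastforce
  qed
  moreover have "card ?R \<le> card ?K"
  proof (rule ccontr)
    assume "\<not> ?thesis"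
    \<comment> \<open>Dually, the vector is a combination of the columns \<open>h _ b\<close> with
      \<open>w b > 0\<close>, so that \<open>g\<close> reads off its coefficients, and it has no
      component along eigenvectors with positive eigenvalue.\<close>
    then obtain c where c: "\<exists>b\<in>?R. c b \<noteq> 0" "\<And>k. k \<in> ?K \<Longrightarrow> (\<Sum>b\<in>?R. (\<Sum>i<N. Q k i * h i b) * c b) = 0"
      using homogeneous_system[OF fin(1,2), of "\<lambda>k b. \<Sum>i<N. Q k i * h i b"] by auto
    define x where "x i = (\<Sum>b\<in>?R. h i b * c b)" for i
    define y where "y k = (\<Sum>i<N. Q k i * x i)" for k
    have y0: "y k = 0" if "k \<in> ?K" for k
    proof -
      have "y k = (\<Sum>b\<in>?R. (\<Sum>i<N. Q k i * h i b) * c b)"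
        unfolding y_def x_def sum_distrib_left sum_distrib_right by (subst sum.swap) (simp add: mult_ac)
      then show ?thesis using c(2)[OF that] by simp
    qed
    let ?L = "{k. k < N \<and> D k \<le> 0}"
    have xy: "x i = (\<Sum>k\<in>?L. y k * p i k)" if "i < N" for i
    proof -
      have "(\<Sum>k\<in>?L. y k * p i k) = (\<Sum>k<N. y k * p i k)"
        using y0 by (intro sum.mono_neutral_left) (auto simp: not_le)
      also have "\<dots> = (\<Sum>j<N. (\<Sum>k<N. p i k * Q k j) * x j)"
        unfolding y_def sum_distrib_left sum_distrib_right by (subst sum.swap) (simp add: mult_ac)
      also have "\<dots> = (\<Sum>j<N. if j = i then x i else 0)" using that by (intro sum.cong refl) (subst PQ, auto)
      also have "\<dots> = x i" using that by simp
      finally show ?thesis by simp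
    qed
    have "q x = q (\<lambda>i. \<Sum>k\<in>?L. y k * p i k)" unfolding q_def by (intro sum.cong refl) (auto simp: xy)
    also have "\<dots> = -1 * (\<Sum>i<N. (\<Sum>k\<in>?L. y k * sqrt \<bar>D k\<bar> * p i k)\<^sup>2)"
      by (rule q_p) auto
    also have "\<dots> \<le> 0" by (simp add: sum_nonneg)
    finally have "q x \<le> 0" .
    have gx: "(\<Sum>i<N. g a i * x i) = (if a \<in> ?R then c a else 0)" if "a < r" for a
    proof -
      have "(\<Sum>i<N. g a i * x i) = (\<Sum>b\<in>?R. (\<Sum>i<N. g a i * h i b) * c b)"
        unfolding x_def sum_distrib_left sum_distrib_right by (subst sum.swap) (simp add: mult_ac)
      also have "\<dots> = (\<Sum>b\<in>?R. if b = a then c a else 0)" using that by (intro sum.cong refl) (subst gh, auto)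
      also have "\<dots> = (if a \<in> ?R then c a else 0)" using fin(2) by simp
      finally show ?thesis .
    qed
    have "q x = (\<Sum>a\<in>?R. w a * (c a)\<^sup>2)" unfolding q_rep
      by (rule sum.mono_neutral_cong_right) (auto simp: gx)
    moreover obtain b where b: "b \<in> ?R" "c b \<noteq> 0" using c(1) by blast
    have "0 < w b * (c b)\<^sup>2" using b by simp
    moreover have "w b * (c b)\<^sup>2 \<le> (\<Sum>a\<in>?R. w a * (c a)\<^sup>2)" using b fin(2) by (intro member_le_sum) auto
    ultimately show False using \<open>q x \<le> 0\<close> by linarith
  qed
  ultimately show ?thesis by simp
qed

text \<open>\<open>N\<close> may exceed \<open>r\<close>: only a right inverse \<open>h\<close> of
  \<open>g\<close> is required instead of a square congruence, so the full Hankel matrix can be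
  treated, kernel included.\<close>

theorem inertia_of_representation:
  fixes A :: "real mat" and N r :: nat
  assumes A: "A \<in> carrier_mat N N"
    and rep: "\<And>i j. i < N \<Longrightarrow> j < N \<Longrightarrow> A $$ (i, j) = (\<Sum>a<r. w a * g a i * g a j)"
    and gh: "\<And>a b. a < r \<Longrightarrow> b < r \<Longrightarrow> (\<Sum>i<N. g a i * h i b) = (if a = b then 1 else 0 :: real)"
  shows "i_plus A = card {a. a < r \<and> w a > 0}" "i_minus A = card {a. a < r \<and> w a < 0}"
proof -
  have sym: "A $$ (i, j) = A $$ (j, i)" if "i < N" "j < N" for i j using that by (simp add: rep mult_ac)
  obtain D P Q where w: "similar_mat_wit A D P Q" and D: "diagonal_mat D"
    using symmetric_diagonalisation[OF A sym] .
  have car: "D \<in> carrier_mat N N" "P \<in> carrier_mat N N" "Q \<in> carrier_mat N N"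
    and PQ: "P * Q = 1\<^sub>m N" "Q * P = 1\<^sub>m N" and eq: "A = P * D * Q"
    using w A unfolding similar_mat_wit_def Let_def by auto
  have AP: "A * P = P * D"
  proof -
    have "A * P = P * D * (Q * P)" unfolding eq using car by (simp add: assoc_mult_mat[of _ N N _ N _ N])
    then show ?thesis unfolding PQ(2) using car by simp
  qed
  have eig: "(\<Sum>j<N. A $$ (i, j) * P $$ (j, k)) = D $$ (k, k) * P $$ (i, k)" if "i < N" "k < N" for i k
  proof -
    have "(\<Sum>j<N. A $$ (i, j) * P $$ (j, k)) = (\<Sum>l<N. P $$ (i, l) * D $$ (l, k))"
      using AP mult_mat_index_sum[OF A car(2) that] mult_mat_index_sum[OF car(2,1) that] by simp
    also have "\<dots> = (\<Sum>l<N. if l = k then D $$ (k, k) * P $$ (i, k) else 0)"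
      using D car(1) that by (intro sum.cong refl) (auto simp: diagonal_mat_def)
    finally show ?thesis using that by simp
  qed
  have PQi: "(\<Sum>k<N. P $$ (i, k) * Q $$ (k, j)) = (if i = j then 1 else 0)"
    "(\<Sum>k<N. Q $$ (i, k) * P $$ (k, j)) = (if i = j then 1 else 0)" if "i < N" "j < N" for i j
    using mult_mat_index_sum[OF car(2,3) that] mult_mat_index_sum[OF car(3,2) that] that by (simp_all add: PQ)
  have "card {k. k < N \<and> D $$ (k, k) > 0} = card {a. a < r \<and> w a > 0}"
    by (rule positive_index_eq[where A = "\<lambda>i j. A $$ (i, j)" and p = "\<lambda>i j. P $$ (i, j)" and Q = "\<lambda>i j. Q $$ (i, j)",
      OF eig sym PQi rep gh])
  then show "i_plus A = card {a. a < r \<and> w a > 0}" by (simp add: inertia_diagonal(1)[OF A w D])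
  \<comment> \<open>The negative index is the positive index of \<open>- A\<close>, with the same
    eigenvectors and with \<open>D\<close> and \<open>w\<close> changing sign.\<close>
  have "card {k. k < N \<and> - D $$ (k, k) > 0} = card {a. a < r \<and> - w a > 0}"
  proof (rule positive_index_eq[where A = "\<lambda>i j. - A $$ (i, j)" and p = "\<lambda>i j. P $$ (i, j)" and Q = "\<lambda>i j. Q $$ (i, j)" and g = g and h = h])
    show "(\<Sum>j<N. - A $$ (i, j) * P $$ (j, k)) = - D $$ (k, k) * P $$ (i, k)" if "i < N" "k < N" for i k
      using eig[OF that] by (simp add: sum_negf)
    show "- A $$ (i, j) = (\<Sum>a<r. - w a * g a i * g a j)" if "i < N" "j < N" for i j
      using rep[OF that] by (simp add: sum_negf)
  qed (use sym PQi gh in auto)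
  then show "i_minus A = card {a. a < r \<and> w a < 0}" by (simp add: inertia_diagonal(2)[OF A w D])
qed

section \<open>Hankel matrices of atomic measures\<close>

text \<open>Used with \<open>m = n\<close> for the given sequence and with \<open>m = n + 1\<close>
  for the extension. There are as many atoms as monomials in \<open>B\<close>, so the Vandermonde
  matrix is square.\<close>

locale atomic_hankel =
  fixes s :: "('d::finite) mindex \<Rightarrow> real" and m :: nat and B :: "'d mindex list"
    and z :: "nat \<Rightarrow> 'd cpoint" and w :: "nat \<Rightarrow> complex"
  assumes deg: "\<And>l. l \<in> set B \<Longrightarrow> mdeg l \<le> m"
    and det: "det (basis_mat s B) \<noteq> 0"
    and w_nonzero: "\<And>a. a < length B \<Longrightarrow> w a \<noteq> 0"
    and moment: "\<And>g. mdeg g \<le> 2 * m \<Longrightarrow> of_real (s g) = (\<Sum>a<length B. w a * mono_at g (z a))"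
begin

abbreviation r where "r \<equiv> length B"

lemma deg_nth: "b < r \<Longrightarrow> mdeg (B ! b) \<le> m"
  using deg by simp

lemma moment_add:
  assumes "mdeg x \<le> m" "mdeg l \<le> m"
  shows "of_real (s (x + l)) = (\<Sum>a<r. w a * (mono_at x (z a) * mono_at l (z a)))"
proof -
  have "mdeg (x + l) \<le> 2 * m" using assms by simp
  from moment[OF this] show ?thesis by simp
qed

lemma vand_car: "vandermonde B z \<in> carrier_mat r r" by (simp add: vandermonde_def)

text \<open>\<open>M\<^sub>B\<close> is the product of the transposed Vandermonde matrix, the
  diagonal matrix of the weights and the Vandermonde matrix, so a kernel vector of the last factor
  is one of \<open>M\<^sub>B\<close>.\<close>

lemma det_vandermonde: "det (vandermonde B z) \<noteq> 0"
  unfolding det_nonzero_iff[OF vand_car]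
proof (intro allI impI)
  fix x b assume x: "\<forall>a<r. (\<Sum>b<r. vandermonde B z $$ (a, b) * x b) = 0" and b: "b < r"
  have car: "map_mat complex_of_real (basis_mat s B) \<in> carrier_mat r r" by (simp add: basis_mat_def)
  have dn: "det (map_mat complex_of_real (basis_mat s B)) \<noteq> 0" using det by simp
  have "(\<Sum>b<r. map_mat complex_of_real (basis_mat s B) $$ (a, b) * x b) = 0" if a: "a < r" for a
  proof -
    have "(\<Sum>b<r. map_mat complex_of_real (basis_mat s B) $$ (a, b) * x b) =
      (\<Sum>b<r. \<Sum>k<r. w k * mono_at (B ! a) (z k) * (mono_at (B ! b) (z k) * x b))"
    proof (intro sum.cong refl)
      fix b assume "b \<in> {..<r}"
      then have "map_mat complex_of_real (basis_mat s B) $$ (a, b) = of_real (s (B ! a + B ! b))"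
        using a by (simp add: basis_mat_def)
      also have "\<dots> = (\<Sum>k<r. w k * (mono_at (B ! a) (z k) * mono_at (B ! b) (z k)))"
        using a \<open>b \<in> {..<r}\<close> by (intro moment_add deg_nth) auto
      finally show "map_mat complex_of_real (basis_mat s B) $$ (a, b) * x b =
        (\<Sum>k<r. w k * mono_at (B ! a) (z k) * (mono_at (B ! b) (z k) * x b))"
        by (simp only: sum_distrib_right mult.assoc)
    qed
    also have "\<dots> = (\<Sum>k<r. w k * mono_at (B ! a) (z k) * (\<Sum>b<r. mono_at (B ! b) (z k) * x b))"
      by (subst sum.swap) (simp only: sum_distrib_left)
    also have "\<dots> = 0" using x by (intro sum.neutral) (auto simp: vandermonde_def)
    finally show ?thesis .
  qed
  from det_nonzeroD[OF car dn this b] show "x b = 0" .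
qed

text \<open>The source of all pointwise identities at the atoms: a defect, multiplied by the nonzero
  weights, vanishes once its integrals against the monomials in \<open>B\<close> do.\<close>

lemma vand_left_inj:
  assumes "\<And>b. b < r \<Longrightarrow> (\<Sum>a<r. y a * mono_at (B ! b) (z a)) = 0" and "a < r"
  shows "y a = 0"
proof -
  have car: "transpose_mat (vandermonde B z) \<in> carrier_mat r r" by (simp add: vandermonde_def)
  have dn: "det (transpose_mat (vandermonde B z)) \<noteq> 0" using det_vandermonde det_transpose[OF vand_car] by simp
  show ?thesis
  proof (rule det_nonzeroD[OF car dn _ assms(2)])
    fix b assume b: "b < r"
    then have "(\<Sum>a<r. transpose_mat (vandermonde B z) $$ (b, a) * y a) = (\<Sum>a<r. y a * mono_at (B ! b) (z a))"
      by (intro sum.cong) (auto simp: vandermonde_def)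
    then show "(\<Sum>a<r. transpose_mat (vandermonde B z) $$ (b, a) * y a) = 0" using assms(1)[OF b] by simp
  qed
qed

lemma vand_left_solve: "\<exists>y. \<forall>b<r. (\<Sum>a<r. y a * mono_at (B ! b) (z a)) = v b"
proof -
  have car: "transpose_mat (vandermonde B z) \<in> carrier_mat r r" by (simp add: vandermonde_def)
  have dn: "det (transpose_mat (vandermonde B z)) \<noteq> 0" using det_vandermonde det_transpose[OF vand_car] by simp
  obtain y where y: "\<forall>b<r. (\<Sum>a<r. transpose_mat (vandermonde B z) $$ (b, a) * y a) = v b"
    using det_nonzero_solve[OF car dn, of v] by (elim exE) (rule that)
  have "(\<Sum>a<r. y a * mono_at (B ! b) (z a)) = v b" if b: "b < r" for b
  proof -
    have "(\<Sum>a<r. y a * mono_at (B ! b) (z a)) = (\<Sum>a<r. transpose_mat (vandermonde B z) $$ (b, a) * y a)"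
      using b by (intro sum.cong) (auto simp: vandermonde_def)
    then show ?thesis using y b by simp
  qed
  then show ?thesis by blast
qed

text \<open>The hypothesis on \<open>c\<close> says that the difference of both sides integrates to
  zero against every monomial in \<open>B\<close>.\<close>

lemma coordinates_mono:
  assumes l: "mdeg l \<le> m" and c: "\<forall>b<r. (\<Sum>k<r. s (B ! b + B ! k) * c k) = s (B ! b + l)"
    and a: "a < r"
  shows "(\<Sum>k<r. of_real (c k) * mono_at (B ! k) (z a)) = mono_at l (z a)"
proof -
  let ?e = "\<lambda>a. (\<Sum>k<r. of_real (c k) * mono_at (B ! k) (z a)) - mono_at l (z a)"
  have "w a * ?e a = 0"
  proof (rule vand_left_inj[OF _ a, where y = "\<lambda>a. w a * ?e a"])
    fix b assume b: "b < r"
    have "(\<Sum>a<r. w a * ?e a * mono_at (B ! b) (z a)) =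
      (\<Sum>a<r. \<Sum>k<r. of_real (c k) * (w a * (mono_at (B ! b) (z a) * mono_at (B ! k) (z a)))) -
      (\<Sum>a<r. w a * (mono_at (B ! b) (z a) * mono_at l (z a)))"
      unfolding sum_subtractf[symmetric]
      by (intro sum.cong refl) (simp add: right_diff_distrib left_diff_distrib sum_distrib_left sum_distrib_right mult_ac)
    also have "(\<Sum>a<r. \<Sum>k<r. of_real (c k) * (w a * (mono_at (B ! b) (z a) * mono_at (B ! k) (z a)))) =
      (\<Sum>k<r. of_real (c k) * of_real (s (B ! b + B ! k)))"
      using b by (subst sum.swap) (simp add: moment_add deg_nth sum_distrib_left)
    also have "(\<Sum>a<r. w a * (mono_at (B ! b) (z a) * mono_at l (z a))) = of_real (s (B ! b + l))"
      using b l by (simp add: moment_add deg_nth)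
    also have "(\<Sum>k<r. of_real (c k) * of_real (s (B ! b + B ! k))) = complex_of_real (s (B ! b + l))"
      using c b by (simp add: mult.commute flip: of_real_mult of_real_sum)
    finally show "(\<Sum>a<r. w a * ?e a * mono_at (B ! b) (z a)) = 0" by simp
  qed
  then show ?thesis using w_nonzero[OF a] by simp
qed

lemma coordinates_exist: "\<exists>c. \<forall>b<r. (\<Sum>k<r. s (B ! b + B ! k) * c k) = s (B ! b + l)"
proof -
  have car: "basis_mat s B \<in> carrier_mat r r" by (simp add: basis_mat_def)
  obtain c where c: "\<forall>b<r. (\<Sum>k<r. basis_mat s B $$ (b, k) * c k) = s (B ! b + l)"
    using det_nonzero_solve[OF car det, of "\<lambda>b. s (B ! b + l)"] by (elim exE) (rule that)
  have "(\<Sum>k<r. s (B ! b + B ! k) * c k) = s (B ! b + l)" if b: "b < r" for b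
    unfolding c[rule_format, OF b, symmetric] using b by (intro sum.cong) (auto simp: basis_mat_def)
  then show ?thesis by blast
qed

text \<open>Integrating the pointwise identity of \<open>coordinates_mono\<close> against any
  monomial passes from the rows in \<open>B\<close> to all rows. This is what makes the extension
  rank preserving.\<close>

lemma coordinates_column:
  assumes l: "mdeg l \<le> m" and c: "\<forall>b<r. (\<Sum>k<r. s (B ! b + B ! k) * c k) = s (B ! b + l)"
    and x: "mdeg x \<le> m"
  shows "s (x + l) = (\<Sum>b<r. c b * s (x + B ! b))"
proof -
  have "of_real (s (x + l)) = (\<Sum>a<r. w a * (mono_at x (z a) * (\<Sum>k<r. of_real (c k) * mono_at (B ! k) (z a))))"
    unfolding moment_add[OF x l] using coordinates_mono[OF l c] by simp
  also have "\<dots> = (\<Sum>k<r. of_real (c k) * (\<Sum>a<r. w a * (mono_at x (z a) * mono_at (B ! k) (z a))))"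
    unfolding sum_distrib_left by (subst sum.swap) (simp add: mult_ac)
  also have "\<dots> = of_real (\<Sum>b<r. c b * s (x + B ! b))"
    using x by (simp add: moment_add deg_nth)
  finally show ?thesis unfolding of_real_eq_iff .
qed

lemma spanning: "spanning s m B"
  unfolding spanning_def
proof (intro allI impI)
  fix l :: "'d mindex" assume l: "mdeg l \<le> m"
  obtain c where c: "\<forall>b<r. (\<Sum>k<r. s (B ! b + B ! k) * c k) = s (B ! b + l)"
    using coordinates_exist[of l] by (elim exE) (rule that)
  show "\<exists>c. \<forall>x. mdeg x \<le> m \<longrightarrow> s (x + l) = (\<Sum>b<r. c b * s (x + B ! b))"
    using coordinates_column[OF l c] by blast
qed

text \<open>Since the first monomial is \<open>1\<close>, the first column of
  \<open>M\<^sub>B\<close> lists the moments of the monomials in \<open>B\<close>, which is the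
  transposed Vandermonde matrix applied to \<open>w\<close>.\<close>

lemma weights:
  assumes "B \<noteq> []" "B ! 0 = 0"
  shows "Matrix.vec r w = minv (transpose_mat (vandermonde B z)) *\<^sub>v
    (map_mat complex_of_real (basis_mat s B) *\<^sub>v unit_vec r 0)"
proof -
  let ?V = "transpose_mat (vandermonde B z)" and ?M = "map_mat complex_of_real (basis_mat s B)"
  have car: "?V \<in> carrier_mat r r" and M: "?M \<in> carrier_mat r r" by (simp_all add: vandermonde_def basis_mat_def)
  have dn: "det ?V \<noteq> 0" using det_vandermonde det_transpose[OF vand_car] by simp
  have r: "0 < r" using assms(1) by simp
  have "?M *\<^sub>v unit_vec r 0 = ?V *\<^sub>v Matrix.vec r w"
  proof (rule eq_vecI)
    fix b assume "b < dim_vec (?V *\<^sub>v Matrix.vec r w)"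
    then have b: "b < r" using car by simp
    have "vec_index (?M *\<^sub>v unit_vec r 0) b = (\<Sum>k<r. if k = 0 then of_real (s (B ! b + B ! 0)) else 0)"
      unfolding mult_mat_vec_index_sum[OF M unit_vec_carrier b]
      using b by (intro sum.cong) (auto simp: basis_mat_def unit_vec_def)
    also have "\<dots> = of_real (s (B ! b + 0))" using r by (simp add: assms(2))
    also have "\<dots> = (\<Sum>a<r. w a * (mono_at (B ! b) (z a) * mono_at 0 (z a)))"
      using b by (intro moment_add deg_nth) auto
    also have "\<dots> = vec_index (?V *\<^sub>v Matrix.vec r w) b"
      unfolding mult_mat_vec_index_sum[OF car vec_carrier b]
      using b by (intro sum.cong) (auto simp: vandermonde_def)
    finally show "vec_index (?M *\<^sub>v unit_vec r 0) b = vec_index (?V *\<^sub>v Matrix.vec r w) b" .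
  qed (simp add: basis_mat_def vandermonde_def)
  then have "minv ?V *\<^sub>v (?M *\<^sub>v unit_vec r 0) = minv ?V *\<^sub>v (?V *\<^sub>v Matrix.vec r w)" by simp
  also have "\<dots> = (minv ?V * ?V) *\<^sub>v Matrix.vec r w"
    by (rule assoc_mult_mat_vec[OF minv_inverse(1)[OF car dn] car, symmetric]) simp
  also have "\<dots> = Matrix.vec r w" unfolding minv_inverse(3)[OF car dn] by (rule one_mult_mat_vec) simp
  finally show ?thesis by simp
qed

text \<open>The conjugated measure has the same atoms, and on \<open>B\<close> the same moments
  because these are real; \<open>vand_left_inj\<close> then identifies the weights.
  \<open>\<sigma>\<close> describes conjugation on the positions of the atoms.\<close>

lemma conjugate_weights:
  assumes sg: "\<forall>a<r. \<sigma> a < r \<and> z (\<sigma> a) = vec_cnj (z a)" and inj: "inj_on z {..<r}"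
  shows "bij_betw \<sigma> {..<r} {..<r}" "a < r \<Longrightarrow> w (\<sigma> a) = cnj (w a)"
proof -
  have "\<sigma> (\<sigma> a) = a" if "a < r" for a
  proof (rule inj_onD[OF inj])
    show "z (\<sigma> (\<sigma> a)) = z a"
      using sg that by (simp add: vec_cnj_def Finite_Cartesian_Product.vec_eq_iff)
  qed (use sg that in auto)
  then show bij: "bij_betw \<sigma> {..<r} {..<r}"
    by (intro bij_betwI[where g = \<sigma>]) (use sg in auto)
  have "w (\<sigma> a) - cnj (w a) = 0" if a: "a < r" for a
  proof -
    have "cnj (w (\<sigma> a)) - w a = 0"
    proof (rule vand_left_inj[OF _ a, where y = "\<lambda>a. cnj (w (\<sigma> a)) - w a"])
      fix b assume b: "b < r"
      have d: "mdeg (B ! b) \<le> 2 * m" using deg_nth[OF b] by simp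
      have "(\<Sum>a<r. cnj (w (\<sigma> a)) * mono_at (B ! b) (z a)) = cnj (\<Sum>a<r. w (\<sigma> a) * mono_at (B ! b) (z (\<sigma> a)))"
        unfolding cnj_sum using sg by (intro sum.cong refl) (auto simp: mono_at_cnj)
      also have "(\<Sum>a<r. w (\<sigma> a) * mono_at (B ! b) (z (\<sigma> a))) = (\<Sum>a<r. w a * mono_at (B ! b) (z a))"
        by (rule sum.reindex_bij_betw[OF bij])
      also have "\<dots> = of_real (s (B ! b))" by (rule moment[OF d, symmetric])
      finally show "(\<Sum>a<r. (cnj (w (\<sigma> a)) - w a) * mono_at (B ! b) (z a)) = 0"
        unfolding left_diff_distrib sum_subtractf moment[OF d, symmetric] by simp
    qed
    then have "cnj (cnj (w (\<sigma> a))) = cnj (w a)" by simp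
    then show ?thesis by simp
  qed
  then show "a < r \<Longrightarrow> w (\<sigma> a) = cnj (w a)" by simp
qed

text \<open>The degree of \<open>g\<close> is unrestricted: symmetry of atoms and weights makes the
  sum real, so moments beyond degree \<open>2 * m\<close> can serve as an extension.\<close>

lemma moments_real:
  assumes inj: "inj_on z {..<r}" and closed: "\<And>a. a < r \<Longrightarrow> vec_cnj (z a) \<in> z ` {..<r}"
  shows "(\<Sum>a<r. w a * mono_at g (z a)) \<in> \<real>"
proof -
  have "\<forall>a. \<exists>a'. a < r \<longrightarrow> a' < r \<and> z a' = vec_cnj (z a)" using closed by fastforce
  from choice[OF this] obtain \<sigma> where sg: "\<forall>a<r. \<sigma> a < r \<and> z (\<sigma> a) = vec_cnj (z a)" by blast
  note cw = conjugate_weights[of \<sigma>, OF sg inj]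
  have "cnj (\<Sum>a<r. w a * mono_at g (z a)) = (\<Sum>a<r. w (\<sigma> a) * mono_at g (z (\<sigma> a)))"
    unfolding cnj_sum using sg cw(2) by (intro sum.cong refl) (auto simp: mono_at_cnj)
  also have "\<dots> = (\<Sum>a<r. w a * mono_at g (z a))" by (rule sum.reindex_bij_betw[OF cw(1)])
  finally show ?thesis by (simp add: Reals_cnj_iff)
qed

lemma real_weights:
  assumes "inj_on z {..<r}" "\<And>a. a < r \<Longrightarrow> z a \<in> real_points" "a < r"
  shows "w a \<in> \<real>"
proof -
  have "vec_cnj (z a) = z a" if "a < r" for a
    using assms(2)[OF that] by (simp add: real_points_def vec_cnj_def Finite_Cartesian_Product.vec_eq_iff Reals_cnj_iff)
  then have "w a = cnj (w a)" using conjugate_weights(2)[of "\<lambda>a. a" a] assms(1,3) by simp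
  then show ?thesis by (simp add: Reals_cnj_iff)
qed

end

section \<open>Column relations, the variety and the diagonalisability of the shifts\<close>

lemma poly_col_zero_iff:
  fixes s :: "('d::{finite,linorder}) mindex \<Rightarrow> real"
  shows "poly_col s m p = 0\<^sub>v (dim_row (hankel s m)) \<longleftrightarrow>
    (\<forall>x. mdeg x \<le> m \<longrightarrow> (\<Sum>l | mdeg l \<le> m. p l * s (x + l)) = 0)"
proof -
  have c: "(\<lambda>l. p l \<cdot>\<^sub>v Xcol s m l) \<in> {l. mdeg l \<le> m} \<rightarrow> carrier_vec (dim_row (hankel s m))"
    using Xcol_carrier[of _ m s] by auto
  show ?thesis
  proof (rule vec_eq_rows_iff)
    show "poly_col s m p \<in> carrier_vec (dim_row (hankel s m))"
      unfolding poly_col_def using c by (rule finsum_vec_closed)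
    fix i assume i: "i < dim_row (hankel s m)"
    show "vec_index (poly_col s m p) i = (\<Sum>l | mdeg l \<le> m. p l * s (mono_list m ! i + l))"
      unfolding poly_col_def index_finsum_vec[OF finite_mdeg_le i c]
      using i by (intro sum.cong refl) (auto simp: Xcol_eq)
  qed auto
qed

lemma sum_single_nth:
  assumes "distinct xs" "l \<in> set xs"
  shows "(\<Sum>i<length xs. if xs ! i = l then f (xs ! i) else 0) = (f l :: 'a::comm_monoid_add)"
proof -
  have "(\<Sum>i<length xs. if xs ! i = l then f (xs ! i) else 0) = (\<Sum>x\<in>set xs. if x = l then f x else 0)"
    using assms(1) by (intro sum.reindex_bij_betw bij_betw_nth) auto
  then show ?thesis using assms(2) by simp
qed

text \<open>The basis has degree at most \<open>n\<close>, one less than the order of the Hankel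
  matrix, so it may be multiplied by a variable without leaving the controlled degrees.\<close>

locale flat_atomic_hankel = atomic_hankel s "Suc n" B z w
  for s :: "('d::{finite,linorder}) mindex \<Rightarrow> real" and n B z w +
  assumes low: "\<And>l. l \<in> set B \<Longrightarrow> mdeg l \<le> n"
begin

lemma low_nth: "b < r \<Longrightarrow> mdeg (B ! b + axis j 1) \<le> Suc n"
  using low[of "B ! b"] by simp

lemma mono_variety:
  assumes x: "x \<in> variety s (Suc n)" and l: "mdeg l \<le> Suc n"
    and c: "\<forall>b<r. (\<Sum>k<r. s (B ! b + B ! k) * c k) = s (B ! b + l)"
  shows "mono_at l x = (\<Sum>b<r. of_real (c b) * mono_at (B ! b) x)"
proof -
  \<comment> \<open>Coefficients of the monomial \<open>l\<close> minus the combination of basis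
    monomials. Sums of indicator terms also cover the case that \<open>l\<close> lies in
    \<open>B\<close>.\<close>
  define p where "p l' = (if l' = l then 1 else 0) - (\<Sum>b<r. if l' = B ! b then c b else 0)" for l'
  \<comment> \<open>Used over the reals for the column relation and over the complex numbers for the
    value at \<open>x\<close>.\<close>
  have ev: "(\<Sum>l' | mdeg l' \<le> Suc n. of_real (p l') * f l') = f l - (\<Sum>b<r. of_real (c b) * f (B ! b))"
    for f :: "'d mindex \<Rightarrow> 'b::real_field"
  proof -
    have "(\<Sum>l' | mdeg l' \<le> Suc n. of_real (p l') * f l') =
      (\<Sum>l' | mdeg l' \<le> Suc n. (if l' = l then f l else 0) - (\<Sum>b<r. if l' = B ! b then of_real (c b) * f (B ! b) else 0))"
      by (intro sum.cong refl) (auto simp: p_def left_diff_distrib sum_distrib_right intro!: sum.cong)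
    also have "\<dots> = f l - (\<Sum>b<r. \<Sum>l' | mdeg l' \<le> Suc n. if l' = B ! b then of_real (c b) * f (B ! b) else 0)"
      unfolding sum_subtractf using l by (subst sum.swap[of _ "{..<r}"]) (simp add: finite_mdeg_le)
    also have "\<dots> = f l - (\<Sum>b<r. of_real (c b) * f (B ! b))"
      using deg_nth by (auto simp: finite_mdeg_le intro!: sum.cong)
    finally show ?thesis .
  qed
  have "(\<Sum>l' | mdeg l' \<le> Suc n. p l' * s (y + l')) = 0" if "mdeg y \<le> Suc n" for y
    using ev[of "\<lambda>l'. s (y + l')"] coordinates_column[OF l c that] by simp
  then have "poly_at (Suc n) p x = 0"
    using x unfolding variety_def poly_col_zero_iff by blast
  then show ?thesis unfolding poly_at_def ev by simp
qed

text \<open>For the harder inclusion, evaluation at \<open>x\<close> agrees on \<open>B\<close>,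
  hence in all degrees up to \<open>n + 1\<close>, with a combination \<open>y\<close> of
  evaluations at the atoms. Multiplying the monomials in \<open>B\<close> by the \<open>j\<close>-th
  variable minus the \<open>j\<close>-th coordinate of \<open>x\<close> shows that
  \<open>y a\<close> is zero unless \<open>z a = x\<close>. If \<open>x\<close> is no atom,
  \<open>y\<close> vanishes, against the value of the monomial \<open>1\<close>.\<close>

lemma variety_eq: "variety s (Suc n) = z ` {..<r}"
proof (intro equalityI subsetI)
  fix x assume x: "x \<in> variety s (Suc n)"
  show "x \<in> z ` {..<r}"
  proof (rule ccontr)
    assume no: "x \<notin> z ` {..<r}"
    obtain y where "\<forall>b<r. (\<Sum>a<r. y a * mono_at (B ! b) (z a)) = mono_at (B ! b) x"
      using vand_left_solve[of "\<lambda>b. mono_at (B ! b) x"] by (elim exE) (rule that)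
    then have y: "(\<Sum>a<r. y a * mono_at (B ! b) (z a)) = mono_at (B ! b) x" if "b < r" for b using that by blast
    have all: "(\<Sum>a<r. y a * mono_at l (z a)) = mono_at l x" if l: "mdeg l \<le> Suc n" for l
    proof -
      obtain c where c: "\<forall>b<r. (\<Sum>k<r. s (B ! b + B ! k) * c k) = s (B ! b + l)"
        using coordinates_exist[of l] by (elim exE) (rule that)
      have "(\<Sum>a<r. y a * mono_at l (z a)) = (\<Sum>a<r. y a * (\<Sum>k<r. of_real (c k) * mono_at (B ! k) (z a)))"
        using coordinates_mono[OF l c] by simp
      also have "\<dots> = (\<Sum>k<r. of_real (c k) * (\<Sum>a<r. y a * mono_at (B ! k) (z a)))"
        unfolding sum_distrib_left by (subst sum.swap) (simp add: mult_ac)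
      also have "\<dots> = mono_at l x"
        unfolding mono_variety[OF x l c] by (intro sum.cong refl) (simp add: y)
      finally show ?thesis .
    qed
    have "y a * (vec_nth (z a) j - vec_nth x j) = 0" if a: "a < r" for a j
    proof (rule vand_left_inj[OF _ a, where y = "\<lambda>a. y a * (vec_nth (z a) j - vec_nth x j)"])
      fix b assume b: "b < r"
      have "(\<Sum>a<r. y a * (vec_nth (z a) j - vec_nth x j) * mono_at (B ! b) (z a)) =
        (\<Sum>a<r. y a * mono_at (B ! b + axis j 1) (z a)) - vec_nth x j * (\<Sum>a<r. y a * mono_at (B ! b) (z a))"
        unfolding sum_distrib_left sum_subtractf[symmetric] by (intro sum.cong refl) (simp add: algebra_simps)
      also have "\<dots> = 0" unfolding all[OF low_nth[OF b]] y[OF b] by simp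
      finally show "(\<Sum>a<r. y a * (vec_nth (z a) j - vec_nth x j) * mono_at (B ! b) (z a)) = 0" .
    qed
    moreover have "\<exists>j. vec_nth (z a) j - vec_nth x j \<noteq> 0" if "a < r" for a
    proof -
      have "z a \<noteq> x" using no that by blast
      then show ?thesis by (auto simp: Finite_Cartesian_Product.vec_eq_iff)
    qed
    ultimately have "y a = 0" if "a < r" for a using that by (metis mult_eq_0_iff)
    then have "(\<Sum>a<r. y a * mono_at 0 (z a)) = 0" by simp
    then show False using all[of 0] by simp
  qed
next
  fix x assume "x \<in> z ` {..<r}"
  then obtain a where a: "a < r" "x = z a" by blast
  show "x \<in> variety s (Suc n)" unfolding variety_def poly_col_zero_iff
  proof (intro CollectI allI impI)
    fix p :: "'d mindex \<Rightarrow> real"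
    assume p: "\<forall>y. mdeg y \<le> Suc n \<longrightarrow> (\<Sum>l | mdeg l \<le> Suc n. p l * s (y + l)) = 0"
    have "w a * poly_at (Suc n) p (z a) = 0"
    proof (rule vand_left_inj[OF _ a(1), where y = "\<lambda>a. w a * poly_at (Suc n) p (z a)"])
      fix b assume b: "b < r"
      have "(\<Sum>a<r. w a * poly_at (Suc n) p (z a) * mono_at (B ! b) (z a)) =
        (\<Sum>a<r. \<Sum>l | mdeg l \<le> Suc n. of_real (p l) * (w a * (mono_at (B ! b) (z a) * mono_at l (z a))))"
        unfolding poly_at_def by (intro sum.cong refl) (simp add: sum_distrib_left sum_distrib_right mult_ac)
      also have "\<dots> = (\<Sum>l | mdeg l \<le> Suc n. of_real (p l) * (\<Sum>a<r. w a * (mono_at (B ! b) (z a) * mono_at l (z a))))"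
        by (subst sum.swap) (simp only: sum_distrib_left)
      also have "\<dots> = (\<Sum>l | mdeg l \<le> Suc n. of_real (p l) * of_real (s (B ! b + l)))"
        using deg_nth[OF b] by (intro sum.cong refl) (simp add: moment_add)
      also have "\<dots> = of_real (\<Sum>l | mdeg l \<le> Suc n. p l * s (B ! b + l))" by simp
      also have "\<dots> = 0" using p deg_nth[OF b] by simp
      finally show "(\<Sum>a<r. w a * poly_at (Suc n) p (z a) * mono_at (B ! b) (z a)) = 0" .
    qed
    then show "poly_at (Suc n) p x = 0" using w_nonzero[OF a(1)] a(2) by simp
  qed
qed

lemma diagonalisable_T: "diagonalisable (map_mat complex_of_real (T_mat s s B j))"
proof -
  interpret F: flat_hankel s n B
    by unfold_locales (use low det spanning in auto)
  let ?V = "vandermonde B z" and ?T = "map_mat complex_of_real (F.T j)"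
  define D where "D = mat r r (\<lambda>(a, b). if a = b then vec_nth (z a) j else 0)"
  have car: "?T \<in> carrier_mat r r" "D \<in> carrier_mat r r" using F.T_car[of j] by (simp_all add: D_def)
  note V = vand_car
  note W = minv_inverse[OF V det_vandermonde]
  note as = assoc_mult_mat[of _ r r _ r _ r]
  \<comment> \<open>Both entries at \<open>(a, b)\<close> are the value at \<open>z a\<close> of the
    monomial \<open>B ! b\<close> times the \<open>j\<close>-th variable.\<close>
  have "?V * ?T = D * ?V"
  proof (rule eq_matI)
    fix a b assume "a < dim_row (D * ?V)" "b < dim_col (D * ?V)"
    then have ab: "a < r" "b < r" using car(2) V by auto
    have "(?V * ?T) $$ (a, b) = (\<Sum>k<r. of_real (F.coords (B ! b + axis j 1) k) * mono_at (B ! k) (z a))"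
      unfolding mult_mat_index_sum[OF V car(1) ab]
      using ab F.T_car[of j] by (intro sum.cong refl) (auto simp: vandermonde_def F.T_col)
    also have "\<dots> = mono_at (B ! b + axis j 1) (z a)"
      using ab low_nth[of b j] by (intro coordinates_mono) (auto simp: F.coords deg_nth)
    also have "\<dots> = (\<Sum>k<r. if k = a then vec_nth (z a) j * mono_at (B ! b) (z a) else 0)"
      using ab by simp
    also have "\<dots> = (D * ?V) $$ (a, b)"
      unfolding mult_mat_index_sum[OF car(2) V ab] using ab
      by (intro sum.cong refl) (auto simp: D_def vandermonde_def)
    finally show "(?V * ?T) $$ (a, b) = (D * ?V) $$ (a, b)" .
  qed (use car V in auto)
  then have "minv ?V * (?V * ?T) = minv ?V * (D * ?V)" by simp
  moreover have "minv ?V * (?V * ?T) = ?T"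
    using V W(1) car by (subst as[symmetric]) (auto simp: W(3))
  moreover have "minv ?V * (D * ?V) = minv ?V * D * ?V"
    using V W(1) car by (intro as[symmetric])
  ultimately have "?T = minv ?V * D * ?V" by simp
  then have "similar_mat_wit ?T D (minv ?V) ?V"
    using V W car by (intro similar_mat_witI[of _ _ r]) auto
  moreover have "diagonal_mat D" by (auto simp: diagonal_mat_def D_def)
  ultimately show ?thesis unfolding diagonalisable_def similar_mat_def by blast
qed

end

section \<open>Passing between extensions and measures\<close>

lemma basis_mat_cong:
  assumes "\<And>g. mdeg g \<le> 2 * n \<Longrightarrow> s' g = s g" "\<forall>l\<in>set B. mdeg l \<le> n"
  shows "basis_mat s' B = basis_mat s B"
proof -
  have "s' (B ! a + B ! b) = s (B ! a + B ! b)" if "a < length B" "b < length B" for a b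
  proof (rule assms(1))
    have "mdeg (B ! a) \<le> n" "mdeg (B ! b) \<le> n" using assms(2) that by auto
    then show "mdeg (B ! a + B ! b) \<le> 2 * n" by simp
  qed
  then show ?thesis by (auto simp: basis_mat_def)
qed

lemma rank_preserving_extension_atomic:
  fixes s :: "('d::{finite,linorder}) mindex \<Rightarrow> real"
  assumes mb: "monomial_basis s n B" and ext: "rank_preserving_extension s n s'"
    and diag: "\<And>j. diagonalisable (map_mat complex_of_real (T_mat s s' B j))"
  obtains z w where "flat_atomic_hankel s' n B z w" "inj_on z {..<length B}"
proof -
  have deg: "\<forall>l\<in>set B. mdeg l \<le> n" using mb by (simp add: monomial_basis_iff)
  have ext': "\<And>g. mdeg g \<le> 2 * n \<Longrightarrow> s' g = s g" "hankel_rank s' (Suc n) = hankel_rank s n"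
    using ext by (simp_all add: rank_preserving_extension_def)
  have bm: "basis_mat s' B = basis_mat s B" by (rule basis_mat_cong[OF ext'(1) deg])
  have det: "det (basis_mat s' B) \<noteq> 0" using monomial_basis_det[OF mb] bm by simp
  have deg': "\<forall>l\<in>set B. mdeg l \<le> Suc n" using deg by auto
  \<comment> \<open>The block of \<open>B\<close> involves only moments of degree at most
    \<open>2 * n\<close>, so \<open>B\<close> stays independent in the extension, and equality of
    the ranks makes it spanning.\<close>
  have "monomial_basis s' (Suc n) B"
    using deg' indep_of_det[OF deg' det] monomial_basis_length[OF mb] ext'(2) by (intro monomial_basisI_rank) auto
  then interpret F: flat_hankel s' n B
    by unfold_locales (use deg det in \<open>auto simp: monomial_basis_iff\<close>)
  have T: "T_mat s s' B j = F.T j" for j by (simp add: T_mat_def bm)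
  obtain z w where zw: "inj_on z {..<length B}" "\<And>a. a < length B \<Longrightarrow> w a \<noteq> 0"
    "\<And>g. mdeg g \<le> 2 * Suc n \<Longrightarrow> of_real (s' g) = (\<Sum>a<length B. w a * mono_at g (z a))"
    using F.flat_atomic[OF diag[unfolded T]] by blast
  have "flat_atomic_hankel s' n B z w"
    by unfold_locales (use deg deg' det zw in auto)
  then show thesis using zw(1) by (rule that)
qed

lemma atomic_rank_preserving_extension:
  fixes s :: "('d::{finite,linorder}) mindex \<Rightarrow> real"
  assumes mb: "monomial_basis s n B" and at: "atomic (length B) z w \<mu>" and rep: "quasi_complex_representing s n \<mu>"
  shows "\<exists>s'. rank_preserving_extension s n s' \<and> (\<forall>j. diagonalisable (map_mat complex_of_real (T_mat s s' B j)))"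
proof -
  let ?r = "length B"
  have deg: "\<forall>l\<in>set B. mdeg l \<le> n" using mb by (simp add: monomial_basis_iff)
  have inj: "inj_on z {..<?r}" and w: "\<And>a. a < ?r \<Longrightarrow> w a \<noteq> 0" using at by (auto simp: atomic_def)
  have mom: "of_real (s g) = (\<Sum>a<?r. w a * mono_at g (z a))" if "mdeg g \<le> 2 * n" for g
    using rep that has_cm_integral_atomic[OF at mono_at_measurable] by (simp add: quasi_complex_representing_def)
  interpret A: atomic_hankel s n B z w
    by unfold_locales (use deg w mom monomial_basis_det[OF mb] in auto)
  have closed: "vec_cnj (z a) \<in> z ` {..<?r}" if "a < ?r" for a
    using rep that unfolding quasi_complex_representing_def quasi_complex_measure_def supp_atomic[OF at] by blast
  \<comment> \<open>The atoms continue the sequence to all degrees. \<open>Re\<close> only provides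
    the real type; by \<open>moments_real\<close> nothing is lost.\<close>
  define s' where "s' g = Re (\<Sum>a<?r. w a * mono_at g (z a))" for g
  have mom': "of_real (s' g) = (\<Sum>a<?r. w a * mono_at g (z a))" for g
    unfolding s'_def by (rule of_real_Re[OF A.moments_real[OF inj closed]])
  have eq: "s' g = s g" if "mdeg g \<le> 2 * n" for g
    unfolding s'_def mom[OF that, symmetric] by simp
  have bm: "basis_mat s' B = basis_mat s B" by (rule basis_mat_cong[OF eq deg])
  have deg': "\<forall>l\<in>set B. mdeg l \<le> Suc n" using deg by auto
  interpret E: flat_atomic_hankel s' n B z w
    by unfold_locales (use deg deg' w mom' bm monomial_basis_det[OF mb] in auto)
  \<comment> \<open>\<open>B\<close> is a basis for both Hankel matrices, so both ranks equal its
    length.\<close>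
  have "monomial_basis s' (Suc n) B" by (rule monomial_basis_of_det[OF deg' E.det E.spanning])
  then have "hankel_rank s' (Suc n) = hankel_rank s n"
    using monomial_basis_length[OF mb] monomial_basis_length by metis
  then have "rank_preserving_extension s n s'" using eq by (simp add: rank_preserving_extension_def)
  moreover have "T_mat s s' B j = T_mat s' s' B j" for j by (simp add: T_mat_def bm)
  ultimately show ?thesis using E.diagonalisable_T by auto
qed

lemma sorted_grlex_distinct: "sorted_wrt grlex xs \<Longrightarrow> distinct xs"
  by (induction xs) (auto simp: grlex_irrefl)

lemma real_atomic_inertia:
  fixes s :: "('d::{finite,linorder}) mindex \<Rightarrow> real"
  assumes "atomic_hankel s n B z w" and inj: "inj_on z {..<length B}"
    and real: "\<And>a. a < length B \<Longrightarrow> z a \<in> real_points"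
  shows "i_plus (hankel s n) = card {a. a < length B \<and> Re (w a) > 0}"
    "i_minus (hankel s n) = card {a. a < length B \<and> Re (w a) < 0}"
proof -
  interpret atomic_hankel s n B z w by fact
  let ?ml = "mono_list n :: 'd mindex list"
  have dist: "distinct ?ml"
    by (rule sorted_grlex_distinct[OF mono_list_props(1)])
  have mono_real: "of_real (Re (mono_at l (z a))) = mono_at l (z a)" if "a < r" for l a
  proof (rule of_real_Re)
    show "mono_at l (z a) \<in> \<real>" using real[OF that] by (auto simp: mono_at_def real_points_def)
  qed
  have w_real: "of_real (Re (w a)) = w a" if "a < r" for a
    by (rule of_real_Re[OF real_weights[OF inj real that]])
  define V where "V = mat r r (\<lambda>(a, b). Re (mono_at (B ! b) (z a)))"
  have V: "V \<in> carrier_mat r r" by (simp add: V_def)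
  have "map_mat complex_of_real V = vandermonde B z"
    by (rule eq_matI) (auto simp: V_def vandermonde_def mono_real)
  then have dV: "det V \<noteq> 0" using det_vandermonde by (metis of_real_hom.hom_det of_real_0)
  note W = minv_inverse[OF V dV]
  define g where "g a i = Re (mono_at (?ml ! i) (z a))" for a i
  \<comment> \<open>The inverse of the real Vandermonde matrix \<open>V\<close>, padded with zero
    rows at the monomials outside \<open>B\<close>.\<close>
  define h where "h i c = (\<Sum>b<r. if ?ml ! i = B ! b then minv V $$ (b, c) else 0)" for i c
  have car: "hankel s n \<in> carrier_mat (length ?ml) (length ?ml)" by (simp add: hankel_def)
  have rep: "hankel s n $$ (i, j) = (\<Sum>a<r. Re (w a) * g a i * g a j)" if "i < length ?ml" "j < length ?ml" for i j
  proof -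
    have "?ml ! i \<in> set ?ml" "?ml ! j \<in> set ?ml" using that by auto
    then have d: "mdeg (?ml ! i) \<le> n" "mdeg (?ml ! j) \<le> n" by (simp_all only: mono_list_props mem_Collect_eq)
    have "complex_of_real (s (?ml ! i + ?ml ! j)) = (\<Sum>a<r. w a * (mono_at (?ml ! i) (z a) * mono_at (?ml ! j) (z a)))"
      by (rule moment_add[OF d])
    also have "\<dots> = (\<Sum>a<r. of_real (Re (w a)) * (of_real (g a i) * of_real (g a j)))"
      unfolding g_def by (intro sum.cong refl) (simp only: mono_real w_real lessThan_iff)
    also have "\<dots> = of_real (\<Sum>a<r. Re (w a) * g a i * g a j)" by (simp add: mult.assoc)
    finally have "s (?ml ! i + ?ml ! j) = (\<Sum>a<r. Re (w a) * g a i * g a j)" unfolding of_real_eq_iff .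
    then show ?thesis using that by (simp add: hankel_def)
  qed
  have gh: "(\<Sum>i<length ?ml. g a i * h i c) = (if a = c then 1 else 0)" if "a < r" "c < r" for a c
  proof -
    have "(\<Sum>i<length ?ml. g a i * h i c) = (\<Sum>b<r. \<Sum>i<length ?ml. if ?ml ! i = B ! b then Re (mono_at (?ml ! i) (z a)) * minv V $$ (b, c) else 0)"
      unfolding g_def h_def sum_distrib_left by (subst sum.swap) (intro sum.cong refl, auto)
    also have "\<dots> = (\<Sum>b<r. Re (mono_at (B ! b) (z a)) * minv V $$ (b, c))"
    proof (intro sum.cong refl)
      fix b assume "b \<in> {..<r}"
      then have "B ! b \<in> set ?ml" using deg_nth by (simp add: mono_list_props)
      then show "(\<Sum>i<length ?ml. if ?ml ! i = B ! b then Re (mono_at (?ml ! i) (z a)) * minv V $$ (b, c) else 0) =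
        Re (mono_at (B ! b) (z a)) * minv V $$ (b, c)"
        by (rule sum_single_nth[OF dist, where f = "\<lambda>l. Re (mono_at l (z a)) * minv V $$ (b, c)"])
    qed
    also have "\<dots> = (V * minv V) $$ (a, c)"
      unfolding mult_mat_index_sum[OF V W(1) that] using that by (intro sum.cong refl) (auto simp: V_def)
    finally show ?thesis unfolding W(2) using that by simp
  qed
  show "i_plus (hankel s n) = card {a. a < length B \<and> Re (w a) > 0}"
    "i_minus (hankel s n) = card {a. a < length B \<and> Re (w a) < 0}"
    using inertia_of_representation[where r = r and w = "\<lambda>a. Re (w a)" and g = g and h = h, OF car rep gh]
    by auto
qed

lemma vec_cnj_variety: "z \<in> variety s m \<longleftrightarrow> vec_cnj z \<in> variety s m"
proof -
  have p: "poly_at m p (vec_cnj z) = cnj (poly_at m p z)" for p and z :: "'a cpoint"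
    by (simp add: poly_at_def mono_at_cnj cnj_sum)
  show ?thesis by (simp add: variety_def p)
qed

theorem theorem7p4:
  fixes s :: "('d::{finite,linorder}) mindex \<Rightarrow> real"
    and n r :: nat
    and B :: "'d mindex list"
  assumes "r = hankel_rank s n"
    and "monomial_basis s n B"
  shows "((\<exists>\<mu> z w. atomic r z w \<mu> \<and> quasi_complex_representing s n \<mu>) \<longleftrightarrow>
          (\<exists>s'. rank_preserving_extension s n s' \<and>
             (\<forall>j. diagonalisable (map_mat complex_of_real (T_mat s s' B j)))))
    \<and> (\<forall>s'. rank_preserving_extension s n s' \<and>
             (\<forall>j. diagonalisable (map_mat complex_of_real (T_mat s s' B j))) \<longrightarrow>
         (\<exists>\<mu> z w. atomic r z w \<mu> \<and> quasi_complex_representing s n \<mu> \<and>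
            supp \<mu> = variety s' (n + 1) \<and>
            (r > 0 \<longrightarrow> (\<exists>B'. monomial_basis s n B' \<and> B' \<noteq> [] \<and> B' ! 0 = 0)) \<and>
            (\<forall>B'. monomial_basis s n B' \<and> B' \<noteq> [] \<and> B' ! 0 = 0 \<longrightarrow>
               Matrix.vec r w =
                 minv (transpose_mat (vandermonde B' z)) *\<^sub>v
                   (map_mat complex_of_real (basis_mat s B') *\<^sub>v unit_vec r 0)) \<and>
            (variety s' (n + 1) \<subseteq> real_points \<longrightarrow>
               signed_representing s n \<mu> \<and>
               (\<exists>\<mu>p \<mu>m. jordan_decomposition (\<lambda>A. Re (\<mu> A)) \<mu>p \<mu>m \<and>
                  card (pos_supp \<mu>p) = i_plus (hankel s n) \<and>
                  card (pos_supp \<mu>m) = i_minus (hankel s n)))))"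
    (is "(?atomic \<longleftrightarrow> ?flat) \<and> (\<forall>s'. ?ext s' \<longrightarrow> (\<exists>\<mu> z w. ?concl s' \<mu> z w))")
proof -
  have len: "length B = r" using monomial_basis_length[OF assms(2)] assms(1) by simp
  have deg: "\<forall>l\<in>set B. mdeg l \<le> n" using assms(2) by (simp add: monomial_basis_iff)
  \<comment> \<open>Serves the direction from extension to measure as well as the claims about each
    single extension.\<close>
  have main: "\<exists>\<mu> z w. ?concl s' \<mu> z w" if ext: "?ext s'" for s'
  proof -
    obtain z w where zw: "flat_atomic_hankel s' n B z w" and inj: "inj_on z {..<r}"
      using rank_preserving_extension_atomic[OF assms(2), of s'] ext unfolding len by blast
    interpret E: flat_atomic_hankel s' n B z w by (rule zw)
    define \<mu> where "\<mu> A = (\<Sum>a<r. w a * dirac (z a) A)" for A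
    have at: "atomic r z w \<mu>" using inj E.w_nonzero by (simp add: atomic_def \<mu>_def len)
    have supp: "supp \<mu> = variety s' (n + 1)"
      using supp_atomic[OF at] E.variety_eq by (simp add: len)
    have mom: "of_real (s g) = (\<Sum>a<r. w a * mono_at g (z a))" if "mdeg g \<le> 2 * n" for g
      using E.moment[of g] ext that by (simp add: len rank_preserving_extension_def)
    \<comment> \<open>The support is the zero set of real polynomials, which yields its closure
      under conjugation.\<close>
    have rep: "quasi_complex_representing s n \<mu>"
      unfolding quasi_complex_representing_def quasi_complex_measure_def supp
    proof (intro conjI allI impI)
      show "complex_measure \<mu>" unfolding \<mu>_def by (rule complex_measure_atoms)
      show "z \<in> variety s' (n + 1) \<longleftrightarrow> vec_cnj z \<in> variety s' (n + 1)" for z by (rule vec_cnj_variety)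
      show "has_cm_integral \<mu> (mono_at g) (of_real (s g))" if "mdeg g \<le> 2 * n" for g
        using mom[OF that] has_cm_integral_atomic[OF at mono_at_measurable] by simp
    qed
    \<comment> \<open>Atoms and weights were found with \<open>B\<close> but fit every monomial
      basis of the same matrix; the weight formula needs one that starts with
      \<open>0\<close>.\<close>
    have AH: "atomic_hankel s n B' z w" if B': "monomial_basis s n B'" for B'
    proof
      have len': "length B' = r" using monomial_basis_length[OF B'] assms(1) by simp
      show "mdeg l \<le> n" if "l \<in> set B'" for l using B' that by (auto simp: monomial_basis_iff)
      show "det (basis_mat s B') \<noteq> 0" by (rule monomial_basis_det[OF B'])
      show "w a \<noteq> 0" if "a < length B'" for a using E.w_nonzero that by (simp add: len len')
      show "of_real (s g) = (\<Sum>a<length B'. w a * mono_at g (z a))" if "mdeg g \<le> 2 * n" for g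
        using mom[OF that] by (simp add: len')
    qed
    interpret A: atomic_hankel s n B z w by (rule AH[OF assms(2)])
    have ex: "\<exists>B'. monomial_basis s n B' \<and> B' \<noteq> [] \<and> B' ! 0 = 0" if "r > 0"
    proof -
      \<comment> \<open>If all moments up to degree \<open>n\<close> vanished, the integrals against
        \<open>B\<close> would vanish, and with them all weights.\<close>
      have "\<exists>x. mdeg x \<le> n \<and> s x \<noteq> 0"
      proof (rule ccontr)
        assume no: "\<not> ?thesis"
        have "w 0 = 0"
        proof (rule A.vand_left_inj)
          fix b assume b: "b < length B"
          then have d: "mdeg (B ! b) \<le> n" by (rule A.deg_nth)
          then have "(\<Sum>a<length B. w a * mono_at (B ! b) (z a)) = of_real (s (B ! b))"
            by (intro A.moment[symmetric]) simp
          also have "\<dots> = 0" using no d by simp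
          finally show "(\<Sum>a<length B. w a * mono_at (B ! b) (z a)) = 0" .
        qed (use that len in simp)
        then show False using A.w_nonzero[of 0] that len by simp
      qed
      \<comment> \<open>Independence of \<open>[0]\<close> means that the column \<open>1\<close> is
        not zero.\<close>
      then have "indep s n [0]" by (auto simp: indep_def)
      then obtain B' where "monomial_basis s n ([0] @ B')" using indep_extend_basis[of s n "[0]"] by auto
      then show ?thesis by (intro exI[of _ "[0] @ B'"]) simp
    qed
    have wt: "Matrix.vec r w = minv (transpose_mat (vandermonde B' z)) *\<^sub>v
        (map_mat complex_of_real (basis_mat s B') *\<^sub>v unit_vec r 0)"
      if B': "monomial_basis s n B' \<and> B' \<noteq> [] \<and> B' ! 0 = 0" for B'
    proof -
      have mb: "monomial_basis s n B'" using B' by simp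
      have len': "length B' = r" using monomial_basis_length[OF mb] assms(1) by simp
      show ?thesis using atomic_hankel.weights[OF AH[OF mb]] B' unfolding len' by blast
    qed
    have sig: "signed_representing s n \<mu> \<and>
        (\<exists>\<mu>p \<mu>m. jordan_decomposition (\<lambda>A. Re (\<mu> A)) \<mu>p \<mu>m \<and>
           card (pos_supp \<mu>p) = i_plus (hankel s n) \<and> card (pos_supp \<mu>m) = i_minus (hankel s n))"
      if real: "variety s' (n + 1) \<subseteq> real_points"
    proof (intro conjI exI)
      have zr: "z a \<in> real_points" if "a < length B" for a
        using real E.variety_eq that by auto
      have wr: "w a \<in> \<real>" if "a < r" for a
        using A.real_weights[of a] inj zr that unfolding len by simp
      have "\<mu> A \<in> \<real>" for A
        unfolding \<mu>_def using wr by (intro sum_in_Reals) (auto simp: dirac_def indicator_def)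
      then show "signed_representing s n \<mu>"
        unfolding signed_representing_def supp using rep real by simp
      let ?P = "{a. a < r \<and> Re (w a) > 0}" and ?N = "{a. a < r \<and> Re (w a) < 0}"
      show "jordan_decomposition (\<lambda>A. Re (\<mu> A)) (atoms_measure ?P (\<lambda>a. Re (w a)) z)
          (atoms_measure ?N (\<lambda>a. - Re (w a)) z)"
        by (rule jordan_decomposition_atoms[OF inj atomic_Re_Im(1)[OF at]])
      note inertia = real_atomic_inertia[OF A.atomic_hankel_axioms inj[folded len] zr, unfolded len]
      have "pos_supp (atoms_measure ?P (\<lambda>a. Re (w a)) z) = z ` ?P" by (rule pos_supp_atoms_measure) auto
      moreover have "card (z ` ?P) = card ?P" by (intro card_image inj_on_subset[OF inj]) auto
      ultimately show "card (pos_supp (atoms_measure ?P (\<lambda>a. Re (w a)) z)) = i_plus (hankel s n)"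
        using inertia(1) by simp
      have "pos_supp (atoms_measure ?N (\<lambda>a. - Re (w a)) z) = z ` ?N" by (rule pos_supp_atoms_measure) auto
      moreover have "card (z ` ?N) = card ?N" by (intro card_image inj_on_subset[OF inj]) auto
      ultimately show "card (pos_supp (atoms_measure ?N (\<lambda>a. - Re (w a)) z)) = i_minus (hankel s n)"
        using inertia(2) by simp
    qed
    show ?thesis using at rep supp ex wt sig by blast
  qed
  have "?atomic \<Longrightarrow> ?flat"
    using atomic_rank_preserving_extension[OF assms(2)] unfolding len by blast
  moreover have "?flat \<Longrightarrow> ?atomic" using main by blast
  ultimately show ?thesis using main by blast
qed

end
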